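(* Let $\mathbf a\in L^\infty((0,T)\times\mathbb R^N;\mathbb R^N)$ be such that a transport flow exists (e.g. $\mathbf a$ satisfies the OSLC condition). For any $\pi^T\in L^\infty_{loc}(\mathbb R^N)$ there exists a unique reversible solution $\pi\in\mathcal R^T$ with $\pi(T,\cdot)=\pi^T$. It is given by $\pi(t,x)=\pi^T(X^T(t,x))\,J(X^T)(t,x)$ for any transport flow $X^T$ (this expression is independent of the choice of $X^T$).
   Context: OSLC: $\langle \mathbf a(t,y)-\mathbf a(t,x),y-x\rangle\le\alpha(t)|y-x|^2$ for a.e. $(t,x,y)$, some $\alpha\in L^1_+(0,T)$. $\mathcal W^T$ denotes the set of $\pi\in C([0,T],L^\infty_{loc}(\mathbb R^N)\text{ weak-*})$ which satisfy $\partial_t\pi+\operatorname{div}(\mathbf a\pi)=0$ in the sense of distributions on $(0,T)\times\mathbb R^N$. A transport flow is a map $X^T\in\mathrm{Lip}([0,T]\times\mathbb R^N;\mathbb R^N)$ (globally Lipschitz) such that $\partial_tX^T+\mathbf a\cdot\nabla X^T=0$ a.e. in $(0,T)\times\mathbb R^N$ (componentwise, $\nabla$ the spatial gradient), $X^T(T,x)=x$ for all $x$, and $J(X^T)=\det(\nabla X^T_1,\dots,\nabla X^T_N)\ge0$ a.e. A reversible solution is $\pi\in\mathcal W^T$ such that for some transport flow $X^T$, $\pi(t,x)=\pi(T,X^T(t,x))\,J(X^T)(t,x)$ for all $t\in[0,T]$ and a.e. $x$ (the right side is well defined in $L^\infty_{loc}$ since, at fixed $t$, $J(X^T)=0$ a.e.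 on $\{x: X^T(t,x)\in Z\}$ whenever $|Z|=0$); $\mathcal R^T$ denotes the set of reversible solutions. *)

theory Defs
  imports "HOL-Analysis.Analysis"
begin

definition Linf_loc :: "(real^'n \<Rightarrow> real) \<Rightarrow> bool" where
  "Linf_loc f \<longleftrightarrow> f \<in> borel_measurable lebesgue \<and>
     (\<forall>K. compact K \<longrightarrow> (\<exists>C. AE x in lebesgue. x \<in> K \<longrightarrow> \<bar>f x\<bar> \<le> C))"

definition Linf_field :: "real \<Rightarrow> (real \<Rightarrow> real^'n \<Rightarrow> real^'n) \<Rightarrow> bool" where
  "Linf_field T a \<longleftrightarrow>
     (\<lambda>z. a (fst z) (snd z)) \<in> borel_measurable (restrict_space lebesgue ({0<..<T} \<times> UNIV)) \<and>
     (\<exists>C. AE z in lebesgue. z \<in> {0<..<T} \<times> UNIV \<longrightarrow> norm (a (fst z) (snd z)) \<le> C)"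

definition dd :: "'a::real_normed_vector \<Rightarrow> ('a \<Rightarrow> 'b::real_normed_vector) \<Rightarrow> 'a \<Rightarrow> 'b" where
  "dd v f x = vector_derivative (\<lambda>s. f (x + s *\<^sub>R v)) (at 0)"

fun iter_dd :: "'a::real_normed_vector list \<Rightarrow> ('a \<Rightarrow> real) \<Rightarrow> 'a \<Rightarrow> real" where
  "iter_dd [] f = f"
| "iter_dd (v # vs) f = dd v (iter_dd vs f)"

definition smooth :: "('a::euclidean_space \<Rightarrow> real) \<Rightarrow> bool" where
  "smooth f \<longleftrightarrow> (\<forall>vs. set vs \<subseteq> Basis \<longrightarrow>
      continuous_on UNIV (iter_dd vs f) \<and>
      (\<forall>v\<in>Basis. \<forall>x. (\<lambda>s. iter_dd vs f (x + s *\<^sub>R v)) differentiable (at 0)))"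

definition test_fn :: "real \<Rightarrow> (real \<times> (real^'n) \<Rightarrow> real) \<Rightarrow> bool" where
  "test_fn T \<phi> \<longleftrightarrow> smooth \<phi> \<and>
     (\<exists>K. compact K \<and> K \<subseteq> {0<..<T} \<times> UNIV \<and> (\<forall>z. z \<notin> K \<longrightarrow> \<phi> z = 0))"

text \<open>Distributional solution of  d_t pi + div(a pi) = 0  on (0,T) x R^N.\<close>
definition dist_solution :: "real \<Rightarrow> (real \<Rightarrow> real^'n \<Rightarrow> real^'n) \<Rightarrow> (real \<Rightarrow> real^'n \<Rightarrow> real) \<Rightarrow> bool" where
  "dist_solution T a \<pi> \<longleftrightarrow> (\<forall>\<phi>. test_fn T \<phi> \<longrightarrow>
     (LINT t|lebesgue. LINT x|lebesgue.
        \<pi> t x * (dd (1, 0) \<phi> (t, x) + a t x \<bullet> (\<chi> j. dd (0, axis j 1) \<phi> (t, x)))) = 0)"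

definition weak_star_continuous :: "real \<Rightarrow> (real \<Rightarrow> real^'n \<Rightarrow> real) \<Rightarrow> bool" where
  "weak_star_continuous T \<pi> \<longleftrightarrow> (\<forall>\<psi> :: real^'n \<Rightarrow> real.
      integrable lebesgue \<psi> \<and> (\<exists>K. compact K \<and> (\<forall>x. x \<notin> K \<longrightarrow> \<psi> x = 0)) \<longrightarrow>
      continuous_on {0..T} (\<lambda>t. LINT x|lebesgue. \<pi> t x * \<psi> x))"

definition W_T :: "real \<Rightarrow> (real \<Rightarrow> real^'n \<Rightarrow> real^'n) \<Rightarrow> (real \<Rightarrow> real^'n \<Rightarrow> real) \<Rightarrow> bool" where
  "W_T T a \<pi> \<longleftrightarrow> (\<forall>t\<in>{0..T}. Linf_loc (\<pi> t)) \<and> weak_star_continuous T \<pi> \<and> dist_solution T a \<pi>"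

definition pd_x :: "(real \<Rightarrow> real^'n \<Rightarrow> real^'n) \<Rightarrow> real \<Rightarrow> 'n \<Rightarrow> real^'n \<Rightarrow> real^'n" where
  "pd_x X t j x = dd (axis j 1) (X t) x"

definition pd_t :: "(real \<Rightarrow> real^'n \<Rightarrow> real^'n) \<Rightarrow> real \<Rightarrow> real^'n \<Rightarrow> real^'n" where
  "pd_t X t x = vector_derivative (\<lambda>s. X s x) (at t)"

definition Jac :: "(real \<Rightarrow> real^'n \<Rightarrow> real^'n) \<Rightarrow> real \<Rightarrow> real^'n \<Rightarrow> real" where
  "Jac X t x = det (\<chi> i j. pd_x X t j x $ i)"

definition transport_flow :: "real \<Rightarrow> (real \<Rightarrow> real^'n \<Rightarrow> real^'n) \<Rightarrow> (real \<Rightarrow> real^'n \<Rightarrow> real^'n) \<Rightarrow> bool" where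
  "transport_flow T a X \<longleftrightarrow>
     (\<exists>L. L-lipschitz_on ({0..T} \<times> UNIV) (\<lambda>z. X (fst z) (snd z))) \<and>
     (AE z in lebesgue. z \<in> {0<..<T} \<times> UNIV \<longrightarrow>
        (\<lambda>s. X s (snd z)) differentiable (at (fst z)) \<and>
        (\<forall>j. (\<lambda>s. X (fst z) (snd z + s *\<^sub>R axis j 1)) differentiable (at 0)) \<and>
        pd_t X (fst z) (snd z) + (\<Sum>j\<in>UNIV. a (fst z) (snd z) $ j *\<^sub>R pd_x X (fst z) j (snd z)) = 0) \<and>
     (\<forall>x. X T x = x) \<and>
     (AE z in lebesgue. z \<in> {0<..<T} \<times> UNIV \<longrightarrow> Jac X (fst z) (snd z) \<ge> 0)"

definition reversible :: "real \<Rightarrow> (real \<Rightarrow> real^'n \<Rightarrow> real^'n) \<Rightarrow> (real \<Rightarrow> real^'n \<Rightarrow> real) \<Rightarrow> bool" where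
  "reversible T a \<pi> \<longleftrightarrow> W_T T a \<pi> \<and>
     (\<exists>X. transport_flow T a X \<and>
        (\<forall>t\<in>{0..T}. AE x in lebesgue. \<pi> t x = \<pi> T (X t x) * Jac X t x))"

end

(* A transport flow X of a field a satisfies the space-time identity
   d/dt (psi w J) integrated in x = integral of w J (psi_t + a . grad psi)
   for every test function psi and every Lipschitz w with w_t + a . grad w = 0, J being the Jacobian
   determinant of X.  It expresses that J is a null Lagrangian: the integral over R^N of
   det (grad f_1, ..., grad f_N) vanishes for Lipschitz f_i one of which has bounded support.  That is
   clear when all other f_i are linear, and it passes to general f_i one slot at a time: the functions
   allowed in a slot form a vector space closed under absolute values and under pointwise limits with
   bounded Lipschitz constants.

   With w = b(X) |X - Y|^2, for a second flow Y, the identity carries the value 0 at time T back to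
   time t; since J >= 0, X = Y almost everywhere on {J > 0}, and gradients of Lipschitz functions agree
   almost everywhere where the functions do.  Hence g(X) J does not depend on the flow.  Taking w = g(X)
   with smooth g, and then bounded Borel g by a monotone class argument, shows that g(X) J is a weakly
   continuous distributional solution and that J vanishes almost everywhere on preimages of null sets. *)
theory Submission
  imports Defs
begin

section \<open>Lebesgue's differentiation theorem for Lipschitz functions, by Stieltjes measures and
  Vitali coverings\<close>

section \<open>Differentiability of Lipschitz functions on the line\<close>

text \<open>\<open>Jac\<close> is built from partial derivatives, so differentiability is handled
  one direction at a time: it is proved on the line and carried over by Fubini. Sums, products and
  one-variable compositions are then differentiated pointwise, and for this reason smooth functions
  of the flow enter as products of one-variable functions of its components.

  The obstacle is that products of derivatives do not pass to weak limits in general. The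
  determinant does, since it is linear in each row: when one row changes, integration by parts moves
  the derivative onto the test function, and only the undifferentiated change of that row remains.
  Limits are therefore taken row by row, and the same device differentiates the integral of J in
  time.

  \<open>J >= 0\<close> is assumed for almost every (t, x), while the claims concern every t in
  [0, T]; continuity in t of integrals against J bridges the gap. As X is the identity at time T and
  Lipschitz in t, points move by a bounded distance. Functions of X(t, x) supported in a ball are
  thus supported in a larger ball in x, uniformly in t, and a cutoff in x that equals 1 there leaves
  no trace in the identity.\<close>

lemma emeasure_interval_measure_Ioo:
  fixes g :: "real \<Rightarrow> real"
  assumes g: "\<And>x y. x \<le> y \<Longrightarrow> g x \<le> g y" and c: "continuous_on UNIV g" and "a \<le> b"
  shows "emeasure (interval_measure g) {a<..<b} = ennreal (g b - g a)"
proof (cases "a = b")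
  case False
  have s: "emeasure (interval_measure g) {b..b} = 0"
    by (subst emeasure_interval_measure_Icc) (use g c in auto)
  have "emeasure (interval_measure g) {a<..b} = emeasure (interval_measure g) ({a<..<b} \<union> {b..b})"
    using False \<open>a \<le> b\<close> by (intro arg_cong[where f="emeasure _"]) auto
  also have "\<dots> = emeasure (interval_measure g) {a<..<b} + emeasure (interval_measure g) {b..b}"
    by (intro plus_emeasure[symmetric]) auto
  finally show ?thesis
    using s \<open>a \<le> b\<close> g c
    by (subst (asm) emeasure_interval_measure_Ioc)
       (auto simp: continuous_on_eq_continuous_at continuous_at_imp_continuous_within)
qed simp

text \<open>\<open>x / 2 + f x\<close> and \<open>x / 2 - f x\<close> are both nondecreasing and add
  up to x, so their Stieltjes measures add up to Lebesgue measure and each of them is dominated by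
  it.\<close>

lemma interval_measure_le_lborel:
  fixes f :: "real \<Rightarrow> real"
  assumes f: "(1/2)-lipschitz_on UNIV f" and A: "A \<in> sets borel"
  shows "emeasure (interval_measure (\<lambda>x. x / 2 + f x)) A \<le> emeasure lborel A"
proof -
  let ?n = "interval_measure (\<lambda>x. x / 2 + f x)" and ?m = "interval_measure (\<lambda>x. x / 2 - f x)"
  let ?r = "measure_of UNIV (sets borel) (\<lambda>A. emeasure ?n A + emeasure ?m A)"
  have l: "\<bar>f y - f x\<bar> \<le> (y - x) / 2" if "x \<le> y" for x y
    using lipschitz_onD[OF f, of x y] that by (auto simp: dist_real_def abs_if split: if_splits)
  have mono: "x / 2 + f x \<le> y / 2 + f y" "x / 2 - f x \<le> y / 2 - f y" if "x \<le> y" for x y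
    using l[OF that] by (simp_all only: abs_le_iff) (auto simp: field_simps)
  have cont: "continuous_on UNIV (\<lambda>x. x / 2 + f x)" "continuous_on UNIV (\<lambda>x. x / 2 - f x)"
    by (intro continuous_intros lipschitz_on_continuous_on[OF f]; simp)+
  have ms: "measure_space UNIV (sets borel) (\<lambda>A. emeasure ?n A + emeasure ?m A)"
    unfolding measure_space_def
  proof (intro conjI)
    show "sigma_algebra UNIV (sets (borel :: real measure))"
      using sets.sigma_algebra_axioms[of "borel :: real measure"] by simp
    show "positive (sets borel) (\<lambda>A. emeasure ?n A + emeasure ?m A)"
      by (simp add: positive_def)
    show "countably_additive (sets borel) (\<lambda>A. emeasure ?n A + emeasure ?m A)"
      by (rule countably_additiveI) (simp add: suminf_add[symmetric] suminf_emeasure image_subset_iff)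
  qed
  then have em: "emeasure ?r B = emeasure ?n B + emeasure ?m B" if "B \<in> sets borel" for B
    using that sets.sigma_sets_eq[of "borel :: real measure"]
    by (intro emeasure_measure_of_sigma) (auto simp: measure_space_def sigma_algebra_def)
  have "lborel = ?r"
  proof (rule lborel_eqI)
    fix a b :: real assume "\<And>c. c \<in> Basis \<Longrightarrow> a \<bullet> c \<le> b \<bullet> c"
    then have "a \<le> b" by simp
    have "emeasure ?r (box a b) = emeasure ?n {a<..<b} + emeasure ?m {a<..<b}"
      by (simp add: em box_real)
    also have "\<dots> = ennreal (b / 2 + f b - (a / 2 + f a)) + ennreal (b / 2 - f b - (a / 2 - f a))"
      using mono cont \<open>a \<le> b\<close> by (simp add: emeasure_interval_measure_Ioo)
    also have "\<dots> = ennreal (b - a)"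
      using mono[OF \<open>a \<le> b\<close>] by (subst ennreal_plus[symmetric]) (auto intro!: arg_cong[where f=ennreal] simp: field_simps)
    finally show "emeasure ?r (box a b) = ennreal (\<Prod>c\<in>Basis. (b - a) \<bullet> c)" by simp
  qed (use sets.sets_measure_of_eq[of "borel :: real measure"] in simp)
  then have "emeasure lborel A = emeasure ?n A + emeasure ?m A" using em[OF A] by simp
  then show ?thesis by simp
qed

text \<open>The intervals may contain x anywhere, also as an endpoint. Each is a closed ball about
  its own midpoint, and this is the form in which the Vitali covering theorem is applied.\<close>

lemma vitali_intervals:
  fixes E U :: "real set"
  assumes U: "open U" "E \<subseteq> U" and E: "E \<in> sets borel"
    and P: "\<And>x d. x \<in> E \<Longrightarrow> 0 < d \<Longrightarrow> \<exists>a b. a \<le> x \<and> x \<le> b \<and> a < b \<and> b - a < d \<and> P a b"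
  obtains C where "countable C" "\<And>a b. (a, b) \<in> C \<Longrightarrow> a < b \<and> {a..b} \<subseteq> U \<and> P a b"
    "disjoint_family_on (\<lambda>(a, b). {a..b}) C" "emeasure lborel (E - (\<Union>(a, b)\<in>C. {a..b})) = 0"
proof -
  define K where "K = {(a, b). a < b \<and> {a..b} \<subseteq> U \<and> P a b}"
  have cb: "cball ((a + b) / 2) ((b - a) / 2) = {a..b}" for a b :: real
    by (auto simp: cball_eq_atLeastAtMost field_simps)
  have cb': "cball ((fst i + snd i) / 2) ((snd i - fst i) / 2) = (case i of (a, b) \<Rightarrow> {a..b})" for i :: "real \<times> real"
    by (cases i) (simp add: cb)
  have pos: "0 < (snd i - fst i) / 2" if "i \<in> K" for i
    using that by (auto simp: K_def)
  have fine: "\<exists>i. i \<in> K \<and> x \<in> cball ((fst i + snd i) / 2) ((snd i - fst i) / 2) \<and> (snd i - fst i) / 2 < d"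
    if x: "x \<in> E" "0 < d" for x d
  proof -
    obtain e where e: "0 < e" "ball x e \<subseteq> U" using U x by (meson open_contains_ball subsetD)
    obtain a b where ab: "a \<le> x" "x \<le> b" "a < b" "b - a < min d e" "P a b"
      using P[OF x(1), of "min d e"] e x by auto
    have "{a..b} \<subseteq> ball x e" using ab by (auto simp: dist_real_def)
    then show ?thesis
      using ab e by (intro exI[of _ "(a, b)"]) (auto simp: K_def cb)
  qed
  obtain C where C: "countable C" "C \<subseteq> K"
     "pairwise (\<lambda>i j. disjnt (cball ((fst i + snd i) / 2) ((snd i - fst i) / 2)) (cball ((fst j + snd j) / 2) ((snd j - fst j) / 2))) C"
     "negligible (E - (\<Union>i \<in> C. cball ((fst i + snd i) / 2) ((snd i - fst i) / 2)))"
    by (rule Vitali_covering_theorem_cballs[OF pos fine])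
  have m: "E - (\<Union>(a, b)\<in>C. {a..b}) \<in> sets borel"
    using C(1) E by (intro sets.Diff sets.countable_UN') auto
  show thesis
  proof (rule that[of C])
    show "disjoint_family_on (\<lambda>(a, b). {a..b}) C"
      using C(3) unfolding cb' by (auto simp: disjoint_family_on_def pairwise_def disjnt_def)
    have "negligible (E - (\<Union>(a, b)\<in>C. {a..b}))" using C(4) unfolding cb' by simp
    then show "emeasure lborel (E - (\<Union>(a, b)\<in>C. {a..b})) = 0"
      using m by (simp add: negligible_iff_null_sets null_sets_completion_iff null_setsD1)
  qed (use C in \<open>auto simp: K_def\<close>)
qed

context
  fixes f g :: "real \<Rightarrow> real"
  assumes f: "(1/2)-lipschitz_on UNIV f" and g_def: "g = (\<lambda>x. x / 2 + f x)"
begin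

lemma slope_sum_mono: "x \<le> y \<Longrightarrow> g x \<le> g y" 
  using lipschitz_onD[OF f, of x y] by (auto simp: g_def dist_real_def abs_if split: if_splits)

lemma slope_sum_continuous: "continuous_on UNIV g"
  unfolding g_def by (intro continuous_intros lipschitz_on_continuous_on[OF f]; simp)

lemma interval_measure_slope_sum_le: "A \<in> sets borel \<Longrightarrow> emeasure (interval_measure g) A \<le> emeasure lborel A"
  unfolding g_def by (rule interval_measure_le_lborel[OF f])

text \<open>Disjoint intervals of slope at most p, inside an open U slightly larger than E, cover E
  up to a Lebesgue null set. That remainder is also null for the Stieltjes measure of g by
  domination, and on the intervals the bound is summed.\<close>

lemma low_slopes:
  assumes E: "E \<in> sets borel" and p: "0 \<le> p"
    and P: "\<And>x d. x \<in> E \<Longrightarrow> 0 < d \<Longrightarrow> \<exists>a b. a \<le> x \<and> x \<le> b \<and> a < b \<and> b - a < d \<and> g b - g a \<le> p * (b - a)"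
  shows "emeasure (interval_measure g) E \<le> ennreal p * emeasure lborel E"
proof -
  have "emeasure (interval_measure g) E \<le> ennreal p * emeasure lborel E + ennreal e" if e: "e > 0" for e :: real
  proof -
    \<comment> \<open>The denominator p + 1 keeps \<open>e'\<close> positive and
      \<open>p * e' \<le> e\<close> even when p = 0.\<close>
    define e' where "e' = e / (p + 1)"
    have e': "e' > 0" "p * e' \<le> e" using e p by (auto simp: e'_def field_simps)
    obtain U where U: "open U" "E \<subseteq> U" "emeasure lborel (U - E) < ennreal e'"
      using outer_regular_lborel[OF E e'(1)] by blast
    obtain C where C: "countable C" "\<And>a b. (a, b) \<in> C \<Longrightarrow> a < b \<and> {a..b} \<subseteq> U \<and> g b - g a \<le> p * (b - a)"
      "disjoint_family_on (\<lambda>(a, b). {a..b}) C" "emeasure lborel (E - (\<Union>(a, b)\<in>C. {a..b})) = 0"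
      using vitali_intervals[OF U(1,2) E P] by blast
    let ?V = "\<Union>(a, b)\<in>C. {a..b}"
    have V: "?V \<in> sets borel" using C(1) by (intro sets.countable_UN') auto
    have VU: "?V \<subseteq> E \<union> (U - E)" "U \<in> sets borel" using C(2) U by (fast, simp)
    have "emeasure (interval_measure g) E \<le> emeasure (interval_measure g) (?V \<union> (E - ?V))"
      using V E by (intro emeasure_mono) auto
    also have "\<dots> \<le> emeasure (interval_measure g) ?V + emeasure (interval_measure g) (E - ?V)"
      using V E by (intro emeasure_subadditive) auto
    also have "emeasure (interval_measure g) (E - ?V) \<le> 0"
      using interval_measure_slope_sum_le[of "E - ?V"] C(4) V E by auto
    also have "emeasure (interval_measure g) ?V = (\<integral>\<^sup>+i. emeasure (interval_measure g) (case i of (a, b) \<Rightarrow> {a..b}) \<partial>count_space C)"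
      using C by (intro emeasure_UN_countable) auto
    also have "\<dots> \<le> (\<integral>\<^sup>+i. ennreal p * emeasure lborel (case i of (a, b) \<Rightarrow> {a..b}) \<partial>count_space C)"
    proof (intro nn_integral_mono, clarsimp)
      fix a b assume "(a, b) \<in> C"
      then show "emeasure (interval_measure g) {a..b} \<le> ennreal p * emeasure lborel {a..b}"
        using C(2)[of a b] p by (subst emeasure_interval_measure_Icc) (auto intro!: slope_sum_mono slope_sum_continuous ennreal_leI simp: ennreal_mult[symmetric])
    qed
    also have "\<dots> = ennreal p * emeasure lborel ?V"
      using C by (subst nn_integral_cmult) (auto intro!: arg_cong[where f="\<lambda>x. _ * x"] emeasure_UN_countable[symmetric])
    also have "\<dots> \<le> ennreal p * emeasure lborel (E \<union> (U - E))"
      using VU E by (intro mult_left_mono emeasure_mono) auto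
    also have "\<dots> \<le> ennreal p * (emeasure lborel E + ennreal e')"
      using U E by (intro mult_left_mono order.trans[OF emeasure_subadditive] add_mono) auto
    also have "\<dots> \<le> ennreal p * emeasure lborel E + ennreal e"
      using e' p by (auto simp: distrib_left ennreal_mult[symmetric] intro!: add_left_mono ennreal_leI)
    finally show ?thesis by (simp add: add_right_mono)
  qed
  then show ?thesis by (rule ennreal_le_epsilon)
qed

text \<open>The same covering with the error on the other side: the excess U - E now counts in the
  Stieltjes measure of g, where domination by Lebesgue measure makes it at most e.\<close>

lemma high_slopes:
  assumes E: "E \<in> sets borel" and q: "0 \<le> q"
    and P: "\<And>x d. x \<in> E \<Longrightarrow> 0 < d \<Longrightarrow> \<exists>a b. a \<le> x \<and> x \<le> b \<and> a < b \<and> b - a < d \<and> q * (b - a) \<le> g b - g a"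
  shows "ennreal q * emeasure lborel E \<le> emeasure (interval_measure g) E"
proof -
  have "ennreal q * emeasure lborel E \<le> emeasure (interval_measure g) E + ennreal e" if e: "e > 0" for e :: real
  proof -
    obtain U where U: "open U" "E \<subseteq> U" "emeasure lborel (U - E) < ennreal e"
      using outer_regular_lborel[OF E e] by blast
    obtain C where C: "countable C" "\<And>a b. (a, b) \<in> C \<Longrightarrow> a < b \<and> {a..b} \<subseteq> U \<and> q * (b - a) \<le> g b - g a"
      "disjoint_family_on (\<lambda>(a, b). {a..b}) C" "emeasure lborel (E - (\<Union>(a, b)\<in>C. {a..b})) = 0"
      using vitali_intervals[OF U(1,2) E P] by blast
    let ?V = "\<Union>(a, b)\<in>C. {a..b}"
    have V: "?V \<in> sets borel" using C(1) by (intro sets.countable_UN') auto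
    have VU: "?V \<subseteq> E \<union> (U - E)" "U \<in> sets borel" using C(2) U by (fast, simp)
    have "emeasure lborel E \<le> emeasure lborel (?V \<union> (E - ?V))"
      using V E by (intro emeasure_mono) auto
    also have "\<dots> \<le> emeasure lborel ?V + emeasure lborel (E - ?V)"
      using V E by (intro emeasure_subadditive) auto
    finally have "ennreal q * emeasure lborel E \<le> ennreal q * emeasure lborel ?V"
      using C(4) by (simp add: mult_left_mono)
    also have "\<dots> = (\<integral>\<^sup>+i. ennreal q * emeasure lborel (case i of (a, b) \<Rightarrow> {a..b}) \<partial>count_space C)"
      using C by (subst nn_integral_cmult) (auto intro!: arg_cong[where f="\<lambda>x. _ * x"] emeasure_UN_countable)
    also have "\<dots> \<le> (\<integral>\<^sup>+i. emeasure (interval_measure g) (case i of (a, b) \<Rightarrow> {a..b}) \<partial>count_space C)"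
    proof (intro nn_integral_mono, clarsimp)
      fix a b assume "(a, b) \<in> C"
      then show "ennreal q * emeasure lborel {a..b} \<le> emeasure (interval_measure g) {a..b}"
        using C(2)[of a b] q by (subst emeasure_interval_measure_Icc) (auto intro!: slope_sum_mono slope_sum_continuous ennreal_leI simp: ennreal_mult[symmetric])
    qed
    also have "\<dots> = emeasure (interval_measure g) ?V"
      using C by (intro emeasure_UN_countable[symmetric]) auto
    also have "\<dots> \<le> emeasure (interval_measure g) (E \<union> (U - E))"
      using VU E by (intro emeasure_mono) auto
    also have "\<dots> \<le> emeasure (interval_measure g) E + emeasure (interval_measure g) (U - E)"
      using U E by (intro emeasure_subadditive) auto
    also have "emeasure (interval_measure g) (U - E) \<le> ennreal e"
      using U E interval_measure_slope_sum_le[of "U - E"] by auto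
    finally show ?thesis by (simp add: add_left_mono)
  qed
  then show ?thesis by (rule ennreal_le_epsilon)
qed

end

text \<open>A two-sided Dini condition: quotients below p occur at arbitrarily small steps. Applied
  to \<open>- g\<close> and \<open>- q\<close> it says that quotients above q occur, so one notion
  serves for lower and upper slopes.\<close>

definition low_set :: "(real \<Rightarrow> real) \<Rightarrow> real \<Rightarrow> real set" where
  "low_set g p = {x. \<forall>d>0. \<exists>h. h \<noteq> 0 \<and> \<bar>h\<bar> < d \<and> (g (x + h) - g x) / h < p}"

text \<open>Measurability comes from this form: for continuous g the uncountable union over h is a
  union of open sets, and the intersection is countable.\<close>

lemma low_set_Gdelta:
  "low_set g p = (\<Inter>n. \<Union>h\<in>{h. h \<noteq> 0 \<and> \<bar>h\<bar> < 1 / real (Suc n)}. {x. (g (x + h) - g x) / h < p})"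
proof (intro set_eqI iffI)
  fix x assume *: "x \<in> (\<Inter>n. \<Union>h\<in>{h. h \<noteq> 0 \<and> \<bar>h\<bar> < 1 / real (Suc n)}. {x. (g (x + h) - g x) / h < p})"
  show "x \<in> low_set g p"
    unfolding low_set_def
  proof safe
    fix d :: real assume "d > 0"
    then obtain n where "1 / real (Suc n) < d" using nat_approx_posE by metis
    moreover obtain h where "h \<noteq> 0" "\<bar>h\<bar> < 1 / real (Suc n)" "(g (x + h) - g x) / h < p" using * by blast
    ultimately show "\<exists>h. h \<noteq> 0 \<and> \<bar>h\<bar> < d \<and> (g (x + h) - g x) / h < p" by (meson less_trans)
  qed
next
  fix x assume "x \<in> low_set g p"
  then have "\<exists>h. h \<noteq> 0 \<and> \<bar>h\<bar> < 1 / real (Suc n) \<and> (g (x + h) - g x) / h < p" for n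
    unfolding low_set_def by simp
  then show "x \<in> (\<Inter>n. \<Union>h\<in>{h. h \<noteq> 0 \<and> \<bar>h\<bar> < 1 / real (Suc n)}. {x. (g (x + h) - g x) / h < p})"
    by blast
qed

text \<open>The quotients are bounded, so if their lower and upper limits coincided, the common
  value would be finite and hence a derivative. Otherwise two rationals fit strictly between
  them.\<close>

lemma not_differentiable_slopes:
  fixes g :: "real \<Rightarrow> real"
  assumes b: "\<And>h. h \<noteq> 0 \<Longrightarrow> \<bar>(g (x + h) - g x) / h\<bar> \<le> L" and nd: "\<not> g differentiable (at x)"
  shows "\<exists>p\<in>\<rat>. \<exists>q\<in>\<rat>. p < q \<and> x \<in> low_set g p \<and> x \<in> low_set (\<lambda>x. - g x) (- q)"
proof -
  define Q where "Q h = ereal ((g (x + h) - g x) / h)" for h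
  have nz: "eventually (\<lambda>h::real. h \<noteq> 0) (at 0)" by (simp add: eventually_at_filter)
  have lb: "ereal (-L) \<le> Liminf (at 0) Q"
    by (rule Liminf_bounded, rule eventually_mono[OF nz]) (use b in \<open>force simp: Q_def abs_le_iff simp del: abs_divide\<close>)
  have ub: "Limsup (at 0) Q \<le> ereal L"
    by (rule Limsup_bounded, rule eventually_mono[OF nz]) (use b in \<open>force simp: Q_def abs_le_iff simp del: abs_divide\<close>)
  have le: "Liminf (at 0) Q \<le> Limsup (at 0) Q" by (rule Liminf_le_Limsup) simp
  have "Liminf (at 0) Q \<noteq> Limsup (at 0) Q"
  proof
    assume eq: "Liminf (at 0) Q = Limsup (at 0) Q"
    obtain D where D: "Limsup (at 0) Q = ereal D"
      using lb ub eq by (cases "Limsup (at 0) Q") auto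
    have "(Q \<longlongrightarrow> ereal D) (at 0)" using eq D by (intro Liminf_eq_Limsup) auto
    then have "((\<lambda>h. (g (x + h) - g x) / h) \<longlongrightarrow> D) (at 0)" unfolding Q_def by simp
    then have "(g has_field_derivative D) (at x)" by (simp add: DERIV_def)
    then show False using nd by (simp add: real_differentiable_def)
  qed
  then have lt: "Liminf (at 0) Q < Limsup (at 0) Q" using le by simp
  then obtain z where z: "Liminf (at 0) Q < ereal z" "ereal z < Limsup (at 0) Q" using ereal_dense2 by blast
  then obtain z' where z': "ereal z < ereal z'" "ereal z' < Limsup (at 0) Q" using ereal_dense2 by blast
  obtain p where p: "p \<in> \<rat>" "z < p" "p < z'" using Rats_dense_in_real z'(1) by auto
  obtain q where q: "q \<in> \<rat>" "p < q" "q < z'" using Rats_dense_in_real p by auto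
  have 1: "\<exists>h. h \<noteq> 0 \<and> \<bar>h\<bar> < d \<and> (g (x + h) - g x) / h < p" if "d > 0" for d
  proof (rule ccontr)
    assume *: "\<not> ?thesis"
    have "eventually (\<lambda>h. ereal p \<le> Q h) (at 0)"
      unfolding eventually_at using * that by (intro exI[of _ d]) (force simp: Q_def dist_real_def)
    then have "ereal p \<le> Liminf (at 0) Q" by (rule Liminf_bounded)
    then show False using z(1) p(2) by (metis ereal_less_eq(3) less_le_not_le order.trans order_less_imp_le)
  qed
  have 2: "\<exists>h. h \<noteq> 0 \<and> \<bar>h\<bar> < d \<and> (- g (x + h) - - g x) / h < - q" if "d > 0" for d
  proof (rule ccontr)
    assume *: "\<not> ?thesis"
    have e: "(- g (x + h) - - g x) / h = - ((g (x + h) - g x) / h)" for h by (simp add: minus_divide_left)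
    have "eventually (\<lambda>h. Q h \<le> ereal q) (at 0)"
      unfolding eventually_at using * that unfolding e by (intro exI[of _ d]) (force simp: Q_def dist_real_def)
    then have "Limsup (at 0) Q \<le> ereal q" by (rule Limsup_bounded)
    then show False using z'(2) q(3) by (metis ereal_less_eq(3) less_le_not_le order.trans order_less_imp_le)
  qed
  show ?thesis using 1 2 p q unfolding low_set_def by blast
qed

lemma low_set_open_cover:
  fixes g :: "'a::topological_space \<Rightarrow> real"
  assumes "\<And>h. h \<in> H \<Longrightarrow> continuous_on UNIV (Q h)"
  shows "(\<Union>h\<in>H. {x. Q h x < (p::real)}) \<in> sets borel"
  using assms by (intro borel_open open_UN ballI open_Collect_less) auto

text \<open>On a set E with slopes below p and slopes above q at every point,
  \<open>q |E| \<le> mu(E) \<le> p |E|\<close> for the Stieltjes measure mu of g, so p < q forces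
  |E| = 0. Countably many rational pairs exhaust the exceptional set.\<close>

lemma half_lipschitz_AE_differentiable:
  fixes f :: "real \<Rightarrow> real"
  assumes f: "(1/2)-lipschitz_on UNIV f"
  shows "AE x in lborel. f differentiable (at x)"
proof -
  define g where "g = (\<lambda>x. x / 2 + f x)"
  have mono: "g x \<le> g y" if "x \<le> y" for x y using slope_sum_mono[OF f g_def that] .
  have cont: "continuous_on UNIV g" using slope_sum_continuous[OF f g_def] .
  have lip: "\<bar>g y - g x\<bar> \<le> \<bar>y - x\<bar>" for x y
    using lipschitz_onD[OF f, of x y] by (auto simp: g_def dist_real_def abs_if split: if_splits)
  have meas: "low_set k p \<in> sets borel" if kc: "continuous_on UNIV k" for k p
    unfolding low_set_Gdelta
  proof (rule sets.countable_INT'[OF _ _ image_subsetI])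
    fix n :: nat
    have *: "continuous_on UNIV (\<lambda>x. (k (x + h) - k x) / h)" if h: "h \<in> {h. h \<noteq> 0 \<and> \<bar>h\<bar> < 1 / real (Suc n)}" for h
      using h by (intro continuous_intros continuous_on_compose2[OF kc]) auto
    show "(\<Union>h\<in>{h. h \<noteq> 0 \<and> \<bar>h\<bar> < 1 / real (Suc n)}. {x. (k (x + h) - k x) / h < p}) \<in> sets borel"
      by (rule low_set_open_cover[OF *])
  qed auto
  have cont': "continuous_on UNIV (\<lambda>x. - g x)" by (intro continuous_intros cont)
  have null: "low_set g p \<inter> low_set (\<lambda>x. - g x) (- q) \<in> null_sets lborel" if pq: "p < q" for p q
  proof -
    \<comment> \<open>Bounded pieces have finite measure, so that the two inequalities can be
      compared as real numbers.\<close>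
    have "low_set g p \<inter> low_set (\<lambda>x. - g x) (- q) \<inter> {-real n<..<real n} \<in> null_sets lborel" (is "?E \<in> _") for n
    proof (cases "?E = {}")
      case False
      have E: "?E \<in> sets borel" using meas[OF cont] meas[OF cont'] by auto
      \<comment> \<open>Slopes of the monotone g are nonnegative, so a single point with a slope
        below p yields \<open>0 \<le> p\<close>, which \<open>low_slopes\<close> requires.\<close>
      obtain x where "x \<in> low_set g p" using False by auto
      then obtain h where h: "h \<noteq> 0" "(g (x + h) - g x) / h < p" unfolding low_set_def by (auto intro: that[of _] dest: spec[of _ 1])
      have "0 \<le> (g (x + h) - g x) / h" using mono[of x "x + h"] mono[of "x+h" x] by (cases "h > 0") (auto simp: zero_le_divide_iff)
      then have p: "0 \<le> p" using h by simp
      have lo: "emeasure (interval_measure g) ?E \<le> ennreal p * emeasure lborel ?E"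
      proof (rule low_slopes[OF f g_def E p])
        fix x d :: real assume "x \<in> ?E" "0 < d"
        then obtain h where h: "h \<noteq> 0" "\<bar>h\<bar> < d" "(g (x + h) - g x) / h < p" unfolding low_set_def by blast
        then show "\<exists>a b. a \<le> x \<and> x \<le> b \<and> a < b \<and> b - a < d \<and> g b - g a \<le> p * (b - a)"
          by (cases "h > 0"; intro exI[of _ "min x (x + h)"] exI[of _ "max x (x + h)"]) (auto simp: min_def max_def field_simps)
      qed
      have hi: "ennreal q * emeasure lborel ?E \<le> emeasure (interval_measure g) ?E"
      proof (rule high_slopes[OF f g_def E])
        fix x d :: real assume "x \<in> ?E" "0 < d"
        then obtain h where h: "h \<noteq> 0" "\<bar>h\<bar> < d" "(- g (x + h) - - g x) / h < - q" unfolding low_set_def by blast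
        then show "\<exists>a b. a \<le> x \<and> x \<le> b \<and> a < b \<and> b - a < d \<and> q * (b - a) \<le> g b - g a"
          by (cases "h > 0"; intro exI[of _ "min x (x + h)"] exI[of _ "max x (x + h)"]) (auto simp: min_def max_def field_simps)
      qed (use p pq in simp)
      have fin: "emeasure lborel ?E < \<infinity>"
        using E by (intro le_less_trans[OF emeasure_mono[of ?E "{-real n<..<real n}"]]) (auto simp: ennreal_less_top)
      then obtain m where m: "emeasure lborel ?E = ennreal m" "0 \<le> m"
        by (cases "emeasure lborel ?E") auto
      have "ennreal (q * m) \<le> ennreal (p * m)"
        using order.trans[OF hi lo] p pq m by (simp add: ennreal_mult)
      then have "q * m \<le> p * m" using p m(2) by (simp add: ennreal_le_iff)
      then have "m = 0" using pq m(2) mult_strict_right_mono[of p q m] by (cases "m = 0") auto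
      then show ?thesis using E m by (auto intro: null_setsI)
    qed auto
    then have "(\<Union>n. low_set g p \<inter> low_set (\<lambda>x. - g x) (- q) \<inter> {-real n<..<real n}) \<in> null_sets lborel"
      by (intro null_sets_UN') auto
    moreover have "(\<Union>n. low_set g p \<inter> low_set (\<lambda>x. - g x) (- q) \<inter> {-real n<..<real n}) = low_set g p \<inter> low_set (\<lambda>x. - g x) (- q)"
    proof -
      have "\<exists>n. x \<in> {-real n<..<real n}" for x
      proof -
        obtain n where "\<bar>x\<bar> < real n" using reals_Archimedean2 by blast
        then show ?thesis by (intro exI[of _ n]) (auto simp: abs_less_iff)
      qed
      then show ?thesis by blast
    qed
    ultimately show ?thesis by simp
  qed
  have N: "(\<Union>p\<in>\<rat>. \<Union>q\<in>\<rat> \<inter> {p<..}. low_set g p \<inter> low_set (\<lambda>x. - g x) (- q)) \<in> null_sets lborel"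
    by (intro null_sets_UN' countable_rat countable_Int1 null) auto
  show ?thesis
  proof (rule AE_I'[OF N], clarify)
    fix x assume nd: "\<not> f differentiable (at x)"
    have "\<not> g differentiable (at x)"
    proof
      assume "g differentiable (at x)"
      then have "(\<lambda>x. g x - x / 2) differentiable (at x)" by (intro derivative_intros) auto
      then show False using nd by (simp add: g_def)
    qed
    then have "\<exists>p\<in>\<rat>. \<exists>q\<in>\<rat>. p < q \<and> x \<in> low_set g p \<and> x \<in> low_set (\<lambda>x. - g x) (- q)"
      using lip[of "x + _" x] by (intro not_differentiable_slopes[where L=1]) (auto simp: abs_divide)
    then show "x \<in> (\<Union>p\<in>\<rat>. \<Union>q\<in>\<rat> \<inter> {p<..}. low_set g p \<inter> low_set (\<lambda>x. - g x) (- q))" by auto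
  qed
qed

lemma lipschitz_AE_differentiable_1d:
  fixes f :: "real \<Rightarrow> real"
  assumes f: "L-lipschitz_on UNIV f"
  shows "AE x in lborel. f differentiable (at x)"
proof -
  \<comment> \<open>Scaling to Lipschitz constant 1/2; the summand 1 keeps the denominator positive
    when L = 0.\<close>
  define c where "c = 1 / (2 * (L + 1))"
  have L: "0 \<le> L" using lipschitz_on_nonneg[OF f] .
  have "(\<bar>c\<bar> * L)-lipschitz_on UNIV (\<lambda>x. c * f x)" using lipschitz_on_cmult_real[OF f] by simp
  then have "(1/2)-lipschitz_on UNIV (\<lambda>x. c * f x)"
    by (rule lipschitz_on_mono) (use L in \<open>auto simp: c_def field_simps\<close>)
  then have "AE x in lborel. (\<lambda>x. c * f x) differentiable (at x)" by (rule half_lipschitz_AE_differentiable)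
  then show ?thesis
  proof (rule eventually_mono)
    fix x assume elim: "(\<lambda>x. c * f x) differentiable (at x)"
    then have "(\<lambda>x. inverse c * (c * f x)) differentiable (at x)" by (intro differentiable_mult differentiable_const elim)
    moreover have "(\<lambda>x. inverse c * (c * f x)) = f" using L by (simp add: c_def)
    ultimately show "f differentiable (at x)" by (simp only:)
  qed
qed

text \<open>The converse direction: a differentiable point never lies in both sets for p < q. The
  exceptional set is thereby exactly a Borel set, not just contained in one.\<close>

lemma low_set_derivative_le:
  assumes "(g has_real_derivative D) (at x)" and x: "x \<in> low_set g p"
  shows "D \<le> p"
proof (rule ccontr)
  assume "\<not> D \<le> p"
  moreover have "((\<lambda>h. (g (x + h) - g x) / h) \<longlongrightarrow> D) (at 0)" using assms by (simp add: DERIV_def)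
  ultimately have "eventually (\<lambda>h. p < (g (x + h) - g x) / h) (at 0)" by (intro order_tendstoD) auto
  then obtain d where "d > 0" "\<And>h. h \<noteq> 0 \<Longrightarrow> \<bar>h\<bar> < d \<Longrightarrow> p < (g (x + h) - g x) / h"
    unfolding eventually_at by (auto simp: dist_real_def)
  then show False using x unfolding low_set_def by (force dest: spec[of _ d])
qed

section \<open>Directional derivatives almost everywhere, and the vanishing integral of a
  derivative\<close>

section \<open>Partial derivatives of Lipschitz functions\<close>

text \<open>All translates \<open>B - s v\<close> have the measure of B, so averaging over s in
  [0, 1] changes nothing. After exchanging the integrals the inner one runs along a line in
  direction v. This is Fubini without a choice of coordinates.\<close>

lemma null_on_lines:
  fixes B :: "'a::euclidean_space set" and v :: 'a
  assumes B[measurable]: "B \<in> sets borel" and null: "\<And>x. {s::real. x + s *\<^sub>R v \<in> B} \<in> null_sets lborel"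
  shows "B \<in> null_sets lborel"
proof -
  have tr: "(\<integral>\<^sup>+x. indicator B (x + s *\<^sub>R v) \<partial>lborel) = emeasure lborel B" for s
  proof -
    have "(\<integral>\<^sup>+x. indicator B x \<partial>lborel) = (\<integral>\<^sup>+x. indicator B x \<partial>distr lborel borel ((+) (s *\<^sub>R v)))"
      by (simp add: lborel_distr_plus)
    also have "\<dots> = (\<integral>\<^sup>+x. indicator B (s *\<^sub>R v + x) \<partial>lborel)"
      by (subst nn_integral_distr) auto
    finally show ?thesis by (simp add: add.commute)
  qed
  have "emeasure lborel B = (\<integral>\<^sup>+s. indicator {0..1::real} s * (\<integral>\<^sup>+x. indicator B (x + s *\<^sub>R v) \<partial>lborel) \<partial>lborel)"
    unfolding tr by (subst nn_integral_multc) auto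
  also have "\<dots> = (\<integral>\<^sup>+s. (\<integral>\<^sup>+x. indicator {0..1::real} s * indicator B (x + s *\<^sub>R v) \<partial>lborel) \<partial>lborel)"
    by (intro nn_integral_cong nn_integral_cmult[symmetric]) measurable
  also have "\<dots> = (\<integral>\<^sup>+x. (\<integral>\<^sup>+s. indicator {0..1::real} s * indicator B (x + s *\<^sub>R v) \<partial>lborel) \<partial>lborel)"
    by (rule lborel_pair.Fubini') measurable
  also have "\<dots> = (\<integral>\<^sup>+x. 0 \<partial>(lborel :: 'a measure))"
  proof (intro nn_integral_cong)
    fix x :: 'a
    have "AE s in lborel. s \<notin> {s::real. x + s *\<^sub>R v \<in> B}" using null AE_not_in by blast
    then have "(\<integral>\<^sup>+s. indicator {0..1::real} s * indicator B (x + s *\<^sub>R v) \<partial>lborel) = (\<integral>\<^sup>+s. 0 \<partial>(lborel :: real measure))"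
      by (intro nn_integral_cong_AE) (auto elim!: eventually_mono)
    then show "(\<integral>\<^sup>+s. indicator {0..1::real} s * indicator B (x + s *\<^sub>R v) \<partial>lborel) = 0" by simp
  qed
  finally show ?thesis using B by (intro null_setsI) auto
qed

definition Lip :: "('a::metric_space \<Rightarrow> 'b::metric_space) \<Rightarrow> bool" where
  "Lip f \<longleftrightarrow> (\<exists>L. L-lipschitz_on UNIV f)"

definition bsupp :: "('a::real_normed_vector \<Rightarrow> real) \<Rightarrow> bool" where
  "bsupp f \<longleftrightarrow> (\<exists>R. \<forall>x. R \<le> norm x \<longrightarrow> f x = 0)"

lemma Lip_continuous_on: "Lip f \<Longrightarrow> continuous_on S f"
  using lipschitz_on_continuous_on continuous_on_subset unfolding Lip_def by blast

lemma Lip_measurable: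
  fixes f :: "'a::euclidean_space \<Rightarrow> 'b::euclidean_space"
  shows "Lip f \<Longrightarrow> f \<in> borel_measurable lebesgue"
  by (intro measurable_completion) (simp add: borel_measurable_continuous_onI Lip_continuous_on)

abbreviation diffable_along :: "'a::real_normed_vector \<Rightarrow> ('a \<Rightarrow> 'b::real_normed_vector) \<Rightarrow> 'a \<Rightarrow> bool" where
  "diffable_along v f x \<equiv> (\<lambda>s. f (x + s *\<^sub>R v)) differentiable (at (0::real))"

lemma differentiable_shift:
  fixes f :: "real \<Rightarrow> 'b::real_normed_vector"
  shows "(\<lambda>s. f (a + s)) differentiable (at x) \<longleftrightarrow> f differentiable (at (a + x))"
proof
  assume "(\<lambda>s. f (a + s)) differentiable (at x)"
  then have "(\<lambda>s. f (a + s)) differentiable (at ((\<lambda>y. y - a) (a + x)))" by simp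
  then have "((\<lambda>s. f (a + s)) \<circ> (\<lambda>y. y - a)) differentiable (at (a + x))"
    by (intro differentiable_chain_at) (auto intro!: derivative_intros)
  then show "f differentiable (at (a + x))" by (simp add: o_def)
next
  assume "f differentiable (at (a + x))"
  then have "(f \<circ> (\<lambda>y. a + y)) differentiable (at x)"
    by (intro differentiable_chain_at) (auto intro!: derivative_intros)
  then show "(\<lambda>s. f (a + s)) differentiable (at x)" by (simp add: o_def)
qed

text \<open>The slope conditions along the line through x, taken at parameter 0, depend on x through
  open conditions, so the exceptional set B is Borel. It consists exactly of the bad points, and
  each line meets it in a null set by the one-dimensional theorem.\<close>

lemma Lip_AE_diffable_along_lborel:
  fixes f :: "'a::euclidean_space \<Rightarrow> real"
  assumes "Lip f"
  shows "AE x in lborel. diffable_along v f x"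
proof -
  obtain L where L: "L-lipschitz_on UNIV f" using assms unfolding Lip_def by blast
  define low where "low k p = {x. 0 \<in> low_set (\<lambda>s. k (x + s *\<^sub>R v)) p}" for k :: "'a \<Rightarrow> real" and p
  have low_eq: "low k p = (\<Inter>n. \<Union>h\<in>{h. h \<noteq> 0 \<and> \<bar>h\<bar> < 1 / real (Suc n)}. {x. (k (x + h *\<^sub>R v) - k x) / h < p})" for k p
    unfolding low_def low_set_Gdelta by auto
  have meas: "low k p \<in> sets borel" if kc: "continuous_on UNIV k" for k p
    unfolding low_eq
  proof (rule sets.countable_INT'[OF _ _ image_subsetI])
    fix n :: nat
    have *: "continuous_on UNIV (\<lambda>x. (k (x + h *\<^sub>R v) - k x) / h)" if h: "h \<in> {h. h \<noteq> 0 \<and> \<bar>h\<bar> < 1 / real (Suc n)}" for h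
      using h by (intro continuous_intros continuous_on_compose2[OF kc]) auto
    show "(\<Union>h\<in>{h. h \<noteq> 0 \<and> \<bar>h\<bar> < 1 / real (Suc n)}. {x. (k (x + h *\<^sub>R v) - k x) / h < p}) \<in> sets borel"
      by (rule low_set_open_cover[OF *])
  qed auto
  define B where "B = (\<Union>p\<in>\<rat>. \<Union>q\<in>\<rat> \<inter> {p<..}. low f p \<inter> low (\<lambda>x. - f x) (- q))"
  have "B \<in> sets borel"
    unfolding B_def
    by (intro sets.countable_UN'' countable_rat countable_Int1 sets.Int meas continuous_intros Lip_continuous_on assms)
  have line: "(norm v * L)-lipschitz_on UNIV (\<lambda>s. f (x + s *\<^sub>R v))" for x
  proof (rule lipschitz_onI)
    fix s t :: real
    have "dist (f (x + s *\<^sub>R v)) (f (x + t *\<^sub>R v)) \<le> L * dist (x + s *\<^sub>R v) (x + t *\<^sub>R v)"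
      using lipschitz_onD[OF L] by blast
    also have "dist (x + s *\<^sub>R v) (x + t *\<^sub>R v) = norm v * dist s t"
      by (simp add: dist_norm flip: scaleR_diff_left)
    finally show "dist (f (x + s *\<^sub>R v)) (f (x + t *\<^sub>R v)) \<le> norm v * L * dist s t" by (simp add: ac_simps)
  qed (use lipschitz_on_nonneg[OF L] in simp)
  have bad: "x \<in> B" if "\<not> diffable_along v f x" for x
  proof -
    have "\<exists>p\<in>\<rat>. \<exists>q\<in>\<rat>. p < q \<and> 0 \<in> low_set (\<lambda>s. f (x + s *\<^sub>R v)) p \<and> 0 \<in> low_set (\<lambda>s. - f (x + s *\<^sub>R v)) (- q)"
    proof (rule not_differentiable_slopes[OF _ that])
      fix h :: real assume "h \<noteq> 0"
      then show "\<bar>(f (x + (0 + h) *\<^sub>R v) - f (x + 0 *\<^sub>R v)) / h\<bar> \<le> norm v * L"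
        using lipschitz_onD[OF line, of h 0 x] by (simp add: dist_real_def divide_le_eq)
    qed
    then show ?thesis by (auto simp: B_def low_def)
  qed
  have good: "x \<notin> B" if d: "diffable_along v f x" for x
  proof
    assume "x \<in> B"
    then obtain p q where pq: "p < q" "0 \<in> low_set (\<lambda>s. f (x + s *\<^sub>R v)) p" "0 \<in> low_set (\<lambda>s. - f (x + s *\<^sub>R v)) (- q)"
      by (auto simp: B_def low_def)
    obtain D where D: "((\<lambda>s. f (x + s *\<^sub>R v)) has_real_derivative D) (at 0)"
      using d unfolding real_differentiable_def by blast
    show False
      using low_set_derivative_le[OF D pq(2)] low_set_derivative_le[OF DERIV_minus[OF D] pq(3)] pq(1) by simp
  qed
  have "B \<in> null_sets lborel"
  proof (rule null_on_lines[OF \<open>B \<in> sets borel\<close>])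
    fix x
    have ae: "AE s in lborel. (\<lambda>s. f (x + s *\<^sub>R v)) differentiable (at s)"
      by (rule lipschitz_AE_differentiable_1d[OF line])
    have "AE s in lborel. s \<notin> {s::real. x + s *\<^sub>R v \<in> B}"
    proof (rule eventually_mono[OF ae])
      fix s assume "(\<lambda>s. f (x + s *\<^sub>R v)) differentiable (at s)"
      then have "(\<lambda>r. f (x + (s + r) *\<^sub>R v)) differentiable (at 0)"
        by (subst differentiable_shift[where f="\<lambda>s. f (x + s *\<^sub>R v)"]) simp
      then have "diffable_along v f (x + s *\<^sub>R v)" by (simp add: algebra_simps)
      then show "s \<notin> {s::real. x + s *\<^sub>R v \<in> B}" using good by blast
    qed
    moreover have "{s::real. x + s *\<^sub>R v \<in> B} \<in> sets borel"
    proof -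
      have "(\<lambda>s. x + s *\<^sub>R v) \<in> borel_measurable borel" by measurable
      from measurable_sets[OF this \<open>B \<in> sets borel\<close>] show ?thesis by (simp add: vimage_def)
    qed
    ultimately show "{s::real. x + s *\<^sub>R v \<in> B} \<in> null_sets lborel"
      by (simp add: AE_iff_null_sets)
  qed
  then show ?thesis
    by (rule AE_I') (use bad in auto)
qed

lemma Lip_AE_diffable_along:
  fixes f :: "'a::euclidean_space \<Rightarrow> real"
  shows "Lip f \<Longrightarrow> AE x in lebesgue. diffable_along v f x"
  by (simp add: AE_completion Lip_AE_diffable_along_lborel)

lemma dd_eqI: "((\<lambda>s. f (x + s *\<^sub>R v)) has_vector_derivative D) (at 0) \<Longrightarrow> dd v f x = D"
  unfolding dd_def by (rule vector_derivative_at)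

lemma dd_works: "diffable_along v f x \<Longrightarrow> ((\<lambda>s. f (x + s *\<^sub>R v)) has_vector_derivative dd v f x) (at 0)"
  unfolding dd_def by (simp add: vector_derivative_works)

text \<open>The steps 1/(n+1) form a sequence, which gives measurability of limits and access to
  dominated convergence.\<close>

definition dq :: "'a::real_normed_vector \<Rightarrow> ('a \<Rightarrow> real) \<Rightarrow> nat \<Rightarrow> 'a \<Rightarrow> real" where
  "dq v f n x = real (Suc n) * (f (x + (1 / real (Suc n)) *\<^sub>R v) - f x)"

lemma LIMSEQ_quotient:
  fixes g :: "real \<Rightarrow> 'a::real_normed_vector"
  assumes "(g has_vector_derivative D) (at a)"
  shows "(\<lambda>n. real (Suc n) *\<^sub>R (g (a + 1 / real (Suc n)) - g a)) \<longlonglongrightarrow> D"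
proof -
  have "((\<lambda>h. (1 / h) *\<^sub>R (g (a + h) - g a)) \<longlongrightarrow> D) (at 0)"
  proof -
    have "((\<lambda>y. (1 / norm (y - a)) *\<^sub>R (g y - (g a + (y - a) *\<^sub>R D))) \<longlongrightarrow> 0) (at a)"
      using assms unfolding has_vector_derivative_def has_derivative_within by simp
    then have "((\<lambda>h. (1 / norm h) *\<^sub>R (g (a + h) - (g a + h *\<^sub>R D))) \<longlongrightarrow> 0) (at 0)"
      by (subst (asm) LIM_offset_zero_iff[of a]) (auto simp: add.commute)
    then have "((\<lambda>h. norm ((1 / norm h) *\<^sub>R (g (a + h) - (g a + h *\<^sub>R D)))) \<longlongrightarrow> 0) (at 0)"
      by (rule tendsto_norm_zero)
    then have "((\<lambda>h. norm ((1 / h) *\<^sub>R (g (a + h) - g a) - D)) \<longlongrightarrow> 0) (at 0)"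
    proof (rule Lim_transform_eventually)
      show "\<forall>\<^sub>F h in at 0. norm ((1 / norm h) *\<^sub>R (g (a + h) - (g a + h *\<^sub>R D))) = norm ((1 / h) *\<^sub>R (g (a + h) - g a) - D)"
      proof (rule eventually_mono[of "\<lambda>h. h \<noteq> 0"])
        fix h :: real assume h: "h \<noteq> 0"
        have "(1 / h) *\<^sub>R (g (a + h) - g a) - D = (1 / h) *\<^sub>R (g (a + h) - (g a + h *\<^sub>R D))"
          using h by (simp add: algebra_simps)
        then show "norm ((1 / norm h) *\<^sub>R (g (a + h) - (g a + h *\<^sub>R D))) = norm ((1 / h) *\<^sub>R (g (a + h) - g a) - D)"
          by simp
      qed (simp add: eventually_at_filter)
    qed
    then show ?thesis using LIM_zero_iff tendsto_norm_zero_iff by blast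
  qed
  moreover have "filterlim (\<lambda>n. 1 / real (Suc n)) (at 0) sequentially"
    unfolding filterlim_at using LIMSEQ_inverse_real_of_nat by (auto simp: inverse_eq_divide)
  ultimately have "(\<lambda>n. (1 / (1 / real (Suc n))) *\<^sub>R (g (a + 1 / real (Suc n)) - g a)) \<longlonglongrightarrow> D"
    by (rule filterlim_compose)
  then show ?thesis by simp
qed

lemma dq_tendsto: "diffable_along v f x \<Longrightarrow> (\<lambda>n. dq v f n x) \<longlonglongrightarrow> dd v f x"
  using LIMSEQ_quotient[OF dd_works[where v=v and f=f and x=x]] by (simp add: dq_def)

lemma dq_bounded:
  assumes "L-lipschitz_on UNIV f" shows "\<bar>dq v f n x\<bar> \<le> L * norm v"
proof -
  have "\<bar>f (x + (1 / real (Suc n)) *\<^sub>R v) - f x\<bar> \<le> L * (norm v / real (Suc n))"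
    using lipschitz_onD[OF assms, of "x + (1 / real (Suc n)) *\<^sub>R v" x] by (simp add: dist_norm)
  then have "real (Suc n) * \<bar>f (x + (1 / real (Suc n)) *\<^sub>R v) - f x\<bar> \<le> real (Suc n) * (L * (norm v / real (Suc n)))"
    by (intro mult_left_mono) auto
  then show ?thesis by (simp add: dq_def abs_mult)
qed

lemma dd_bounded:
  assumes "L-lipschitz_on UNIV f" "diffable_along v f x" shows "\<bar>dd v f x\<bar> \<le> L * norm v"
  by (rule LIMSEQ_le_const2[OF tendsto_rabs[OF dq_tendsto[OF assms(2)]]]) (use dq_bounded[OF assms(1)] in blast)

lemma dq_continuous: "Lip f \<Longrightarrow> continuous_on UNIV (dq v f n)"
  unfolding dq_def
  by (drule Lip_continuous_on[where S=UNIV]) (auto intro!: continuous_intros elim!: continuous_on_compose2)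

text \<open>Completeness of Lebesgue measure absorbs the points without convergence;
  \<open>dd\<close> has no prescribed value where the derivative fails to exist.\<close>

lemma borel_measurable_LIMSEQ_AE:
  fixes f :: "'a::euclidean_space \<Rightarrow> real"
  assumes "\<And>n. u n \<in> borel_measurable lebesgue" and ae: "AE x in lebesgue. (\<lambda>n. u n x) \<longlonglongrightarrow> f x"
  shows "f \<in> borel_measurable lebesgue"
proof (rule borel_measurable_AE)
  show "(\<lambda>x. lim (\<lambda>n. u n x)) \<in> borel_measurable lebesgue"
    using assms(1) by (rule borel_measurable_lim_metric)
  show "AE x in lebesgue. lim (\<lambda>n. u n x) = f x"
    by (rule eventually_mono[OF ae]) (rule limI)
qed

lemma dd_measurable:
  fixes f :: "'a::euclidean_space \<Rightarrow> real"
  assumes "Lip f" shows "dd v f \<in> borel_measurable lebesgue"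
proof (rule borel_measurable_LIMSEQ_AE)
  show "dq v f n \<in> borel_measurable lebesgue" for n
    by (intro measurable_completion) (simp add: borel_measurable_continuous_onI dq_continuous assms)
  show "AE x in lebesgue. (\<lambda>n. dq v f n x) \<longlonglongrightarrow> dd v f x"
    using Lip_AE_diffable_along[OF assms, of v] by (rule eventually_mono) (rule dq_tendsto)
qed

lemma integrable_const_cball:
  "integrable lebesgue (\<lambda>x::'a::euclidean_space. C * indicator (cball a R) x :: real)"
proof (intro integrable_mult_right integrable_real_indicator)
  show "emeasure lebesgue (cball a R) < \<infinity>"
    using emeasure_bounded_finite[OF bounded_cball] by simp
qed simp

lemma integrable_bounded_support:
  fixes f :: "'a::euclidean_space \<Rightarrow> real"
  assumes f: "f \<in> borel_measurable lebesgue" and b: "AE x in lebesgue. \<bar>f x\<bar> \<le> C * indicator (cball 0 R) x"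
  shows "integrable lebesgue f"
proof (rule Bochner_Integration.integrable_bound[OF _ f])
  show "integrable lebesgue (\<lambda>x. C * indicator (cball 0 R) x :: real)"
    by (rule integrable_const_cball)
  show "AE x in lebesgue. norm (f x) \<le> norm (C * indicator (cball 0 R) x :: real)"
    by (rule eventually_mono[OF b]) (auto simp: indicator_def)
qed

lemma integrable_mult_bounded:
  fixes k E :: "'a::euclidean_space \<Rightarrow> real"
  assumes k: "integrable lebesgue k" and E: "E \<in> borel_measurable lebesgue" "AE x in lebesgue. \<bar>E x\<bar> \<le> M"
  shows "integrable lebesgue (\<lambda>x. k x * E x)"
proof (rule Bochner_Integration.integrable_bound)
  show "integrable lebesgue (\<lambda>x. \<bar>M\<bar> * k x)" using k by simp
  show "AE x in lebesgue. norm (k x * E x) \<le> norm (\<bar>M\<bar> * k x)"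
    using E(2)
  proof (rule eventually_mono)
    fix x assume "\<bar>E x\<bar> \<le> M"
    then have "\<bar>k x\<bar> * \<bar>E x\<bar> \<le> \<bar>k x\<bar> * \<bar>M\<bar>" by (intro mult_left_mono) auto
    then show "norm (k x * E x) \<le> norm (\<bar>M\<bar> * k x)" by (simp add: abs_mult mult.commute)
  qed
qed (use k E in auto)

lemma integrable_AE_eq:
  fixes f g :: "'a::euclidean_space \<Rightarrow> real"
  assumes f: "integrable lebesgue f" and eq: "AE x in lebesgue. f x = g x"
  shows "integrable lebesgue g" "(\<integral>x. f x \<partial>lebesgue) = (\<integral>x. g x \<partial>lebesgue)"
proof -
  have g: "g \<in> borel_measurable lebesgue" by (rule borel_measurable_AE[OF borel_measurable_integrable[OF f] eq])
  show "integrable lebesgue g" by (rule integrable_cong_AE_imp[OF f g]) (use eq in \<open>auto elim: eventually_mono\<close>)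
  show "(\<integral>x. f x \<partial>lebesgue) = (\<integral>x. g x \<partial>lebesgue)"
    by (rule integral_cong_AE[OF borel_measurable_integrable[OF f] g eq])
qed

lemma integral_bounded_support:
  fixes f :: "'a::euclidean_space \<Rightarrow> real"
  assumes "integrable lebesgue f" "AE x in lebesgue. \<bar>f x\<bar> \<le> C * indicator (cball 0 R) x"
  shows "\<bar>\<integral>x. f x \<partial>lebesgue\<bar> \<le> C * measure lebesgue (cball (0::'a) R)"
proof -
  have "\<bar>\<integral>x. f x \<partial>lebesgue\<bar> \<le> (\<integral>x. \<bar>f x\<bar> \<partial>lebesgue)" by (rule integral_abs_bound)
  also have "\<dots> \<le> (\<integral>x. C * indicator (cball 0 R) x \<partial>(lebesgue :: 'a measure))"
    using assms by (intro integral_mono_AE integrable_const_cball) auto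
  finally show ?thesis by simp
qed

lemma bsupp_bounded:
  fixes f :: "'a::euclidean_space \<Rightarrow> real"
  assumes "continuous_on UNIV f" and R: "\<And>x. R \<le> norm x \<Longrightarrow> f x = 0"
  shows "\<exists>C\<ge>0. \<forall>x. \<bar>f x\<bar> \<le> C * indicator (cball 0 R) x"
proof -
  have "compact (f ` cball 0 R)" by (intro compact_continuous_image continuous_on_subset[OF assms(1)]) auto
  then obtain C where C: "\<And>x. x \<in> cball 0 R \<Longrightarrow> \<bar>f x\<bar> \<le> C"
    using compact_imp_bounded[THEN bounded_iff[THEN iffD1]] by fastforce
  have "\<bar>f x\<bar> \<le> max C 0 * indicator (cball 0 R) x" for x
    using C[of x] R[of x] by (cases "norm x \<le> R") auto
  then show ?thesis by (intro exI[of _ "max C 0"]) auto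
qed

lemma integral_translate:
  fixes f :: "'a::euclidean_space \<Rightarrow> real"
  assumes "continuous_on UNIV f"
  shows "(\<integral>x. f (x + c) \<partial>lebesgue) = (\<integral>x. f x \<partial>lebesgue)"
proof -
  have m: "f \<in> borel_measurable borel" "(\<lambda>x. f (x + c)) \<in> borel_measurable borel"
    using assms by (auto intro!: borel_measurable_continuous_onI continuous_on_compose2[OF assms] continuous_intros)
  have "(\<integral>x. f x \<partial>lborel) = (\<integral>x. f x \<partial>distr lborel borel ((+) c))" by (simp add: lborel_distr_plus)
  also have "\<dots> = (\<integral>x. f (c + x) \<partial>lborel)" using m by (subst integral_distr) auto
  finally show ?thesis using m by (simp add: integral_completion add.commute)
qed

text \<open>Each difference quotient has integral 0 by translation invariance. The quotients are
  bounded by the Lipschitz constant on a common ball, so the limit inherits the value.\<close>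

lemma integral_dd_zero:
  fixes f :: "'a::euclidean_space \<Rightarrow> real"
  assumes "Lip f" "bsupp f"
  shows "(\<integral>x. dd v f x \<partial>lebesgue) = 0"
proof -
  obtain L where L: "L-lipschitz_on UNIV f" using assms(1) unfolding Lip_def by blast
  obtain R where R: "\<And>x. R \<le> norm x \<Longrightarrow> f x = 0" using assms(2) unfolding bsupp_def by blast
  have c: "continuous_on UNIV f" by (rule Lip_continuous_on[OF assms(1)])
  obtain C where C': "0 \<le> C" "\<forall>x. \<bar>f x\<bar> \<le> C * indicator (cball 0 R) x" using bsupp_bounded[OF c R] by blast
  have C: "\<bar>f x\<bar> \<le> C" for x
    using C'(2)[rule_format, of x] C'(1) by (cases "norm x \<le> R") auto
  have int: "integrable lebesgue (\<lambda>x. f (x + c))" for c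
  proof (rule integrable_bounded_support[where C=C and R="\<bar>R\<bar> + norm c"])
    have "continuous_on UNIV (\<lambda>x. f (x + c))"
      by (intro continuous_on_compose2[OF \<open>continuous_on UNIV f\<close>] continuous_intros) auto
    then show "(\<lambda>x. f (x + c)) \<in> borel_measurable lebesgue"
      by (intro measurable_completion) (simp add: borel_measurable_continuous_onI)
    show "AE x in lebesgue. \<bar>f (x + c)\<bar> \<le> C * indicator (cball 0 (\<bar>R\<bar> + norm c)) x"
    proof (rule AE_I2)
      fix x
      have "f (x + c) = 0" if "\<bar>R\<bar> + norm c < norm x"
        using norm_triangle_ineq4[of "x + c" c] that by (intro R) auto
      then show "\<bar>f (x + c)\<bar> \<le> C * indicator (cball 0 (\<bar>R\<bar> + norm c)) x"
        using C by (auto simp: indicator_def)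
    qed
  qed
  have z: "(\<integral>x. dq v f n x \<partial>lebesgue) = 0" for n
    unfolding dq_def using int[of 0] int[of "(1 / real (Suc n)) *\<^sub>R v"] by (simp add: integral_translate[OF c])
  have "(\<lambda>n. \<integral>x. dq v f n x \<partial>lebesgue) \<longlonglongrightarrow> (\<integral>x. dd v f x \<partial>lebesgue)"
  proof (rule integral_dominated_convergence[where w="\<lambda>x. (L * norm v) * indicator (cball 0 (\<bar>R\<bar> + norm v)) x"])
    show "dd v f \<in> borel_measurable lebesgue" by (rule dd_measurable[OF assms(1)])
    show "dq v f n \<in> borel_measurable lebesgue" for n
      by (intro measurable_completion) (simp add: borel_measurable_continuous_onI dq_continuous assms)
    show "integrable lebesgue (\<lambda>x. (L * norm v) * indicator (cball 0 (\<bar>R\<bar> + norm v)) x :: real)"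
      by (rule integrable_const_cball)
    show "AE x in lebesgue. (\<lambda>n. dq v f n x) \<longlonglongrightarrow> dd v f x"
      using Lip_AE_diffable_along[OF assms(1), of v] by (rule eventually_mono) (rule dq_tendsto)
    fix n
    show "AE x in lebesgue. norm (dq v f n x) \<le> (L * norm v) * indicator (cball 0 (\<bar>R\<bar> + norm v)) x"
    proof (rule AE_I2)
      fix x
      have "dq v f n x = 0" if x: "\<bar>R\<bar> + norm v < norm x"
      proof -
        have "norm ((1 / real (Suc n)) *\<^sub>R v) \<le> norm v" by (simp add: divide_le_eq mult_le_cancel_left1)
        moreover have "norm x - norm ((1 / real (Suc n)) *\<^sub>R v) \<le> norm (x + (1 / real (Suc n)) *\<^sub>R v)"
          using norm_triangle_ineq4[of "x + (1 / real (Suc n)) *\<^sub>R v" "(1 / real (Suc n)) *\<^sub>R v"] by simp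
        ultimately have "R \<le> norm (x + (1 / real (Suc n)) *\<^sub>R v)" using x by linarith
        moreover have "R \<le> norm x" using x norm_ge_zero[of v] by linarith
        ultimately show ?thesis using R by (simp add: dq_def)
      qed
      then show "norm (dq v f n x) \<le> (L * norm v) * indicator (cball 0 (\<bar>R\<bar> + norm v)) x"
        using dq_bounded[OF L, of v n x] by (auto simp: indicator_def)
    qed
  qed
  then have "(\<lambda>n::nat. 0::real) \<longlonglongrightarrow> (\<integral>x. dd v f x \<partial>lebesgue)" unfolding z .
  then show ?thesis by (simp add: LIMSEQ_const_iff)
qed

section \<open>Lipschitz functions with bounded support are dense in L1 and suffice to test
  weak-star convergence\<close>

section \<open>Density\<close>

lemma Lip_add: "Lip f \<Longrightarrow> Lip g \<Longrightarrow> Lip (\<lambda>x. f x + g x)" for f g :: "'a::metric_space \<Rightarrow> 'b::real_normed_vector"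
  unfolding Lip_def by (blast intro: lipschitz_on_add)
lemma Lip_diff: "Lip f \<Longrightarrow> Lip g \<Longrightarrow> Lip (\<lambda>x. f x - g x)" for f g :: "'a::metric_space \<Rightarrow> 'b::real_normed_vector"
  unfolding Lip_def by (blast intro: lipschitz_on_diff)
lemma Lip_cmult: "Lip f \<Longrightarrow> Lip (\<lambda>x. c * f x)" for f :: "'a::metric_space \<Rightarrow> real"
  unfolding Lip_def by (blast intro: lipschitz_on_cmult_real)
lemma Lip_const: "Lip (\<lambda>x. c)" unfolding Lip_def by (blast intro: lipschitz_on_constant)

lemma Lip_compose: "Lip f \<Longrightarrow> Lip g \<Longrightarrow> Lip (\<lambda>x. f (g x))"
  unfolding Lip_def using lipschitz_on_compose2 lipschitz_on_subset by (metis subset_UNIV)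

lemma Lip_abs_fun: "Lip (abs :: real \<Rightarrow> real)"
  unfolding Lip_def by (intro exI[of _ 1] lipschitz_onI) (auto simp: dist_real_def)

lemma Lip_abs: "Lip f \<Longrightarrow> Lip (\<lambda>x. \<bar>f x\<bar>)" for f :: "'a::metric_space \<Rightarrow> real"
  by (rule Lip_compose[OF Lip_abs_fun])

lemma Lip_max: "Lip f \<Longrightarrow> Lip g \<Longrightarrow> Lip (\<lambda>x. max (f x) (g x))" for f g :: "'a::metric_space \<Rightarrow> real"
proof -
  assume *: "Lip f" "Lip g"
  have "(\<lambda>x. max (f x) (g x)) = (\<lambda>x. (1/2) * ((f x + g x) + \<bar>f x - g x\<bar>))"
    by (auto simp: max_def fun_eq_iff)
  then show ?thesis using * by (simp only:) (intro Lip_cmult Lip_add Lip_abs Lip_diff)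
qed

lemma Lip_norm: "Lip (norm :: 'a::real_normed_vector \<Rightarrow> real)"
  unfolding Lip_def
  by (intro exI[of _ 1] lipschitz_onI) (auto simp: dist_norm norm_triangle_ineq3)

lemma Lip_infdist: "Lip (\<lambda>x. infdist x A)"
  unfolding Lip_def
  by (intro exI[of _ 1] lipschitz_onI) (auto simp: dist_real_def infdist_triangle_abs)

lemma Lip_bsupp_bounded:
  fixes f :: "'a::euclidean_space \<Rightarrow> real"
  assumes "Lip f" "bsupp f"
  obtains C R where "0 \<le> C" "0 \<le> R" "\<And>x. \<bar>f x\<bar> \<le> C * indicator (cball 0 R) x" "\<And>x. R \<le> norm x \<Longrightarrow> f x = 0"
proof -
  obtain R where R: "\<And>x. R \<le> norm x \<Longrightarrow> f x = 0" using assms(2) unfolding bsupp_def by blast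
  have R': "\<And>x. max R 0 \<le> norm x \<Longrightarrow> f x = 0" using R by simp
  obtain C where "C \<ge> 0" "\<forall>x. \<bar>f x\<bar> \<le> C * indicator (cball 0 (max R 0)) x"
    using bsupp_bounded[OF Lip_continuous_on[OF assms(1)] R'] by blast
  then show ?thesis using that[of C "max R 0"] R' by simp
qed

lemma Lip_bsupp_integrable:
  fixes f :: "'a::euclidean_space \<Rightarrow> real"
  assumes "Lip f" "bsupp f" shows "integrable lebesgue f"
proof -
  obtain C R where "\<And>x. \<bar>f x\<bar> \<le> C * indicator (cball 0 R) x" using Lip_bsupp_bounded[OF assms] by metis
  then show ?thesis by (intro integrable_bounded_support Lip_measurable assms) auto
qed

lemma Lip_mult:
  fixes f g :: "'a::metric_space \<Rightarrow> real"
  assumes f: "Lip f" "\<And>x. \<bar>f x\<bar> \<le> A" and g: "Lip g" "\<And>x. \<bar>g x\<bar> \<le> B"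
  shows "Lip (\<lambda>x. f x * g x)"
proof -
  obtain L M where L: "L-lipschitz_on UNIV f" "M-lipschitz_on UNIV g" using f g unfolding Lip_def by blast
  have nn: "0 \<le> L" "0 \<le> M" using L lipschitz_on_nonneg by blast+
  have AB: "0 \<le> A" "0 \<le> B" using f(2)[of undefined] g(2)[of undefined] by linarith+
  show ?thesis unfolding Lip_def
  proof (intro exI lipschitz_onI)
    fix x y :: 'a
    have "f x * g x - f y * g y = f x * (g x - g y) + (f x - f y) * g y" by (simp add: algebra_simps)
    then have "\<bar>f x * g x - f y * g y\<bar> \<le> \<bar>f x\<bar> * \<bar>g x - g y\<bar> + \<bar>f x - f y\<bar> * \<bar>g y\<bar>"
      by (metis abs_mult abs_triangle_ineq)
    also have "\<dots> \<le> A * (M * dist x y) + (L * dist x y) * B"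
      using lipschitz_onD[OF L(1), of x y] lipschitz_onD[OF L(2), of x y] nn AB
      by (intro add_mono mult_mono f g) (auto simp: dist_real_def)
    finally show "dist (f x * g x) (f y * g y) \<le> (A * M + L * B) * dist x y" by (simp add: dist_real_def algebra_simps)
  qed (use nn AB in simp)
qed

text \<open>A product of Lipschitz functions is Lipschitz only when both are bounded, so g is first
  truncated; the truncation is invisible because f vanishes where it acts.\<close>

lemma Lip_mult_bsupp:
  fixes f g :: "'a::euclidean_space \<Rightarrow> real"
  assumes f: "Lip f" "bsupp f" and g: "Lip g"
  shows "Lip (\<lambda>x. f x * g x)"
proof -
  obtain C R where R: "0 \<le> R" "\<And>x. R \<le> norm x \<Longrightarrow> f x = 0" and C: "\<And>x. \<bar>f x\<bar> \<le> C * indicator (cball 0 R) x"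
    using Lip_bsupp_bounded[OF f] by metis
  have "0 \<le> C" using C[of 0] R by (simp add: order.trans[OF abs_ge_zero])
  then have fC: "\<bar>f x\<bar> \<le> C" for x using C[of x] \<open>0 \<le> C\<close> by (cases "norm x \<le> R") auto
  define h where "h x = max 0 (R + 1 - max R (norm x))" for x :: 'a
  have h: "Lip h" unfolding h_def by (intro Lip_max Lip_const Lip_diff Lip_norm)
  have hR: "h x = 0" if "R + 1 \<le> norm x" for x using that by (simp add: h_def)
  have hb: "\<bar>h x\<bar> \<le> 1" for x using R(1) by (auto simp: h_def)
  obtain M where M: "M-lipschitz_on UNIV g" using g unfolding Lip_def by blast
  have "\<exists>G. \<forall>x\<in>cball 0 (R + 1). \<bar>g x\<bar> \<le> G"
  proof -
    have "compact (g ` cball 0 (R + 1))" by (intro compact_continuous_image Lip_continuous_on g) auto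
    then show ?thesis using compact_imp_bounded[THEN bounded_iff[THEN iffD1]] by fastforce
  qed
  then obtain G where G: "\<And>x. x \<in> cball 0 (R + 1) \<Longrightarrow> \<bar>g x\<bar> \<le> G" by blast
  \<comment> \<open>The truncation of g to [-G, G], where G bounds g on a ball containing the
    support of f; the minimum is written through maxima.\<close>
  define k where "k x = max (- G) (- max (- g x) (- G))" for x
  have Lk: "Lip k" unfolding k_def using Lip_cmult[OF g, of "-1"] Lip_cmult[OF Lip_max[OF _ Lip_const], of "\<lambda>x. - g x" "-1" "- G"]
    by (intro Lip_max Lip_const) simp
  have "0 \<le> G" using G[of 0] R(1) by auto
  then have kG: "\<bar>k x\<bar> \<le> G" for x by (auto simp: k_def)
  have "f x * g x = f x * k x" for x
    using G[of x] R(2)[of x] by (cases "norm x \<le> R + 1") (auto simp: k_def abs_le_iff)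
  then have "(\<lambda>x. f x * g x) = (\<lambda>x. f x * k x)" by (rule ext)
  then show ?thesis using Lip_mult[OF f(1) fC Lk kG] by (simp only:)
qed

lemma bsupp_mult: "bsupp f \<Longrightarrow> bsupp (\<lambda>x. f x * g x)" "bsupp f \<Longrightarrow> bsupp (\<lambda>x. g x * f x)"
  unfolding bsupp_def by fastforce+

lemma bsupp_add: "bsupp f \<Longrightarrow> bsupp g \<Longrightarrow> bsupp (\<lambda>x. f x + g x)"
proof -
  assume "bsupp f" "bsupp g"
  then obtain R S where "\<And>x. R \<le> norm x \<Longrightarrow> f x = 0" "\<And>x. S \<le> norm x \<Longrightarrow> g x = 0" unfolding bsupp_def by blast
  then show ?thesis unfolding bsupp_def by (intro exI[of _ "max R S"]) simp
qed

text \<open>To be read for integrable f: the integral of a nonintegrable function is 0 by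
  convention.\<close>

definition L1_approx :: "('a::euclidean_space \<Rightarrow> real) \<Rightarrow> bool" where
  "L1_approx f \<longleftrightarrow> (\<forall>e>0. \<exists>h. Lip h \<and> bsupp h \<and> (\<integral>x. \<bar>f x - h x\<bar> \<partial>lebesgue) < e)"

lemma L1_approx_limit:
  fixes f :: "'a::euclidean_space \<Rightarrow> real"
  assumes s: "\<And>i. integrable lebesgue (s i)" "\<And>i. L1_approx (s i)"
    and f: "integrable lebesgue f" and lim: "AE x in lebesgue. (\<lambda>i. s i x) \<longlonglongrightarrow> f x"
    and w: "integrable lebesgue w" and b: "\<And>i. AE x in lebesgue. \<bar>s i x\<bar> \<le> w x"
  shows "L1_approx f"
  unfolding L1_approx_def
proof (intro allI impI)
  fix e :: real assume "e > 0"
  have "(\<lambda>i. \<integral>x. \<bar>f x - s i x\<bar> \<partial>lebesgue) \<longlonglongrightarrow> (\<integral>x. 0 \<partial>(lebesgue :: 'a measure))"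
  proof (rule integral_dominated_convergence[where w="\<lambda>x. \<bar>f x\<bar> + w x"])
    show "AE x in lebesgue. (\<lambda>i. \<bar>f x - s i x\<bar>) \<longlonglongrightarrow> 0"
      using lim by (rule eventually_mono) (auto intro!: tendsto_eq_intros)
    show "AE x in lebesgue. norm \<bar>f x - s i x\<bar> \<le> \<bar>f x\<bar> + w x" for i
      using b[of i] by (rule eventually_mono) auto
  qed (use s f w in \<open>auto intro!: borel_measurable_integrable\<close>)
  then have "eventually (\<lambda>i. (\<integral>x. \<bar>f x - s i x\<bar> \<partial>lebesgue) < e / 2) sequentially"
    using \<open>e > 0\<close> by (intro order_tendstoD) auto
  then obtain i where i: "(\<integral>x. \<bar>f x - s i x\<bar> \<partial>lebesgue) < e / 2" by (auto simp: eventually_sequentially)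
  obtain h where h: "Lip h" "bsupp h" "(\<integral>x. \<bar>s i x - h x\<bar> \<partial>lebesgue) < e / 2"
    using s(2)[of i, unfolded L1_approx_def, rule_format, of "e / 2"] \<open>e > 0\<close> by auto
  have ih: "integrable lebesgue h" by (rule Lip_bsupp_integrable[OF h(1,2)])
  have "(\<integral>x. \<bar>f x - h x\<bar> \<partial>lebesgue) \<le> (\<integral>x. \<bar>f x - s i x\<bar> + \<bar>s i x - h x\<bar> \<partial>lebesgue)"
    using f s(1)[of i] ih by (intro integral_mono) auto
  also have "\<dots> = (\<integral>x. \<bar>f x - s i x\<bar> \<partial>lebesgue) + (\<integral>x. \<bar>s i x - h x\<bar> \<partial>lebesgue)"
    using f s(1)[of i] ih by (intro Bochner_Integration.integral_add) auto
  finally show "\<exists>h. Lip h \<and> bsupp h \<and> (\<integral>x. \<bar>f x - h x\<bar> \<partial>lebesgue) < e" using h i by force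
qed

lemma L1_approx_compact:
  fixes K :: "'a::euclidean_space set"
  assumes K: "compact K"
  shows "L1_approx (indicator K)"
\<comment> \<open>The distance to the empty set is 0 by convention, so the functions s below would
  be constantly 1 there.\<close>
proof (cases "K = {}")
  case True
  have "Lip (\<lambda>x::'a. 0::real)" "bsupp (\<lambda>x::'a. 0)" by (auto simp: Lip_const bsupp_def)
  then show ?thesis unfolding L1_approx_def by (intro allI impI exI[of _ "\<lambda>x. 0"]) (simp add: True)
next
  case False
  obtain r where r: "K \<subseteq> cball 0 r" using compact_imp_bounded[OF K] unfolding bounded_pos by (metis mem_cball_0 subsetI)
  define s where "s i x = max 0 (1 - real (Suc i) * infdist x K)" for i and x :: 'a
  have sL: "Lip (s i)" for i unfolding s_def by (intro Lip_max Lip_const Lip_diff Lip_cmult Lip_infdist)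
  \<comment> \<open>Points at distance at least 1 from K are outside every tent, which gives one
    dominating ball for the whole sequence.\<close>
  have s0: "s i x = 0" if x: "r + 1 \<le> norm x" for i x
  proof -
    have "1 \<le> infdist x K"
      unfolding infdist_notempty[OF False]
    proof (rule cINF_greatest[OF False])
      fix y assume "y \<in> K"
      then have "norm y \<le> r" using r by auto
      then show "1 \<le> dist x y" using x norm_triangle_ineq2[of x y] by (simp add: dist_norm)
    qed
    then have "1 \<le> real (Suc i) * infdist x K" by (metis mult_mono' mult_1 of_nat_0_le_iff zero_le_one le_numeral_extra(1) Suc_le_eq nat_le_real_less less_eq_Suc_le of_nat_1 le_add1 plus_1_eq_Suc of_nat_mono)
    then show ?thesis by (simp add: s_def)
  qed
  have sb: "bsupp (s i)" for i unfolding bsupp_def using s0 by blast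
  show ?thesis
  proof (rule L1_approx_limit[where s=s and w="indicator (cball 0 (r + 1))"])
    show "integrable lebesgue (s i)" for i by (rule Lip_bsupp_integrable[OF sL sb])
    show "L1_approx (s i)" for i
      unfolding L1_approx_def using sL sb by (intro allI impI exI[of _ "s i"]) simp
    show "integrable lebesgue (indicator K :: 'a \<Rightarrow> real)"
      using K emeasure_bounded_finite[OF compact_imp_bounded[OF K]] by (intro integrable_real_indicator) (auto simp: borel_compact)
    show "integrable lebesgue (indicator (cball (0::'a) (r + 1)) :: 'a \<Rightarrow> real)" using integrable_const_cball[of 1] by simp
    show "AE x in lebesgue. \<bar>s i x\<bar> \<le> indicator (cball 0 (r + 1)) x" for i
    proof (rule AE_I2)
      fix x show "\<bar>s i x\<bar> \<le> indicator (cball 0 (r + 1)) x"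
        using s0[of x i] infdist_nonneg[of x K] by (cases "norm x \<le> r + 1") (auto simp: s_def)
    qed
    show "AE x in lebesgue. (\<lambda>i. s i x) \<longlonglongrightarrow> indicator K x"
    proof (rule AE_I2)
      fix x
      show "(\<lambda>i. s i x) \<longlonglongrightarrow> indicator K x"
      proof (cases "x \<in> K")
        case True then show ?thesis by (simp add: s_def)
      next
        case False
        then have pos: "infdist x K > 0"
          using \<open>K \<noteq> {}\<close> K by (metis compact_imp_closed in_closed_iff_infdist_zero infdist_nonneg less_eq_real_def)
        obtain N where N: "1 / infdist x K < real N" using reals_Archimedean2 by blast
        have "eventually (\<lambda>i. s i x = 0) sequentially"
        proof (rule eventually_sequentiallyI[of N])
          fix i assume "N \<le> i"
          then have "1 / infdist x K < real (Suc i)" using N by simp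
          then have "1 < real (Suc i) * infdist x K" using pos by (simp add: field_simps)
          then show "s i x = 0" by (simp add: s_def)
        qed
        then show ?thesis using False by (simp add: tendsto_eventually)
      qed
    qed
  qed
qed

text \<open>Up to a null set A is a countable union of compact sets; their finite unions increase to
  it and are dominated by the indicator of A.\<close>

lemma L1_approx_indicator:
  fixes A :: "'a::euclidean_space set"
  assumes A: "A \<in> sets lebesgue" "emeasure lebesgue A < \<infinity>"
  shows "L1_approx (indicator A)"
proof -
  obtain C T where C: "fsigma C" "T \<in> null_sets lebesgue" "C \<union> T = A" using lebesgue_set_almost_fsigma[OF A(1)] .
  obtain F :: "nat \<Rightarrow> 'a set" where F: "range F \<subseteq> Collect compact" "C = \<Union>(range F)"
    using C(1) fsigma_Union_compact by metis
  define G where "G i = (\<Union>j\<le>i. F j)" for i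
  have G: "compact (G i)" for i unfolding G_def using F(1) by (intro compact_UN) auto
  have GA: "G i \<subseteq> A" for i using F C by (auto simp: G_def)
  have ia: "integrable lebesgue (indicator A :: 'a \<Rightarrow> real)" using A by (intro integrable_real_indicator) auto
  show ?thesis
  proof (rule L1_approx_limit[where s="\<lambda>i. indicator (G i)" and w="indicator A"])
    show "integrable lebesgue (indicator (G i) :: 'a \<Rightarrow> real)" for i
      using G[of i] emeasure_bounded_finite[OF compact_imp_bounded[OF G[of i]]] by (intro integrable_real_indicator) (auto simp: borel_compact)
    show "L1_approx (indicator (G i))" for i by (rule L1_approx_compact[OF G])
    show "AE x in lebesgue. \<bar>indicator (G i) x :: real\<bar> \<le> indicator A x" for i
      using GA[of i] by (intro AE_I2) (auto simp: indicator_def)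
    have "AE x in lebesgue. x \<notin> T" using C(2) by (rule AE_not_in)
    then show "AE x in lebesgue. (\<lambda>i. indicator (G i) x :: real) \<longlonglongrightarrow> indicator A x"
    proof (rule eventually_mono)
      fix x assume x: "x \<notin> T"
      show "(\<lambda>i. indicator (G i) x :: real) \<longlonglongrightarrow> indicator A x"
      proof (cases "x \<in> A")
        case True
        then obtain j where "x \<in> F j" using x C F by auto
        then have "eventually (\<lambda>i. indicator (G i) x = (1::real)) sequentially"
          by (intro eventually_sequentiallyI[of j] indicator_simps(1)) (auto simp: G_def)
        then show ?thesis using True by (simp add: tendsto_eventually)
      next
        case False
        then have "indicator (G i) x = (0::real)" for i using GA[of i] by (intro indicator_simps(2)) auto
        then show ?thesis using False by simp
      qed
    qed
  qed (use ia in auto)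
qed

lemma L1_approx_cmult: assumes "L1_approx f" shows "L1_approx (\<lambda>x. c * f x)"
proof (cases "c = 0")
  case True
  have "Lip (\<lambda>x::'a. 0::real)" "bsupp (\<lambda>x::'a. 0)" by (auto simp: Lip_const bsupp_def)
  then show ?thesis unfolding L1_approx_def by (intro allI impI exI[of _ "\<lambda>x. 0"]) (simp add: True)
next
  case False
  show ?thesis unfolding L1_approx_def
  proof (intro allI impI)
    fix e :: real assume "e > 0"
    then obtain h where h: "Lip h" "bsupp h" "(\<integral>x. \<bar>f x - h x\<bar> \<partial>lebesgue) < e / \<bar>c\<bar>"
      using assms False unfolding L1_approx_def by (meson divide_pos_pos zero_less_abs_iff)
    have "(\<integral>x. \<bar>c * f x - c * h x\<bar> \<partial>lebesgue) = \<bar>c\<bar> * (\<integral>x. \<bar>f x - h x\<bar> \<partial>lebesgue)"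
      by (simp add: abs_mult flip: right_diff_distrib)
    also have "\<dots> < e" using h(3) False by (simp add: field_simps)
    finally show "\<exists>h. Lip h \<and> bsupp h \<and> (\<integral>x. \<bar>c * f x - h x\<bar> \<partial>lebesgue) < e"
      using h by (intro exI[of _ "\<lambda>x. c * h x"]) (auto intro: Lip_cmult bsupp_mult)
  qed
qed

lemma L1_approx_add:
  fixes f g :: "'a::euclidean_space \<Rightarrow> real"
  assumes i: "integrable lebesgue f" "integrable lebesgue g" and "L1_approx f" "L1_approx g"
  shows "L1_approx (\<lambda>x. f x + g x)"
  unfolding L1_approx_def
proof (intro allI impI)
  fix e :: real assume "e > 0"
  obtain h where h: "Lip h" "bsupp h" "(\<integral>x. \<bar>f x - h x\<bar> \<partial>lebesgue) < e / 2"
    using assms(3)[unfolded L1_approx_def, rule_format, of "e / 2"] \<open>e > 0\<close> by auto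
  obtain k where k: "Lip k" "bsupp k" "(\<integral>x. \<bar>g x - k x\<bar> \<partial>lebesgue) < e / 2"
    using assms(4)[unfolded L1_approx_def, rule_format, of "e / 2"] \<open>e > 0\<close> by auto
  note ih = Lip_bsupp_integrable[OF h(1,2)] Lip_bsupp_integrable[OF k(1,2)]
  have "(\<integral>x. \<bar>f x + g x - (h x + k x)\<bar> \<partial>lebesgue) \<le> (\<integral>x. \<bar>f x - h x\<bar> + \<bar>g x - k x\<bar> \<partial>lebesgue)"
    using i ih by (intro integral_mono) auto
  also have "\<dots> = (\<integral>x. \<bar>f x - h x\<bar> \<partial>lebesgue) + (\<integral>x. \<bar>g x - k x\<bar> \<partial>lebesgue)"
    using i ih by (intro Bochner_Integration.integral_add) auto
  finally show "\<exists>h. Lip h \<and> bsupp h \<and> (\<integral>x. \<bar>f x + g x - h x\<bar> \<partial>lebesgue) < e"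
    using h k by (intro exI[of _ "\<lambda>x. h x + k x"]) (auto intro: Lip_add bsupp_add)
qed

lemma integrable_imp_L1_approx:
  fixes f :: "'a::euclidean_space \<Rightarrow> real"
  assumes "integrable lebesgue f"
  shows "L1_approx f"
  using assms
proof (induction rule: integrable_induct)
  case (base A c)
  then show ?case using L1_approx_cmult[OF L1_approx_indicator[OF base], of c] by (simp add: mult.commute)
next
  case (add f g) then show ?case by (intro L1_approx_add)
next
  case (lim f s)
  then show ?case by (intro L1_approx_limit[where s=s and f=f and w="\<lambda>x. 2 * \<bar>f x\<bar>"]) auto
qed

text \<open>Replacing f by a Lipschitz h costs at most the uniform bound times the L1 distance, for
  every \<open>Dn n\<close> and for D alike; the remaining third is the assumed convergence.\<close>

lemma weak_star_density:
  fixes D :: "'a::euclidean_space \<Rightarrow> real"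
  assumes D: "\<And>n. Dn n \<in> borel_measurable lebesgue" "\<And>n. AE x in lebesgue. \<bar>Dn n x\<bar> \<le> M"
    "D \<in> borel_measurable lebesgue" "AE x in lebesgue. \<bar>D x\<bar> \<le> M"
    and conv: "\<And>h. Lip h \<Longrightarrow> bsupp h \<Longrightarrow> (\<lambda>n. \<integral>x. h x * Dn n x \<partial>lebesgue) \<longlonglongrightarrow> (\<integral>x. h x * D x \<partial>lebesgue)"
    and f: "integrable lebesgue f"
  shows "(\<lambda>n. \<integral>x. f x * Dn n x \<partial>lebesgue) \<longlonglongrightarrow> (\<integral>x. f x * D x \<partial>lebesgue)"
proof (rule LIMSEQ_I)
  fix e :: real assume e: "e > 0"
  \<comment> \<open>Strictly positive whatever the sign of M, so that one may divide by it.\<close>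
  define M' where "M' = \<bar>M\<bar> + 1"
  have M': "M' > 0" "M \<le> M'" by (auto simp: M'_def)
  obtain h where h: "Lip h" "bsupp h" "(\<integral>x. \<bar>f x - h x\<bar> \<partial>lebesgue) < e / (3 * M')"
    using integrable_imp_L1_approx[OF f, unfolded L1_approx_def, rule_format, of "e / (3 * M')"] e M' by auto
  have ih: "integrable lebesgue h" by (rule Lip_bsupp_integrable[OF h(1,2)])
  have err: "\<bar>(\<integral>x. f x * E x \<partial>lebesgue) - (\<integral>x. h x * E x \<partial>lebesgue)\<bar> < e / 3"
    if E: "E \<in> borel_measurable lebesgue" "AE x in lebesgue. \<bar>E x\<bar> \<le> M" for E
  proof -
    note int = integrable_mult_bounded[OF _ E]
    have "\<bar>(\<integral>x. f x * E x \<partial>lebesgue) - (\<integral>x. h x * E x \<partial>lebesgue)\<bar> = \<bar>\<integral>x. (f x - h x) * E x \<partial>lebesgue\<bar>"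
      using int[OF f] int[OF ih] by (simp add: left_diff_distrib)
    also have "\<dots> \<le> (\<integral>x. \<bar>(f x - h x) * E x\<bar> \<partial>lebesgue)" by (rule integral_abs_bound)
    also have "\<dots> \<le> (\<integral>x. M' * \<bar>f x - h x\<bar> \<partial>lebesgue)"
    proof (rule integral_mono_AE)
      show "AE x in lebesgue. \<bar>(f x - h x) * E x\<bar> \<le> M' * \<bar>f x - h x\<bar>"
        using E(2)
      proof (rule eventually_mono)
        fix x assume "\<bar>E x\<bar> \<le> M"
        then have "\<bar>f x - h x\<bar> * \<bar>E x\<bar> \<le> \<bar>f x - h x\<bar> * M'" using M' by (intro mult_left_mono) auto
        then show "\<bar>(f x - h x) * E x\<bar> \<le> M' * \<bar>f x - h x\<bar>" by (simp add: abs_mult mult.commute)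
      qed
    qed (use int[of "\<lambda>x. f x - h x"] f ih in auto)
    also have "\<dots> = M' * (\<integral>x. \<bar>f x - h x\<bar> \<partial>lebesgue)" by simp
    also have "\<dots> < M' * (e / (3 * M'))" using h(3) M' by (intro mult_strict_left_mono) auto
    also have "\<dots> = e / 3" using M' by simp
    finally show ?thesis .
  qed
  obtain N where N: "\<And>n. n \<ge> N \<Longrightarrow> norm ((\<integral>x. h x * Dn n x \<partial>lebesgue) - (\<integral>x. h x * D x \<partial>lebesgue)) < e / 3"
    using LIMSEQ_D[OF conv[OF h(1,2)], of "e / 3"] e by auto
  show "\<exists>N. \<forall>n\<ge>N. norm ((\<integral>x. f x * Dn n x \<partial>lebesgue) - (\<integral>x. f x * D x \<partial>lebesgue)) < e"
  proof (intro exI allI impI)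
    fix n assume "n \<ge> N"
    from N[OF this] err[OF D(1,2), of n] err[OF D(3,4)]
    show "norm ((\<integral>x. f x * Dn n x \<partial>lebesgue) - (\<integral>x. f x * D x \<partial>lebesgue)) < e" unfolding real_norm_def by linarith
  qed
qed

section \<open>Row-wise multilinear algebra of determinants\<close>

section \<open>Determinants\<close>

text \<open>Rows are a function of the index, so that replacing a row is the function update
  \<open>r(k := v)\<close>.\<close>

definition rdet :: "('n \<Rightarrow> real^'n) \<Rightarrow> real" where "rdet r = det (\<chi> i. r i)"

lemma rdet_linear: "linear (\<lambda>v. rdet (r(k := v)))"
proof (rule linearI)
  show "rdet (r(k := u + v)) = rdet (r(k := u)) + rdet (r(k := v))" for u v
    unfolding rdet_def fun_upd_def by (rule det_row_add)
  show "rdet (r(k := c *\<^sub>R v)) = c *\<^sub>R rdet (r(k := v))" for c v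
    unfolding rdet_def fun_upd_def using det_row_mul[of k c "\<lambda>_. v" r] by (simp only: scalar_mult_eq_scaleR real_scaleR_def)
qed

lemma rdet_eq_rows: "i \<noteq> j \<Longrightarrow> r i = r j \<Longrightarrow> rdet r = 0"
  unfolding rdet_def by (rule det_identical_rows[of i j]) (auto simp: row_def)

lemma rdet_zero_row: "r k = 0 \<Longrightarrow> rdet r = 0"
  using linear_0[OF rdet_linear[of r k]] by (metis fun_upd_triv)

text \<open>Laplace expansion along row k; the cofactor appears as the determinant with row k
  replaced by a unit vector.\<close>

lemma rdet_expand: "rdet (r(k := v)) = (\<Sum>j\<in>UNIV. v $ j * rdet (r(k := axis j 1)))"
proof -
  have "rdet (r(k := v)) = rdet (r(k := (\<Sum>j\<in>UNIV. v $ j *\<^sub>R axis j 1)))"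
    by (simp add: basis_expansion scalar_mult_eq_scaleR[symmetric])
  also have "\<dots> = (\<Sum>j\<in>UNIV. v $ j * rdet (r(k := axis j 1)))"
    by (subst linear_sum[OF rdet_linear]) (simp add: linear_scale[OF rdet_linear])
  finally show ?thesis .
qed

lemma rdet_row_operation: "i \<noteq> l \<Longrightarrow> rdet (r(l := r l + c *\<^sub>R r i)) = rdet r"
proof -
  assume il: "i \<noteq> l"
  have "rdet (r(l := r l + c *\<^sub>R r i)) = rdet (r(l := r l)) + c * rdet (r(l := r i))"
    by (simp only: linear_add[OF rdet_linear] linear_scale[OF rdet_linear] real_scaleR_def)
  also have "rdet (r(l := r i)) = 0" using il by (intro rdet_eq_rows[of i l]) auto
  finally show ?thesis by (simp only: fun_upd_triv mult_zero_right add_0_right)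
qed

text \<open>Subtracting multiples of the unit row i from the other rows removes their k-th entries;
  the induction runs over the set of rows already cleared.\<close>

lemma rdet_clear_column:
  "rdet (r(i := axis k 1)) = rdet (\<lambda>l. if l = i then axis k 1 else r l - (r l $ k) *\<^sub>R axis k 1)"
proof -
  have "rdet (r(i := axis k 1)) = rdet (\<lambda>l. if l = i then axis k 1 else if l \<in> S then r l - (r l $ k) *\<^sub>R axis k 1 else r l)"
    if "finite S" for S
    using that
  proof induction
    case empty then show ?case by (simp add: fun_upd_def cong: if_cong)
  next
    case (insert m S)
    let ?r = "\<lambda>l. if l = i then axis k 1 else if l \<in> S then r l - (r l $ k) *\<^sub>R axis k 1 else r l"
    show ?case
    proof (cases "m = i")
      case True
      then have "(\<lambda>l. if l = i then axis k 1 else if l \<in> insert m S then r l - (r l $ k) *\<^sub>R axis k 1 else r l) = ?r"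
        by auto
      then show ?thesis using insert by simp
    next
      case False
      then have "(\<lambda>l. if l = i then axis k 1 else if l \<in> insert m S then r l - (r l $ k) *\<^sub>R axis k 1 else r l)
        = ?r(m := ?r m + (- (r m $ k)) *\<^sub>R ?r i)"
        using insert(2) by (auto simp: fun_eq_iff)
      then show ?thesis using rdet_row_operation[of i m ?r "- (r m $ k)"] False insert by simp
    qed
  qed
  from this[OF finite_class.finite_UNIV] show ?thesis by (simp only: UNIV_I if_True)
qed

lemma rdet_transpose: "rdet (\<lambda>m. \<chi> l. r l $ m) = rdet r"
proof -
  have "(\<chi> m. \<chi> l. r l $ m) = transpose (\<chi> i. r i)" by (simp add: transpose_def)
  then show ?thesis unfolding rdet_def by (simp add: det_transpose)
qed

text \<open>Once column k is cleared, entry (i, k) is a 1 alone in its row and its column, and such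
  a matrix has the same shape after transposition. So the cofactor can be read from rows or from
  columns.\<close>

lemma rdet_cofactor: "rdet (r(i := axis k 1)) = rdet ((\<lambda>m. \<chi> l. r l $ m)(k := axis i 1))"
proof -
  let ?c = "\<lambda>m. \<chi> l. r l $ m"
  have "rdet (?c(k := axis i 1)) = rdet (\<lambda>l. if l = k then axis i 1 else ?c l - (?c l $ i) *\<^sub>R axis i 1)"
    by (rule rdet_clear_column)
  also have "(\<lambda>l. if l = k then axis i 1 else ?c l - (?c l $ i) *\<^sub>R axis i 1)
     = (\<lambda>m. \<chi> l. (if l = i then axis k 1 else r l - (r l $ k) *\<^sub>R axis k 1) $ m)"
    by (auto simp: fun_eq_iff vec_eq_iff axis_def)
  also have "rdet \<dots> = rdet (\<lambda>l. if l = i then axis k 1 else r l - (r l $ k) *\<^sub>R axis k 1)"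
    by (rule rdet_transpose)
  also have "\<dots> = rdet (r(i := axis k 1))" by (rule rdet_clear_column[symmetric])
  finally show ?thesis by (rule sym)
qed

text \<open>Cramer's rule. For \<open>w = axis k 1\<close> the sum, read through columns, is the
  determinant of the matrix A with rows r whose column k is replaced by A a; of the columns making
  up A a only the k-th contributes. General w follows by linearity.\<close>

lemma rdet_replace_sum:
  fixes r :: "'n::finite \<Rightarrow> real^'n"
  shows "(\<Sum>i\<in>UNIV. (r i \<bullet> a) * rdet (r(i := w))) = (a \<bullet> w) * rdet r"
proof -
  let ?c = "\<lambda>m. \<chi> l. r l $ m"
  have k: "(\<Sum>i\<in>UNIV. (r i \<bullet> a) * rdet (r(i := axis k 1))) = a $ k * rdet r" for k
  proof -
    have "(\<Sum>i\<in>UNIV. (r i \<bullet> a) * rdet (r(i := axis k 1))) = (\<Sum>i\<in>UNIV. (\<chi> i. r i \<bullet> a) $ i * rdet (?c(k := axis i 1)))"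
      by (simp only: rdet_cofactor[of r] vec_lambda_beta)
    also have "\<dots> = rdet (?c(k := (\<chi> i. r i \<bullet> a)))" by (rule rdet_expand[symmetric])
    also have "(\<chi> i. r i \<bullet> a) = (\<Sum>m\<in>UNIV. a $ m *\<^sub>R ?c m)"
      by (simp add: vec_eq_iff inner_vec_def mult.commute sum_component)
    also have "rdet (?c(k := (\<Sum>m\<in>UNIV. a $ m *\<^sub>R ?c m))) = (\<Sum>m\<in>UNIV. a $ m * rdet (?c(k := ?c m)))"
      by (subst linear_sum[OF rdet_linear]) (simp add: linear_scale[OF rdet_linear])
    also have "\<dots> = (\<Sum>m\<in>UNIV. if m = k then a $ k * rdet ?c else 0)"
    proof (intro sum.cong refl)
      fix m
      have "rdet (?c(k := ?c m)) = 0" if "m \<noteq> k"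
        using that by (intro rdet_eq_rows[of m k]) auto
      moreover have "?c(k := ?c k) = ?c" by (rule fun_upd_triv)
      ultimately show "a $ m * rdet (?c(k := ?c m)) = (if m = k then a $ k * rdet ?c else 0)" by (cases "m = k") simp_all
    qed
    also have "\<dots> = a $ k * rdet r" by (simp add: rdet_transpose)
    finally show ?thesis .
  qed
  have "(\<Sum>i\<in>UNIV. (r i \<bullet> a) * rdet (r(i := w))) = (\<Sum>i\<in>UNIV. \<Sum>k\<in>UNIV. w $ k * ((r i \<bullet> a) * rdet (r(i := axis k 1))))"
    by (subst rdet_expand) (simp add: sum_distrib_left mult_ac)
  also have "\<dots> = (\<Sum>k\<in>UNIV. w $ k * (\<Sum>i\<in>UNIV. (r i \<bullet> a) * rdet (r(i := axis k 1))))"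
    by (subst sum.swap) (simp add: sum_distrib_left)
  also have "\<dots> = (a \<bullet> w) * rdet r" unfolding k by (simp add: inner_vec_def sum_distrib_left mult_ac)
  finally show ?thesis .
qed

text \<open>A crude Leibniz bound, the number of permutations times the product of the entry bounds;
  the type argument carries the dimension.\<close>

definition det_bound :: "'n::finite itself \<Rightarrow> real \<Rightarrow> real" where
  "det_bound _ M = real (card {p. p permutes (UNIV :: 'n set)}) * M ^ CARD('n)"

lemma rdet_bound:
  fixes r :: "'n::finite \<Rightarrow> real^'n"
  assumes "\<And>i j. \<bar>r i $ j\<bar> \<le> M"
  shows "\<bar>rdet r\<bar> \<le> det_bound TYPE('n) M"
proof -
  have "0 \<le> M" using order.trans[OF abs_ge_zero assms] .
  have "\<bar>rdet r\<bar> \<le> (\<Sum>p\<in>{p. p permutes (UNIV :: 'n set)}. \<bar>of_int (sign p) * (\<Prod>i\<in>UNIV. r i $ p i)\<bar>)"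
    unfolding rdet_def det_def by (simp add: sum_abs)
  also have "\<dots> \<le> (\<Sum>p\<in>{p. p permutes (UNIV :: 'n set)}. M ^ CARD('n))"
  proof (rule sum_mono)
    fix p :: "'n \<Rightarrow> 'n"
    have "\<bar>\<Prod>i\<in>UNIV. r i $ p i\<bar> \<le> (\<Prod>i\<in>(UNIV::'n set). M)"
      unfolding abs_prod by (rule prod_mono) (use assms in auto)
    then show "\<bar>of_int (sign p) * (\<Prod>i\<in>UNIV. r i $ p i)\<bar> \<le> M ^ CARD('n)"
      by (simp add: abs_mult sign_def)
  qed
  finally show ?thesis by (simp add: det_bound_def)
qed

lemma rdet_measurable:
  fixes r :: "'n::finite \<Rightarrow> 'b \<Rightarrow> real^'n"
  assumes "\<And>i j. (\<lambda>x. r i x $ j) \<in> borel_measurable N"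
  shows "(\<lambda>x. rdet (\<lambda>i. r i x)) \<in> borel_measurable N"
  unfolding rdet_def det_def using assms by (auto intro!: borel_measurable_sum borel_measurable_times borel_measurable_prod)

section \<open>Calculus at points where all partial derivatives exist\<close>

section \<open>Gradients\<close>

definition grad :: "(real^'n \<Rightarrow> real) \<Rightarrow> real^'n \<Rightarrow> real^'n" where
  "grad f x = (\<chi> j. dd (axis j 1) f x)"

text \<open>Existence of all partial derivatives, a condition weaker than Frechet differentiability
  but stable under sums, products and composition with a one-variable function.\<close>

definition pd :: "(real^'n \<Rightarrow> real) \<Rightarrow> real^'n \<Rightarrow> bool" where
  "pd f x \<longleftrightarrow> (\<forall>j. diffable_along (axis j 1) f x)"

lemma pd_DERIV: "pd f x \<Longrightarrow> ((\<lambda>s. f (x + s *\<^sub>R axis j 1)) has_real_derivative grad f x $ j) (at 0)"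
  using dd_works[where f=f and x=x and v="axis j 1"]
  by (simp add: pd_def grad_def has_real_derivative_iff_has_vector_derivative)

lemma pdI:
  assumes "\<And>j. ((\<lambda>s. f (x + s *\<^sub>R axis j 1)) has_real_derivative D $ j) (at 0)"
  shows "pd f x" "grad f x = D"
  using assms
  by (auto simp: pd_def grad_def vec_eq_iff real_differentiable_def has_real_derivative_iff_has_vector_derivative intro: dd_eqI)

lemma grad_const: "pd (\<lambda>x::real^'n. c) x" "grad (\<lambda>x::real^'n. c) x = 0"
proof -
  have "((\<lambda>s::real. c) has_real_derivative 0 $ j) (at 0)" for j :: 'n by simp
  from pdI[OF this] show "pd (\<lambda>x::real^'n. c) x" "grad (\<lambda>x. c) x = 0" by auto
qed

lemma grad_inner: "pd (\<lambda>x. v \<bullet> x) x" "grad (\<lambda>x. v \<bullet> x) x = v"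
proof -
  have "((\<lambda>s. v \<bullet> (x + s *\<^sub>R axis j 1)) has_real_derivative v $ j) (at 0)" for j
    by (auto intro!: derivative_eq_intros simp: inner_add_right inner_axis)
  from pdI[OF this] show "pd (\<lambda>x. v \<bullet> x) x" "grad (\<lambda>x. v \<bullet> x) x = v" by auto
qed

lemma grad_add:
  assumes "pd f x" "pd g x"
  shows "pd (\<lambda>x. f x + g x) x" "grad (\<lambda>x. f x + g x) x = grad f x + grad g x"
proof -
  have "((\<lambda>s. f (x + s *\<^sub>R axis j 1) + g (x + s *\<^sub>R axis j 1)) has_real_derivative (grad f x + grad g x) $ j) (at 0)" for j
    by (auto intro!: derivative_eq_intros pd_DERIV assms)
  from pdI[OF this] show "pd (\<lambda>x. f x + g x) x" "grad (\<lambda>x. f x + g x) x = grad f x + grad g x" by auto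
qed

lemma grad_diff:
  assumes "pd f x" "pd g x"
  shows "pd (\<lambda>x. f x - g x) x" "grad (\<lambda>x. f x - g x) x = grad f x - grad g x"
proof -
  have "((\<lambda>s. f (x + s *\<^sub>R axis j 1) - g (x + s *\<^sub>R axis j 1)) has_real_derivative (grad f x - grad g x) $ j) (at 0)" for j
    by (auto intro!: derivative_eq_intros pd_DERIV assms)
  from pdI[OF this] show "pd (\<lambda>x. f x - g x) x" "grad (\<lambda>x. f x - g x) x = grad f x - grad g x" by auto
qed

lemma grad_mult:
  assumes "pd f x" "pd g x"
  shows "pd (\<lambda>x. f x * g x) x" "grad (\<lambda>x. f x * g x) x = f x *\<^sub>R grad g x + g x *\<^sub>R grad f x"
proof -
  have "((\<lambda>s. f (x + s *\<^sub>R axis j 1) * g (x + s *\<^sub>R axis j 1)) has_real_derivative (f x *\<^sub>R grad g x + g x *\<^sub>R grad f x) $ j) (at 0)" for j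
    by (rule DERIV_cong[OF DERIV_mult[OF pd_DERIV[OF assms(1)] pd_DERIV[OF assms(2)]]]) (simp add: mult.commute)
  from pdI[OF this] show "pd (\<lambda>x. f x * g x) x" "grad (\<lambda>x. f x * g x) x = f x *\<^sub>R grad g x + g x *\<^sub>R grad f x" by auto
qed

lemma grad_compose:
  assumes "pd f x" "(H has_real_derivative H') (at (f x))"
  shows "pd (\<lambda>x. H (f x)) x" "grad (\<lambda>x. H (f x)) x = H' *\<^sub>R grad f x"
proof -
  have "((\<lambda>s. H (f (x + s *\<^sub>R axis j 1))) has_real_derivative (H' *\<^sub>R grad f x) $ j) (at 0)" for j
    by (rule DERIV_cong[OF DERIV_chain2[OF _ pd_DERIV[OF assms(1)]]]) (use assms(2) in auto)
  from pdI[OF this] show "pd (\<lambda>x. H (f x)) x" "grad (\<lambda>x. H (f x)) x = H' *\<^sub>R grad f x" by auto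
qed

lemma grad_cmult:
  assumes "pd f x"
  shows "pd (\<lambda>x. c * f x) x" "grad (\<lambda>x. c * f x) x = c *\<^sub>R grad f x"
  using grad_compose[OF assms, of "\<lambda>y. c * y" c] by (auto intro!: derivative_eq_intros)

lemma grad_transform:
  assumes "open U" "x \<in> U" "\<And>y. y \<in> U \<Longrightarrow> f y = g y" "pd f x"
  shows "pd g x" "grad g x = grad f x"
proof -
  obtain e where e: "e > 0" "ball x e \<subseteq> U" using assms(1,2) open_contains_ball by metis
  have "((\<lambda>s. g (x + s *\<^sub>R axis j 1)) has_real_derivative grad f x $ j) (at 0)" for j
  proof (rule has_field_derivative_transform_within_open[OF pd_DERIV[OF assms(4)], where S="ball 0 e"])
    fix s :: real assume "s \<in> ball 0 e"
    then have "x + s *\<^sub>R axis j 1 \<in> ball x e" by (simp add: dist_norm norm_axis_1)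
    then show "f (x + s *\<^sub>R axis j 1) = g (x + s *\<^sub>R axis j 1)" using e assms(3) by blast
  qed (use e in auto)
  from pdI[OF this] show "pd g x" "grad g x = grad f x" by auto
qed

lemma grad_zero_outside:
  assumes "\<And>y. R \<le> norm y \<Longrightarrow> f y = 0" "R < norm x"
  shows "pd f x" "grad f x = 0"
proof -
  have U: "open (- cball (0::real^'a) R)" "x \<in> - cball 0 R" using assms(2) by auto
  have eq: "(0::real) = f y" if "y \<in> - cball 0 R" for y using that assms(1)[of y] by auto
  show "pd f x" "grad f x = 0" using grad_transform[OF U eq grad_const(1)] grad_const(2)[of 0 x] by auto
qed

lemma dd_zero_outside:
  fixes h :: "'a::real_normed_vector \<Rightarrow> real"
  assumes R: "\<And>x. R \<le> norm x \<Longrightarrow> h x = 0" and x: "R < norm x"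
  shows "dd v h x = 0"
proof (rule dd_eqI)
  have "((\<lambda>s. x + s *\<^sub>R v) \<longlongrightarrow> x + 0 *\<^sub>R v) (at 0)" by (intro tendsto_intros)
  then have "eventually (\<lambda>s. x + s *\<^sub>R v \<in> - cball 0 R) (at 0)"
    by (rule topological_tendstoD) (use x in auto)
  then have "eventually (\<lambda>s. 0 = h (x + s *\<^sub>R v)) (at 0)" by (rule eventually_mono) (metis ComplD R mem_cball_0 nle_le)
  then obtain e where e: "e > 0" "\<And>s. s \<noteq> 0 \<Longrightarrow> \<bar>s\<bar> < e \<Longrightarrow> 0 = h (x + s *\<^sub>R v)"
    unfolding eventually_at by (auto simp: dist_real_def)
  show "((\<lambda>s. h (x + s *\<^sub>R v)) has_vector_derivative 0) (at 0)"
  proof (rule has_vector_derivative_transform_within_open[OF has_vector_derivative_const, of "ball 0 e"])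
    fix s :: real assume "s \<in> ball 0 e"
    then show "0 = h (x + s *\<^sub>R v)" using e(2)[of s] R[of x] x by (cases "s = 0") auto
  qed (use e in auto)
qed

text \<open>At a zero of g the function |g| has a minimum, so its derivative is 0; the quotients of
  g have the same absolute values and tend to 0 as well.\<close>

lemma abs_DERIV_zero:
  fixes g :: "real \<Rightarrow> real"
  assumes "g a = 0" "(g has_real_derivative D) (at a)" "((\<lambda>s. \<bar>g s\<bar>) has_real_derivative E) (at a)"
  shows "D = 0" "E = 0"
proof -
  show E: "E = 0"
    by (rule DERIV_local_min[OF assms(3), of 1]) (use assms(1) in auto)
  have "((\<lambda>h. (\<bar>g (a + h)\<bar> - \<bar>g a\<bar>) / h) \<longlongrightarrow> 0) (at 0)" using assms(3) E by (simp add: DERIV_def)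
  then have "((\<lambda>h. \<bar>(\<bar>g (a + h)\<bar> - \<bar>g a\<bar>) / h\<bar>) \<longlongrightarrow> 0) (at 0)" by (rule tendsto_rabs_zero)
  then have "((\<lambda>h. \<bar>(g (a + h) - g a) / h\<bar>) \<longlongrightarrow> 0) (at 0)" using assms(1) by simp
  then have "((\<lambda>h. (g (a + h) - g a) / h) \<longlongrightarrow> 0) (at 0)" by (rule tendsto_rabs_zero_cancel)
  moreover have "((\<lambda>h. (g (a + h) - g a) / h) \<longlongrightarrow> D) (at 0)" using assms(2) by (simp add: DERIV_def)
  ultimately show "D = 0" using LIM_unique by blast
qed

text \<open>For Lipschitz f both differentiability assumptions hold almost everywhere, since |f| is
  Lipschitz too. So the gradient vanishes almost everywhere on the zero set, and two functions share
  their gradients where they agree.\<close>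

lemma grad_zero_on_zero_set:
  assumes "pd f x" "pd (\<lambda>x. \<bar>f x\<bar>) x" "f x = 0"
  shows "grad f x = 0" "grad (\<lambda>x. \<bar>f x\<bar>) x = 0"
  using abs_DERIV_zero[OF _ pd_DERIV[OF assms(1)] pd_DERIV[OF assms(2)]] assms(3) by (auto simp: vec_eq_iff)

lemma grad_abs:
  assumes "pd f x" "pd (\<lambda>x. \<bar>f x\<bar>) x"
  shows "grad (\<lambda>x. \<bar>f x\<bar>) x = sgn (f x) *\<^sub>R grad f x"
proof (cases "f x = 0")
  case True then show ?thesis using grad_zero_on_zero_set[OF assms] by simp
next
  case False
  have "(abs has_real_derivative sgn (f x)) (at (f x))"
  proof (cases "f x > 0")
    case True
    have "(abs has_real_derivative 1) (at (f x))"
      by (rule has_field_derivative_transform_within_open[OF DERIV_ident, of "{0<..}"]) (use True in auto)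
    then show ?thesis using True by simp
  next
    case neg: False
    have "(abs has_real_derivative - 1) (at (f x))"
      by (rule has_field_derivative_transform_within_open[OF DERIV_minus[OF DERIV_ident], of "{..<0}"]) (use False neg in auto)
    then show ?thesis using False neg by (simp add: sgn_if)
  qed
  then show ?thesis by (rule grad_compose(2)[OF assms(1)])
qed

lemma Lip_AE_pd: "Lip f \<Longrightarrow> AE x in lebesgue. pd f x"
  unfolding pd_def by (intro eventually_all_finite Lip_AE_diffable_along)

lemma AE_pd_all: "(\<And>i::'i::finite. Lip (f i)) \<Longrightarrow> AE x in lebesgue. \<forall>i. pd (f i) x"
  by (intro eventually_all_finite Lip_AE_pd)

lemma grad_bounded:
  assumes "L-lipschitz_on UNIV f" "pd f x" shows "\<bar>grad f x $ j\<bar> \<le> L"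
  using dd_bounded[OF assms(1), of x "axis j 1"] assms(2) by (simp add: grad_def pd_def norm_axis_1)

lemma Lip_common:
  fixes f :: "'i::finite \<Rightarrow> 'a::metric_space \<Rightarrow> 'b::metric_space"
  assumes "\<And>i. Lip (f i)"
  obtains L where "\<And>i. L-lipschitz_on UNIV (f i)"
proof -
  obtain l where l: "\<And>i. (l i)-lipschitz_on UNIV (f i)" using assms unfolding Lip_def by metis
  have "(Max (range l))-lipschitz_on UNIV (f i)" for i
    by (rule lipschitz_on_mono[OF l[of i]]) auto
  then show ?thesis using that by blast
qed

section \<open>Bounds, integrability, integration by parts, and weak-star convergence of
  derivatives\<close>

section \<open>Jacobian determinants\<close>

definition jac :: "('n \<Rightarrow> real^'n \<Rightarrow> real) \<Rightarrow> real^'n \<Rightarrow> real" where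
  "jac f x = rdet (\<lambda>i. grad (f i) x)"

lemma jac_upd: "jac (f(k := g)) x = rdet ((\<lambda>i. grad (f i) x)(k := grad g x))"
  unfolding jac_def by (rule arg_cong[where f=rdet]) auto

lemma jac_bounded:
  fixes f :: "'n::finite \<Rightarrow> real^'n \<Rightarrow> real"
  assumes "\<And>i. L-lipschitz_on UNIV (f i)"
  shows "AE x in lebesgue. \<bar>jac f x\<bar> \<le> det_bound TYPE('n) L"
proof (rule eventually_mono)
  show "AE x in lebesgue. \<forall>i. pd (f i) x" by (rule AE_pd_all) (use assms in \<open>auto simp: Lip_def\<close>)
  fix x assume "\<forall>i. pd (f i) x"
  then show "\<bar>jac f x\<bar> \<le> det_bound TYPE('n) L"
    unfolding jac_def by (intro rdet_bound grad_bounded assms) auto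
qed

lemma grad_measurable: "Lip f \<Longrightarrow> (\<lambda>x. grad f x $ j) \<in> borel_measurable lebesgue"
  by (simp add: grad_def dd_measurable)

lemma jac_measurable: "(\<And>i. Lip (f i)) \<Longrightarrow> jac f \<in> borel_measurable lebesgue"
  unfolding jac_def by (intro rdet_measurable grad_measurable)

lemma jac_zero_outside:
  assumes "\<And>y. R \<le> norm y \<Longrightarrow> f k y = 0" "R < norm x"
  shows "jac f x = 0"
  unfolding jac_def by (rule rdet_zero_row[of _ k]) (rule grad_zero_outside[OF assms])

lemma jac_bounded_support:
  fixes f :: "'n::finite \<Rightarrow> real^'n \<Rightarrow> real"
  assumes "\<And>i. Lip (f i)" "bsupp (f k)"
  obtains C R where "0 \<le> C" "AE x in lebesgue. \<bar>jac f x\<bar> \<le> C * indicator (cball 0 R) x"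
proof -
  obtain L where L: "\<And>i. L-lipschitz_on UNIV (f i)" using Lip_common[of f, OF assms(1)] by blast
  obtain R where R: "\<And>y. R \<le> norm y \<Longrightarrow> f k y = 0" using assms(2) unfolding bsupp_def by blast
  show ?thesis
  proof (rule that[of "det_bound TYPE('n) L" R])
    show "0 \<le> det_bound TYPE('n) L" using lipschitz_on_nonneg[OF L] by (simp add: det_bound_def)
    show "AE x in lebesgue. \<bar>jac f x\<bar> \<le> det_bound TYPE('n) L * indicator (cball 0 R) x"
      using jac_bounded[OF L]
      by (rule eventually_mono) (use jac_zero_outside[where f=f and k=k, OF R] in \<open>auto simp: indicator_def not_le\<close>)
  qed
qed

lemma jac_integrable:
  assumes "\<And>i. Lip (f i)" "bsupp (f k)" shows "integrable lebesgue (jac f)"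
proof -
  obtain C R where "AE x in lebesgue. \<bar>jac f x\<bar> \<le> C * indicator (cball 0 R) x"
    using jac_bounded_support[where f=f and k=k, OF assms] by metis
  then show ?thesis by (rule integrable_bounded_support[OF jac_measurable[OF assms(1)]])
qed

lemma dd_bsupp_integrable:
  fixes h :: "'a::euclidean_space \<Rightarrow> real"
  assumes h: "Lip h" "bsupp h" shows "integrable lebesgue (dd v h)"
proof -
  obtain M where M: "M-lipschitz_on UNIV h" using h unfolding Lip_def by blast
  obtain R where R: "\<And>x. R \<le> norm x \<Longrightarrow> h x = 0" using h(2) unfolding bsupp_def by blast
  have z: "dd v h x = 0" if "R < norm x" for x using dd_zero_outside[OF R that] .
  show ?thesis
  proof (rule integrable_bounded_support[where C="M * norm v" and R=R])
    show "AE x in lebesgue. \<bar>dd v h x\<bar> \<le> M * norm v * indicator (cball 0 R) x"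
      using Lip_AE_diffable_along[OF h(1), of v]
      by (rule eventually_mono) (use dd_bounded[OF M, where v=v] z in \<open>auto simp: indicator_def not_le\<close>)
  qed (use dd_measurable[OF h(1)] in auto)
qed

text \<open>The product rule holds almost everywhere, and the derivative of \<open>h * f\<close>
  integrates to 0. Integrability of \<open>f * dd v h\<close> is obtained as a difference, since f
  may be unbounded.\<close>

lemma integration_by_parts_along:
  fixes f h :: "'a::euclidean_space \<Rightarrow> real"
  assumes h: "Lip h" "bsupp h" and f: "Lip f"
  shows "(\<integral>x. h x * dd v f x \<partial>lebesgue) = - (\<integral>x. f x * dd v h x \<partial>lebesgue)"
proof -
  obtain L where L: "L-lipschitz_on UNIV f" using f unfolding Lip_def by blast
  have Lp: "Lip (\<lambda>x. h x * f x)" by (rule Lip_mult_bsupp[OF h f])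
  have bp: "bsupp (\<lambda>x. h x * f x)" by (rule bsupp_mult(1)[OF h(2)])
  have i1: "integrable lebesgue (\<lambda>x. h x * dd v f x)"
  proof (rule integrable_mult_bounded)
    show "AE x in lebesgue. \<bar>dd v f x\<bar> \<le> L * norm v"
      using Lip_AE_diffable_along[OF f, of v] by (rule eventually_mono) (rule dd_bounded[OF L])
  qed (use h f in \<open>auto intro: Lip_bsupp_integrable dd_measurable\<close>)
  have pr: "AE x in lebesgue. dd v (\<lambda>x. h x * f x) x = h x * dd v f x + f x * dd v h x"
    using Lip_AE_diffable_along[OF f, of v] Lip_AE_diffable_along[OF h(1), of v]
  proof eventually_elim
    case (elim x)
    then have "((\<lambda>s. f (x + s *\<^sub>R v)) has_real_derivative dd v f x) (at 0)" "((\<lambda>s. h (x + s *\<^sub>R v)) has_real_derivative dd v h x) (at 0)"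
      using dd_works[where v=v and x=x and f=f] dd_works[where v=v and x=x and f=h] by (auto simp: has_real_derivative_iff_has_vector_derivative)
    from DERIV_mult[OF this(2,1)]
    have "((\<lambda>s. h (x + s *\<^sub>R v) * f (x + s *\<^sub>R v)) has_vector_derivative (h x * dd v f x + f x * dd v h x)) (at 0)"
      by (simp add: has_real_derivative_iff_has_vector_derivative[symmetric] mult.commute add.commute)
    then show ?case by (rule dd_eqI)
  qed
  have i0: "integrable lebesgue (dd v (\<lambda>x. h x * f x))" using dd_bsupp_integrable[OF Lp bp] .
  have "integrable lebesgue (\<lambda>x. dd v (\<lambda>x. h x * f x) x - h x * dd v f x)" using i0 i1 by simp
  moreover have "AE x in lebesgue. dd v (\<lambda>x. h x * f x) x - h x * dd v f x = f x * dd v h x"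
    using pr by (rule eventually_mono) simp
  ultimately have "(\<integral>x. f x * dd v h x \<partial>lebesgue) = (\<integral>x. dd v (\<lambda>x. h x * f x) x - h x * dd v f x \<partial>lebesgue)"
    using integrable_AE_eq(2) by metis
  also have "\<dots> = - (\<integral>x. h x * dd v f x \<partial>lebesgue)"
    using i0 i1 integral_dd_zero[OF Lp bp, of v] by simp
  finally show ?thesis by simp
qed

text \<open>Against a Lipschitz h with bounded support the derivative moves to h, and F n converges
  boundedly on the support. The common Lipschitz constant then extends this to all integrable p by
  density.\<close>

lemma dd_weak_star:
  fixes f :: "'a::euclidean_space \<Rightarrow> real"
  assumes L: "\<And>n. L-lipschitz_on UNIV (F n)" "L-lipschitz_on UNIV f" and lim: "\<And>x. (\<lambda>n. F n x) \<longlonglongrightarrow> f x"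
    and p: "integrable lebesgue p"
  shows "(\<lambda>n. \<integral>x. p x * dd v (F n) x \<partial>lebesgue) \<longlonglongrightarrow> (\<integral>x. p x * dd v f x \<partial>lebesgue)"
proof (rule weak_star_density[where M="L * norm v"])
  have Lf: "Lip (F n)" "Lip f" for n using L unfolding Lip_def by blast+
  show "dd v (F n) \<in> borel_measurable lebesgue" "dd v f \<in> borel_measurable lebesgue" for n
    by (intro dd_measurable Lf)+
  show "AE x in lebesgue. \<bar>dd v (F n) x\<bar> \<le> L * norm v" for n
    using Lip_AE_diffable_along[OF Lf(1), where v=v] by (rule eventually_mono) (rule dd_bounded[OF L(1)])
  show "AE x in lebesgue. \<bar>dd v f x\<bar> \<le> L * norm v"
    using Lip_AE_diffable_along[OF Lf(2), of v] by (rule eventually_mono) (rule dd_bounded[OF L(2)])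
  show "integrable lebesgue p" by fact
  fix h :: "'a \<Rightarrow> real" assume h: "Lip h" "bsupp h"
  obtain C R where C: "0 \<le> C" "\<And>x. \<bar>h x\<bar> \<le> C * indicator (cball 0 R) x" and R: "\<And>x. R \<le> norm x \<Longrightarrow> h x = 0" "0 \<le> R"
    using Lip_bsupp_bounded[OF h] by metis
  obtain M where M: "M-lipschitz_on UNIV h" using h unfolding Lip_def by blast
  obtain B where B: "\<And>n. \<bar>F n 0\<bar> \<le> B"
    using convergent_imp_Bseq[OF convergentI[OF lim[of 0]]] unfolding Bseq_def by auto
  have z: "dd v h x = 0" if "R < norm x" for x using dd_zero_outside[OF R(1) that] .
  have "(\<lambda>n. \<integral>x. F n x * dd v h x \<partial>lebesgue) \<longlonglongrightarrow> (\<integral>x. f x * dd v h x \<partial>lebesgue)"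
  proof (rule integral_dominated_convergence[where w="\<lambda>x. ((B + L * R) * (M * norm v)) * indicator (cball 0 R) x"])
    show "AE x in lebesgue. (\<lambda>n. F n x * dd v h x) \<longlonglongrightarrow> f x * dd v h x"
      by (intro AE_I2 tendsto_mult_right lim)
    show "AE x in lebesgue. norm (F n x * dd v h x) \<le> ((B + L * R) * (M * norm v)) * indicator (cball 0 R) x" for n
      using Lip_AE_diffable_along[OF h(1), of v]
    proof (rule eventually_mono)
      fix x assume d: "diffable_along v h x"
      show "norm (F n x * dd v h x) \<le> ((B + L * R) * (M * norm v)) * indicator (cball 0 R) x"
      proof (cases "norm x \<le> R")
        case True
        have "\<bar>F n x\<bar> \<le> \<bar>F n 0\<bar> + L * norm x" using lipschitz_onD[OF L(1)[of n], of x 0] by (simp add: dist_norm)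
        also have "\<dots> \<le> B + L * R" using B True lipschitz_on_nonneg[OF L(2)] by (intro add_mono mult_left_mono) auto
        finally show ?thesis using True dd_bounded[OF M d]
          by (auto simp: abs_mult intro!: mult_mono)
      qed (simp add: z)
    qed
    show "(\<lambda>x. F n x * dd v h x) \<in> borel_measurable lebesgue" "(\<lambda>x. f x * dd v h x) \<in> borel_measurable lebesgue" for n
      by (intro borel_measurable_times Lip_measurable dd_measurable Lf h)+
    show "integrable lebesgue (\<lambda>x. ((B + L * R) * (M * norm v)) * indicator (cball 0 R) x :: real)"
      by (rule integrable_const_cball)
  qed
  then show "(\<lambda>n. \<integral>x. h x * dd v (F n) x \<partial>lebesgue) \<longlonglongrightarrow> (\<integral>x. h x * dd v f x \<partial>lebesgue)"
    unfolding integration_by_parts_along[OF h Lf(1)] integration_by_parts_along[OF h Lf(2)] by (rule tendsto_minus)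
qed

section \<open>The integral of a Jacobian determinant with one row of bounded support
  vanishes\<close>

section \<open>The Jacobian determinant is a null Lagrangian\<close>

text \<open>Only the rows in \<open>S\<close> and the row \<open>k0\<close> with bounded support may be nonlinear; the vanishing of
  \<open>\<integral>jac f\<close> is extended from \<open>S\<close> to \<open>insert k S\<close> by enlarging the class of functions allowed in row \<open>k\<close>.\<close>
definition admissible :: "'n::finite \<Rightarrow> 'n set \<Rightarrow> ('n \<Rightarrow> real^'n \<Rightarrow> real) \<Rightarrow> bool" where
  "admissible k0 S f \<longleftrightarrow> (\<forall>i. Lip (f i)) \<and> bsupp (f k0) \<and> (\<forall>i. i \<notin> S \<and> i \<noteq> k0 \<longrightarrow> (\<exists>v. f i = (\<lambda>x. v \<bullet> x)))"

text \<open>\<open>insert k S\<close> lifts the restriction on row k of f, which g overwrites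
  anyway; the other rows remain restricted as for S.\<close>

definition null_row :: "'n::finite \<Rightarrow> 'n set \<Rightarrow> 'n \<Rightarrow> (real^'n \<Rightarrow> real) \<Rightarrow> bool" where
  "null_row k0 S k g \<longleftrightarrow> Lip g \<and> (\<forall>f. admissible k0 (insert k S) f \<longrightarrow> (\<integral>x. jac (f(k := g)) x \<partial>lebesgue) = 0)"

lemma Lip_inner: "Lip (\<lambda>x::'a::real_inner. v \<bullet> x)"
  unfolding Lip_def
proof (intro exI lipschitz_onI)
  show "dist (v \<bullet> x) (v \<bullet> y) \<le> norm v * dist x y" for x y
    using Cauchy_Schwarz_ineq2[of v "x - y"] by (simp add: dist_norm inner_diff_right)
qed simp

lemma Lip_arctan: "Lip (arctan :: real \<Rightarrow> real)"
  unfolding Lip_def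
proof (intro exI lipschitz_onI)
  fix x y :: real
  have "norm (arctan x - arctan y) \<le> 1 * norm (x - y)"
  proof (rule field_differentiable_bound[of UNIV arctan "\<lambda>x. inverse (1 + x\<^sup>2)"])
    show "norm (inverse (1 + z\<^sup>2)) \<le> 1" for z :: real
      by (simp add: inverse_le_1_iff add_nonneg_nonneg)
  qed (auto intro: DERIV_arctan)
  then show "dist (arctan x) (arctan y) \<le> 1 * dist x y" by (simp add: dist_norm)
qed simp

lemma jac_upd_integrable:
  assumes "\<And>i. Lip (f i)" "bsupp (f k0)" "k \<noteq> k0" "Lip g"
  shows "integrable lebesgue (jac (f(k := g)))"
  by (rule jac_integrable[where k=k0]) (use assms in auto)

context
  fixes k0 k :: "'n::finite" and S :: "'n set"
  assumes k: "k \<noteq> k0"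
begin

lemma admissibleD:
  assumes "admissible k0 S' f"
  shows "Lip (f i)" "bsupp (f k0)"
  using assms unfolding admissible_def by auto

lemma null_row_const: "null_row k0 S k (\<lambda>x. c)"
  unfolding null_row_def
proof (intro conjI allI impI)
  fix f :: "'n \<Rightarrow> real^'n \<Rightarrow> real" assume "admissible k0 (insert k S) f"
  have "jac (f(k := (\<lambda>x. c))) x = 0" for x
    unfolding jac_def by (rule rdet_zero_row[of _ k]) (simp add: grad_const)
  then show "(\<integral>x. jac (f(k := (\<lambda>x. c))) x \<partial>lebesgue) = 0" by simp
qed (rule Lip_const)

lemma null_row_add:
  assumes g: "null_row k0 S k g" "null_row k0 S k h"
  shows "null_row k0 S k (\<lambda>x. g x + h x)"
  unfolding null_row_def
proof (intro conjI allI impI)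
  have L: "Lip g" "Lip h" using g unfolding null_row_def by auto
  show Ls: "Lip (\<lambda>x. g x + h x)" by (rule Lip_add[OF L])
  fix f :: "'n \<Rightarrow> real^'n \<Rightarrow> real" assume f: "admissible k0 (insert k S) f"
  note int = jac_upd_integrable[where f=f, OF admissibleD[OF f] k]
  have "(\<integral>x. jac (f(k := (\<lambda>x. g x + h x))) x \<partial>lebesgue) = (\<integral>x. jac (f(k := g)) x + jac (f(k := h)) x \<partial>lebesgue)"
  proof (rule integral_cong_AE)
    show "AE x in lebesgue. jac (f(k := (\<lambda>x. g x + h x))) x = jac (f(k := g)) x + jac (f(k := h)) x"
      using Lip_AE_pd[OF L(1)] Lip_AE_pd[OF L(2)]
    proof eventually_elim
      case (elim x)
      show ?case unfolding jac_upd grad_add(2)[OF elim] by (rule linear_add[OF rdet_linear])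
    qed
  qed (use int[OF L(1)] int[OF L(2)] int[OF Ls] in auto)
  also have "\<dots> = 0"
    using int[OF L(1)] int[OF L(2)] g f unfolding null_row_def by simp
  finally show "(\<integral>x. jac (f(k := (\<lambda>x. g x + h x))) x \<partial>lebesgue) = 0" .
qed

lemma null_row_cmult:
  assumes g: "null_row k0 S k g"
  shows "null_row k0 S k (\<lambda>x. c * g x)"
  unfolding null_row_def
proof (intro conjI allI impI)
  have L: "Lip g" using g unfolding null_row_def by auto
  show Ls: "Lip (\<lambda>x. c * g x)" by (rule Lip_cmult[OF L])
  fix f :: "'n \<Rightarrow> real^'n \<Rightarrow> real" assume f: "admissible k0 (insert k S) f"
  note int = jac_upd_integrable[where f=f, OF admissibleD[OF f] k]
  have "(\<integral>x. jac (f(k := (\<lambda>x. c * g x))) x \<partial>lebesgue) = (\<integral>x. c * jac (f(k := g)) x \<partial>lebesgue)"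
  proof (rule integral_cong_AE)
    show "AE x in lebesgue. jac (f(k := (\<lambda>x. c * g x))) x = c * jac (f(k := g)) x"
      using Lip_AE_pd[OF L(1)]
    proof eventually_elim
      case (elim x)
      show ?case unfolding jac_upd grad_cmult(2)[OF elim]
        using linear_scale[OF rdet_linear[of _ k]] by (metis real_scaleR_def)
    qed
  qed (use int[OF L] int[OF Ls] in auto)
  also have "\<dots> = 0"
    using g f unfolding null_row_def by simp
  finally show "(\<integral>x. jac (f(k := (\<lambda>x. c * g x))) x \<partial>lebesgue) = 0" .
qed

text \<open>Multiplying row \<open>k0\<close> by \<open>\<theta>(g)\<close> adds to its gradient a multiple of \<open>\<nabla>g\<close>, which is row \<open>k\<close>;
  so \<open>\<integral>\<theta>(g) jac = 0\<close>, and \<open>\<theta>(s) = arctan (n s)\<close> approximates a multiple of the sign.\<close>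
lemma null_row_abs:
  assumes g: "null_row k0 S k g"
  shows "null_row k0 S k (\<lambda>x. \<bar>g x\<bar>)"
  unfolding null_row_def
proof (intro conjI allI impI)
  have L: "Lip g" using g unfolding null_row_def by auto
  show Ls: "Lip (\<lambda>x. \<bar>g x\<bar>)" by (rule Lip_abs[OF L])
  fix f :: "'n \<Rightarrow> real^'n \<Rightarrow> real" assume f: "admissible k0 (insert k S) f"
  note int = jac_upd_integrable[where f=f, OF admissibleD[OF f] k]
  define th where "th n x = arctan (real n * g x)" for n x
  have Lt: "Lip (th n)" for n unfolding th_def by (intro Lip_compose[OF Lip_arctan] Lip_cmult L)
  have z: "(\<integral>x. th n x * jac (f(k := g)) x \<partial>lebesgue) = 0" for n
  proof -
    let ?F = "f(k0 := (\<lambda>x. f k0 x * th n x))"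
    have Lf: "Lip (\<lambda>x. f k0 x * th n x)" by (intro Lip_mult_bsupp admissibleD[OF f] Lt)
    \<comment> \<open>Row k0 may be any Lipschitz function with bounded support, so it absorbs the
      factor without leaving the class.\<close>
    have aF: "admissible k0 (insert k S) ?F"
      using f Lf bsupp_mult(1)[OF admissibleD(2)[OF f]] unfolding admissible_def by auto
    have "(\<integral>x. th n x * jac (f(k := g)) x \<partial>lebesgue) = (\<integral>x. jac (?F(k := g)) x \<partial>lebesgue)"
    proof (rule integral_cong_AE)
      show "AE x in lebesgue. th n x * jac (f(k := g)) x = jac (?F(k := g)) x"
        using Lip_AE_pd[OF L(1)] Lip_AE_pd[OF admissibleD(1)[OF f, of k0]]
      proof eventually_elim
        case (elim x)
        let ?r = "(\<lambda>i. grad (f i) x)(k := grad g x)"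
        have D: "((\<lambda>s. arctan (real n * s)) has_real_derivative inverse (1 + (real n * g x)\<^sup>2) * real n) (at (g x))"
          by (auto intro!: derivative_eq_intros simp: inverse_eq_divide)
        note gt = grad_compose[OF elim(1) D, folded th_def]
        obtain c where c: "grad (th n) x = c *\<^sub>R grad g x" "pd (th n) x" using gt by (auto simp: th_def)
        have "jac (?F(k := g)) x = rdet (?r(k0 := th n x *\<^sub>R grad (f k0) x + (f k0 x * c) *\<^sub>R grad g x))"
        proof -
          have "grad (\<lambda>x. f k0 x * th n x) x = th n x *\<^sub>R grad (f k0) x + (f k0 x * c) *\<^sub>R grad g x"
            using grad_mult(2)[OF elim(2) c(2)] c(1) by (simp add: add.commute)
          then show ?thesis unfolding jac_def using k by (intro arg_cong[where f=rdet]) auto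
        qed
        also have "\<dots> = th n x * rdet (?r(k0 := grad (f k0) x)) + (f k0 x * c) * rdet (?r(k0 := grad g x))"
          by (simp only: linear_add[OF rdet_linear] linear_scale[OF rdet_linear] real_scaleR_def)
        also have "rdet (?r(k0 := grad g x)) = 0" using k by (intro rdet_eq_rows[of k k0]) auto
        also have "rdet (?r(k0 := grad (f k0) x)) = jac (f(k := g)) x"
          unfolding jac_upd using k by (intro arg_cong[where f=rdet]) auto
        finally show ?case by (simp only: mult_zero_right add_0_right)
      qed
      show "(\<lambda>x. th n x * jac (f(k := g)) x) \<in> borel_measurable lebesgue"
        using int[OF L] Lip_measurable[OF Lt[of n]] by auto
      show "jac (?F(k := g)) \<in> borel_measurable lebesgue"
        by (rule jac_measurable) (use Lf L admissibleD[OF f] in auto)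
    qed
    also have "\<dots> = 0" using g aF unfolding null_row_def by blast
    finally show ?thesis .
  qed
  have "(\<lambda>n. \<integral>x. th n x * jac (f(k := g)) x \<partial>lebesgue) \<longlonglongrightarrow> (\<integral>x. (pi / 2 * sgn (g x)) * jac (f(k := g)) x \<partial>lebesgue)"
  proof (rule integral_dominated_convergence[where w="\<lambda>x. (pi / 2) * \<bar>jac (f(k := g)) x\<bar>"])
    show "AE x in lebesgue. (\<lambda>n. th n x * jac (f(k := g)) x) \<longlonglongrightarrow> (pi / 2 * sgn (g x)) * jac (f(k := g)) x"
    proof (intro AE_I2 tendsto_mult_right)
      fix x
      have r: "filterlim (\<lambda>n. real n) at_top sequentially" by (rule filterlim_real_sequentially)
      consider "g x = 0" | "g x > 0" | "g x < 0" by linarith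
      then show "(\<lambda>n. th n x) \<longlonglongrightarrow> pi / 2 * sgn (g x)"
      proof cases
        case 2
        have "(\<lambda>n. arctan (real n * g x)) \<longlonglongrightarrow> pi / 2"
          by (rule filterlim_compose[OF tendsto_arctan_at_top filterlim_at_top_mult_tendsto_pos[OF tendsto_const 2 r, simplified mult.commute[of "g x"]]])
        then show ?thesis using 2 by (simp add: th_def)
      next
        case 3
        then have "- g x > 0" by simp
        have "(\<lambda>n. arctan (real n * (- g x))) \<longlonglongrightarrow> pi / 2"
          by (rule filterlim_compose[OF tendsto_arctan_at_top filterlim_at_top_mult_tendsto_pos[OF tendsto_const \<open>- g x > 0\<close> r]])
        then have "(\<lambda>n. - arctan (real n * (- g x))) \<longlonglongrightarrow> - (pi / 2)" by (rule tendsto_minus)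
        then show ?thesis using 3 by (simp add: th_def arctan_minus)
      qed (simp add: th_def)
    qed
    show "AE x in lebesgue. norm (th n x * jac (f(k := g)) x) \<le> (pi / 2) * \<bar>jac (f(k := g)) x\<bar>" for n
    proof (rule AE_I2)
      fix x
      have "\<bar>th n x\<bar> \<le> pi / 2" using arctan_lbound[of "real n * g x"] arctan_ubound[of "real n * g x"] by (simp add: th_def abs_le_iff)
      then have "\<bar>th n x\<bar> * \<bar>jac (f(k := g)) x\<bar> \<le> (pi / 2) * \<bar>jac (f(k := g)) x\<bar>" by (intro mult_right_mono) auto
      then show "norm (th n x * jac (f(k := g)) x) \<le> (pi / 2) * \<bar>jac (f(k := g)) x\<bar>" by (simp only: real_norm_def abs_mult)
    qed
    show "(\<lambda>x. (pi / 2 * sgn (g x)) * jac (f(k := g)) x) \<in> borel_measurable lebesgue"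
      using int[OF L] Lip_measurable[OF L] by auto
    show "(\<lambda>x. th n x * jac (f(k := g)) x) \<in> borel_measurable lebesgue" for n
      using int[OF L] Lip_measurable[OF Lt[of n]] by auto
    show "integrable lebesgue (\<lambda>x. (pi / 2) * \<bar>jac (f(k := g)) x\<bar>)" using int[OF L] by simp
  qed
  then have "(\<integral>x. (pi / 2 * sgn (g x)) * jac (f(k := g)) x \<partial>lebesgue) = 0"
    unfolding z by (simp add: LIMSEQ_const_iff)
  then have s0: "(\<integral>x. sgn (g x) * jac (f(k := g)) x \<partial>lebesgue) = 0" by (simp add: mult.assoc)
  have "(\<integral>x. jac (f(k := (\<lambda>x. \<bar>g x\<bar>))) x \<partial>lebesgue) = (\<integral>x. sgn (g x) * jac (f(k := g)) x \<partial>lebesgue)"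
  proof (rule integral_cong_AE)
    show "AE x in lebesgue. jac (f(k := (\<lambda>x. \<bar>g x\<bar>))) x = sgn (g x) * jac (f(k := g)) x"
      using Lip_AE_pd[OF L] Lip_AE_pd[OF Ls]
    proof eventually_elim
      case (elim x)
      show ?case unfolding jac_upd grad_abs[OF elim]
        using linear_scale[OF rdet_linear[of _ k]] by (metis real_scaleR_def)
    qed
  qed (use int[OF L] int[OF Ls] Lip_measurable[OF L] in auto)
  then show "(\<integral>x. jac (f(k := (\<lambda>x. \<bar>g x\<bar>))) x \<partial>lebesgue) = 0" using s0 by simp
qed

lemma null_row_min:
  assumes g: "null_row k0 S k g" "null_row k0 S k h"
  shows "null_row k0 S k (\<lambda>x. min (g x) (h x))"
proof -
  have "(\<lambda>x. min (g x) (h x)) = (\<lambda>x. (1/2) * ((g x + h x) + (-1) * \<bar>g x + (-1) * h x\<bar>))"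
    by (auto simp: min_def fun_eq_iff)
  then show ?thesis by (simp only:) (intro null_row_cmult null_row_add null_row_abs g)
qed

lemma null_row_sum:
  assumes "finite A" "\<And>j. j \<in> A \<Longrightarrow> null_row k0 S k (g j)"
  shows "null_row k0 S k (\<lambda>x. \<Sum>j\<in>A. g j x)"
  using assms
proof (induction A)
  case empty then show ?case using null_row_const[of 0] by simp
next
  case (insert j A)
  then show ?case using null_row_add[of "g j" "\<lambda>x. \<Sum>j\<in>A. g j x"] by simp
qed

text \<open>Expansion along row k leaves fixed cofactors times partial derivatives of F n, which
  converge weakly-star. Each cofactor is itself the Jacobian with row k a coordinate function, hence
  integrable.\<close>

lemma null_row_limit:
  assumes F: "\<And>n. null_row k0 S k (F n)" and L: "\<And>n. L-lipschitz_on UNIV (F n)" "L-lipschitz_on UNIV g"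
    and lim: "\<And>x. (\<lambda>n. F n x) \<longlonglongrightarrow> g x"
  shows "null_row k0 S k g"
  unfolding null_row_def
proof (intro conjI allI impI)
  have Lg: "Lip g" and LF: "Lip (F n)" for n using L unfolding Lip_def by blast+
  then show "Lip g" by simp
  fix f :: "'n \<Rightarrow> real^'n \<Rightarrow> real" assume f: "admissible k0 (insert k S) f"
  define c where "c j x = rdet ((\<lambda>i. grad (f i) x)(k := axis j 1))" for j x
  have c_jac: "c j x = jac (f(k := (\<lambda>x. axis j 1 \<bullet> x))) x" for j x
    unfolding jac_upd c_def by (simp add: grad_inner)
  have ci: "integrable lebesgue (c j)" for j
  proof -
    have "c j = jac (f(k := (\<lambda>x. axis j 1 \<bullet> x)))" using c_jac by blast
    then show ?thesis using jac_upd_integrable[where f=f, OF admissibleD[OF f] k Lip_inner] by simp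
  qed
  have ex: "jac (f(k := h)) x = (\<Sum>j\<in>UNIV. c j x * dd (axis j 1) h x)" for h x
    unfolding jac_upd c_def by (subst rdet_expand) (simp add: grad_def mult.commute)
  have int: "integrable lebesgue (\<lambda>x. c j x * dd (axis j 1) h x)" if h: "M-lipschitz_on UNIV h" for h M j
  proof (rule integrable_mult_bounded[OF ci])
    have Lh: "Lip h" using h unfolding Lip_def by blast
    then show "dd (axis j 1) h \<in> borel_measurable lebesgue" by (rule dd_measurable)
    show "AE x in lebesgue. \<bar>dd (axis j 1) h x\<bar> \<le> M * norm (axis j (1::real) :: real^'n)"
      using Lip_AE_diffable_along[OF Lh, where v="axis j 1"] by (rule eventually_mono) (rule dd_bounded[OF h])
  qed
  have tl: "(\<lambda>n. \<Sum>j\<in>UNIV. \<integral>x. c j x * dd (axis j 1) (F n) x \<partial>lebesgue) \<longlonglongrightarrow> (\<Sum>j\<in>UNIV. \<integral>x. c j x * dd (axis j 1) g x \<partial>lebesgue)"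
    by (intro tendsto_sum dd_weak_star[OF L lim] ci)
  have e1: "(\<Sum>j\<in>UNIV. \<integral>x. c j x * dd (axis j 1) h x \<partial>lebesgue) = (\<integral>x. jac (f(k := h)) x \<partial>lebesgue)"
    if "M-lipschitz_on UNIV h" for h M
    unfolding ex using int[OF that] by (simp add: Bochner_Integration.integral_sum)
  have "(\<lambda>n. \<integral>x. jac (f(k := F n)) x \<partial>lebesgue) \<longlonglongrightarrow> (\<integral>x. jac (f(k := g)) x \<partial>lebesgue)"
    using tl unfolding e1[OF L(1)] e1[OF L(2)] .
  moreover have "(\<integral>x. jac (f(k := F n)) x \<partial>lebesgue) = 0" for n using F f unfolding null_row_def by blast
  ultimately show "(\<integral>x. jac (f(k := g)) x \<partial>lebesgue) = 0" by (simp add: LIMSEQ_const_iff)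
qed

text \<open>f is the infimum of the cones \<open>f y + L |x - y|\<close> over a countable dense set
  of apexes y, and finite minima of cones share a Lipschitz constant. The l1 norm is used because it
  is a sum of absolute values of affine functions, so the cones lie in the class.\<close>

lemma null_row_Lip:
  assumes lin: "\<And>v. null_row k0 S k (\<lambda>x. v \<bullet> x)" and f: "Lip f"
  shows "null_row k0 S k f"
proof -
  obtain L where L: "L-lipschitz_on UNIV f" using f unfolding Lip_def by blast
  have L0: "0 \<le> L" using lipschitz_on_nonneg[OF L] .
  obtain D :: "(real^'n) set" where D: "countable D" "\<And>X. open X \<Longrightarrow> X \<noteq> {} \<Longrightarrow> \<exists>d\<in>D. d \<in> X"
    using countable_dense_exists by blast
  have "D \<noteq> {}" using D(2)[of UNIV] by auto
  define q where "q = from_nat_into D"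
  define l1 where "l1 x = (\<Sum>j\<in>UNIV. \<bar>x $ j\<bar>)" for x :: "real^'n"
  define cone where "cone y x = f y + L * l1 (x - y)" for x y
  have l1_tri: "l1 (x + y) \<le> l1 x + l1 y" for x y
    by (simp add: l1_def sum.distrib[symmetric] sum_mono)
  have l1_norm: "norm x \<le> l1 x" "l1 x \<le> real CARD('n) * norm x" for x
    using norm_le_l1_cart[of x] sum_bounded_above[of UNIV "\<lambda>j. \<bar>x $ j\<bar>" "norm x"] component_le_norm_cart[of x] by (auto simp: l1_def)
  have cone_lip: "(L * real CARD('n))-lipschitz_on UNIV (cone y)" for y
  proof (rule lipschitz_onI)
    fix u v
    have "l1 (u - y) \<le> l1 (u - v) + l1 (v - y)" "l1 (v - y) \<le> l1 (v - u) + l1 (u - y)"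
      using l1_tri[of "u - v" "v - y"] l1_tri[of "v - u" "u - y"] by auto
    moreover have "l1 (u - v) \<le> real CARD('n) * norm (u - v)" "l1 (v - u) \<le> real CARD('n) * norm (u - v)"
      using l1_norm(2)[of "u - v"] l1_norm(2)[of "v - u"] by (auto simp: norm_minus_commute)
    ultimately have "\<bar>l1 (u - y) - l1 (v - y)\<bar> \<le> real CARD('n) * norm (u - v)" by linarith
    then have "L * \<bar>l1 (u - y) - l1 (v - y)\<bar> \<le> L * (real CARD('n) * norm (u - v))" using L0 by (rule mult_left_mono)
    then show "dist (cone y u) (cone y v) \<le> L * real CARD('n) * dist u v"
      using L0 by (simp add: cone_def dist_norm abs_mult flip: right_diff_distrib)
  qed (use L0 in simp)
  have cone_null: "null_row k0 S k (cone y)" for y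
  proof -
    have "cone y = (\<lambda>x. f y + L * (\<Sum>j\<in>UNIV. \<bar>axis j 1 \<bullet> x + (- (y $ j))\<bar>))"
      by (simp add: cone_def l1_def inner_axis' fun_eq_iff)
    then show ?thesis
      by (simp only:) (intro null_row_add null_row_const null_row_cmult null_row_sum null_row_abs lin finite_class.finite_UNIV)
  qed
  define F where "F = rec_nat (cone (q 0)) (\<lambda>n g x. min (g x) (cone (q (Suc n)) x))"
  have F_simps: "F 0 = cone (q 0)" "F (Suc n) = (\<lambda>x. min (F n x) (cone (q (Suc n)) x))" for n
    by (auto simp: F_def)
  have F_null: "null_row k0 S k (F n)" for n
    by (induction n) (auto simp: F_simps intro: null_row_min cone_null)
  have F_lip: "(L * real CARD('n))-lipschitz_on UNIV (F n)" for n
  proof (induction n)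
    case (Suc n)
    show ?case
    proof (rule lipschitz_onI)
      fix u v
      have "\<bar>F n u - F n v\<bar> \<le> L * real CARD('n) * dist u v" "\<bar>cone (q (Suc n)) u - cone (q (Suc n)) v\<bar> \<le> L * real CARD('n) * dist u v"
        using lipschitz_onD[OF Suc, of u v] lipschitz_onD[OF cone_lip, of u v] by (auto simp: dist_real_def)
      then show "dist (F (Suc n) u) (F (Suc n) v) \<le> L * real CARD('n) * dist u v"
        by (auto simp: F_simps dist_real_def min_def)
    qed (use L0 in simp)
  qed (simp add: F_simps cone_lip)
  have cone_ge: "f x \<le> cone y x" for x y
  proof -
    have "\<bar>f x - f y\<bar> \<le> L * norm (x - y)" using lipschitz_onD[OF L, of x y] by (simp add: dist_norm)
    also have "\<dots> \<le> L * l1 (x - y)" using l1_norm(1) L0 by (rule mult_left_mono)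
    finally show ?thesis by (simp add: cone_def)
  qed
  have F_ge: "f x \<le> F n x" for n x by (induction n) (auto simp: F_simps cone_ge)
  have F_le: "F n x \<le> cone (q m) x" if "m \<le> n" for m n x
    using that by (induction n) (auto simp: F_simps le_Suc_eq min.coboundedI1 min.coboundedI2 min_le_iff_disj)
  have lim: "(\<lambda>n. F n x) \<longlonglongrightarrow> f x" for x
  proof (rule LIMSEQ_I)
    fix e :: real assume e: "e > 0"
    \<comment> \<open>This choice gives \<open>2 * (L + L * N) * d + d = e\<close> with N the
      dimension, hence \<open>(L + L * N) * d < e\<close>, also for L = 0.\<close>
    define d where "d = e / (2 * (L + L * real CARD('n)) + 1)"
    have d: "d > 0" using e L0 by (auto simp: d_def intro!: divide_pos_pos add_nonneg_pos)
    obtain y where y: "y \<in> D" "y \<in> ball x d" using D(2)[of "ball x d"] d by auto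
    obtain m where m: "q m = y" using from_nat_into_surj[OF D(1) y(1)] unfolding q_def by blast
    have small: "cone y x - f x < e"
    proof -
      have "f y - f x \<le> L * norm (x - y)" using lipschitz_onD[OF L, of y x] by (simp add: dist_norm norm_minus_commute)
      moreover have "L * l1 (x - y) \<le> L * (real CARD('n) * norm (x - y))" using l1_norm(2) L0 by (rule mult_left_mono)
      ultimately have "cone y x - f x \<le> (L + L * real CARD('n)) * norm (x - y)" by (simp add: cone_def algebra_simps)
      also have "\<dots> \<le> (L + L * real CARD('n)) * d" using y L0 by (intro mult_left_mono) (auto simp: dist_norm)
      also have "\<dots> < e"
      proof -
        have "(L + L * real CARD('n)) * d * 2 + d = e" using L0 by (simp add: d_def field_simps add_nonneg_eq_0_iff)
        moreover have "0 \<le> (L + L * real CARD('n)) * d" using L0 d by simp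
        ultimately show ?thesis using d by linarith
      qed
      finally show ?thesis .
    qed
    show "\<exists>N. \<forall>n\<ge>N. norm (F n x - f x) < e"
    proof (intro exI allI impI)
      fix n assume "m \<le> n"
      then show "norm (F n x - f x) < e" using F_le[of m n x] F_ge[of x n] small m by simp
    qed
  qed
  have "(L * real CARD('n))-lipschitz_on UNIV f"
    using L0 by (intro lipschitz_on_mono[OF L]) (auto simp: mult_le_cancel_left1)
  from null_row_limit[OF F_null F_lip this lim] show ?thesis .
qed

end

text \<open>With all rows except k0 linear the cofactors of row k0 are constants, and the integrals
  of the partial derivatives of \<open>f k0\<close> vanish. The induction then frees one row at a
  time.\<close>

lemma integral_jac_zero_admissible:
  fixes k0 :: "'n::finite"
  assumes "finite S"
  shows "admissible k0 S f \<Longrightarrow> (\<integral>x. jac f x \<partial>lebesgue) = 0"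
  using assms
proof (induction S arbitrary: f)
  case empty
  then have "\<forall>i. \<exists>v. i \<noteq> k0 \<longrightarrow> f i = (\<lambda>x. v \<bullet> x)" unfolding admissible_def by auto
  then obtain v where v: "\<And>i. i \<noteq> k0 \<Longrightarrow> f i = (\<lambda>x. v i \<bullet> x)" by metis
  have L: "Lip (f k0)" "bsupp (f k0)" using empty unfolding admissible_def by auto
  have "jac f x = (\<Sum>j\<in>UNIV. dd (axis j 1) (f k0) x * rdet (v(k0 := axis j 1)))" for x
  proof -
    have "jac f x = rdet (v(k0 := grad (f k0) x))"
      unfolding jac_def by (rule arg_cong[where f=rdet]) (auto simp: fun_eq_iff v grad_inner)
    then show ?thesis by (subst (asm) rdet_expand) (simp add: grad_def)
  qed
  moreover have "integrable lebesgue (dd (axis j 1) (f k0))" for j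
    using dd_bsupp_integrable[OF L] .
  ultimately show ?case using integral_dd_zero[OF L] by (simp add: Bochner_Integration.integral_sum)
next
  case (insert k S)
  show ?case
  proof (cases "k = k0")
    case True
    then have "admissible k0 S f" using insert.prems unfolding admissible_def by auto
    then show ?thesis by (rule insert.IH)
  next
    case False
    have lin: "null_row k0 S k (\<lambda>x. v \<bullet> x)" for v
      unfolding null_row_def
    proof (intro conjI allI impI Lip_inner)
      fix f assume "admissible k0 (insert k S) f"
      then have "admissible k0 S (f(k := (\<lambda>x. v \<bullet> x)))" using False Lip_inner[of v] unfolding admissible_def by auto
      then show "(\<integral>x. jac (f(k := (\<lambda>x. v \<bullet> x))) x \<partial>lebesgue) = 0" by (rule insert.IH)
    qed
    have "null_row k0 S k (f k)"
      by (rule null_row_Lip[OF False lin]) (use insert.prems in \<open>auto simp: admissible_def\<close>)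
    then show ?thesis using insert.prems unfolding null_row_def by fastforce
  qed
qed

theorem integral_jac_zero:
  fixes f :: "'n::finite \<Rightarrow> real^'n \<Rightarrow> real"
  assumes "\<And>i. Lip (f i)" "bsupp (f k)"
  shows "(\<integral>x. jac f x \<partial>lebesgue) = 0"
  by (rule integral_jac_zero_admissible[OF finite_class.finite_UNIV, of k]) (use assms in \<open>simp add: admissible_def\<close>)

text \<open>Put \<open>u * g\<close> in row k: the integral vanishes because u has bounded support,
  and the product rule splits the row into the two terms.\<close>

lemma integral_jac_by_parts:
  fixes f :: "'n::finite \<Rightarrow> real^'n \<Rightarrow> real"
  assumes f: "\<And>i. Lip (f i)" and u: "Lip u" "bsupp u" and g: "Lip g"
  shows "(\<integral>x. u x * jac (f(k := g)) x \<partial>lebesgue) = - (\<integral>x. g x * jac (f(k := u)) x \<partial>lebesgue)"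
    and "integrable lebesgue (\<lambda>x. u x * jac (f(k := g)) x)"
    and "integrable lebesgue (\<lambda>x. g x * jac (f(k := u)) x)"
proof -
  have Lug: "Lip (\<lambda>x. u x * g x)" by (rule Lip_mult_bsupp[OF u g])
  have Lf: "\<And>i. Lip ((f(k := h)) i)" if "Lip h" for h using that f by simp
  obtain M where M: "\<And>i. M-lipschitz_on UNIV ((f(k := g)) i)" using Lip_common[of "f(k := g)", OF Lf[OF g]] by blast
  show i1: "integrable lebesgue (\<lambda>x. u x * jac (f(k := g)) x)"
    by (rule integrable_mult_bounded[OF Lip_bsupp_integrable[OF u] jac_measurable[OF Lf[OF g]] jac_bounded[OF M]])
  have i2: "integrable lebesgue (jac (f(k := (\<lambda>x. u x * g x))))"
    by (rule jac_integrable[where k=k]) (use Lug f bsupp_mult(1)[OF u(2)] in auto)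
  have ae: "AE x in lebesgue. jac (f(k := (\<lambda>x. u x * g x))) x - u x * jac (f(k := g)) x = g x * jac (f(k := u)) x"
    using Lip_AE_pd[OF u(1)] Lip_AE_pd[OF g]
  proof eventually_elim
    case (elim x)
    show ?case unfolding jac_upd grad_mult(2)[OF elim]
      by (simp only: linear_add[OF rdet_linear] linear_scale[OF rdet_linear] real_scaleR_def)
  qed
  have i12: "integrable lebesgue (\<lambda>x. jac (f(k := (\<lambda>x. u x * g x))) x - u x * jac (f(k := g)) x)" using i1 i2 by simp
  show "integrable lebesgue (\<lambda>x. g x * jac (f(k := u)) x)" by (rule integrable_AE_eq(1)[OF i12 ae])
  have "(\<integral>x. g x * jac (f(k := u)) x \<partial>lebesgue) = (\<integral>x. jac (f(k := (\<lambda>x. u x * g x))) x - u x * jac (f(k := g)) x \<partial>lebesgue)"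
    by (rule integrable_AE_eq(2)[OF i12 ae, symmetric])
  also have "\<dots> = - (\<integral>x. u x * jac (f(k := g)) x \<partial>lebesgue)"
  proof -
    have "(\<integral>x. jac (f(k := (\<lambda>x. u x * g x))) x \<partial>lebesgue) = 0"
      by (rule integral_jac_zero[where k=k]) (use Lug f bsupp_mult(1)[OF u(2)] in auto)
    then show ?thesis using i1 i2 by simp
  qed
  finally show "(\<integral>x. u x * jac (f(k := g)) x \<partial>lebesgue) = - (\<integral>x. g x * jac (f(k := u)) x \<partial>lebesgue)" by simp
qed

section \<open>Convergence and difference quotients of Jacobian integrals, one row at a time\<close>

section \<open>Weak continuity\<close>

lemma jac_upd_diff:
  assumes "Lip g" "Lip h"
  shows "AE x in lebesgue. jac (f(k := (\<lambda>x. g x - h x))) x = jac (f(k := g)) x - jac (f(k := h)) x"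
  using Lip_AE_pd[OF assms(1)] Lip_AE_pd[OF assms(2)]
proof eventually_elim
  case (elim x)
  show ?case unfolding jac_upd grad_diff(2)[OF elim] by (rule linear_diff[OF rdet_linear])
qed

text \<open>The key estimate of this part: changing one row is paid for by the values of
  \<open>g - h\<close> alone, the derivative having moved to u.\<close>

lemma integral_jac_upd_diff:
  fixes f :: "'n::finite \<Rightarrow> real^'n \<Rightarrow> real"
  assumes f: "\<And>i. Lip (f i)" and u: "Lip u" "bsupp u" and g: "Lip g" "Lip h"
  shows "(\<integral>x. u x * jac (f(k := g)) x \<partial>lebesgue) - (\<integral>x. u x * jac (f(k := h)) x \<partial>lebesgue)
    = - (\<integral>x. (g x - h x) * jac (f(k := u)) x \<partial>lebesgue)"
proof -
  note P = integral_jac_by_parts[where f=f and k=k, OF f u]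
  have Ld: "Lip (\<lambda>x. g x - h x)" by (rule Lip_diff[OF g])
  have "(\<integral>x. u x * jac (f(k := (\<lambda>x. g x - h x))) x \<partial>lebesgue) = (\<integral>x. u x * jac (f(k := g)) x - u x * jac (f(k := h)) x \<partial>lebesgue)"
    using P(2)[OF Ld] P(2)[OF g(1)] P(2)[OF g(2)] jac_upd_diff[OF g, of f k]
    by (intro integral_cong_AE) (auto simp: right_diff_distrib elim!: eventually_mono)
  also have "\<dots> = (\<integral>x. u x * jac (f(k := g)) x \<partial>lebesgue) - (\<integral>x. u x * jac (f(k := h)) x \<partial>lebesgue)"
    using P(2)[OF g(1)] P(2)[OF g(2)] by simp
  finally show ?thesis using P(1)[OF Ld] by simp
qed

text \<open>The intermediate stages of a telescoping argument that exchanges the rows of g for those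
  of f, with S the rows already exchanged.\<close>

definition mix :: "'i set \<Rightarrow> ('i \<Rightarrow> 'b) \<Rightarrow> ('i \<Rightarrow> 'b) \<Rightarrow> 'i \<Rightarrow> 'b" where
  "mix S f g i = (if i \<in> S then f i else g i)"

lemma mix_insert: "mix (insert k S) f g = (mix S f g)(k := f k)"
  by (auto simp: mix_def fun_eq_iff)

lemma mix_upd: "k \<notin> S \<Longrightarrow> (mix S f g)(k := g k) = mix S f g"
  by (auto simp: mix_def fun_eq_iff)

lemma mix_UNIV: "mix UNIV f g = f" and mix_empty: "mix {} f g = g"
  by (auto simp: mix_def fun_eq_iff)

text \<open>Each exchange of a row costs the integral of \<open>F n k - G k\<close> against a
  bounded Jacobian supported where h is. Pointwise convergence therefore suffices although
  derivatives of all rows appear.\<close>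

lemma jac_weak_star:
  fixes F :: "nat \<Rightarrow> 'n::finite \<Rightarrow> real^'n \<Rightarrow> real"
  assumes L: "\<And>n i. L-lipschitz_on UNIV (F n i)" "\<And>i. L-lipschitz_on UNIV (G i)"
    and lim: "\<And>i x. (\<lambda>n. F n i x) \<longlonglongrightarrow> G i x" and p: "integrable lebesgue p"
  shows "(\<lambda>n. \<integral>x. p x * jac (F n) x \<partial>lebesgue) \<longlonglongrightarrow> (\<integral>x. p x * jac G x \<partial>lebesgue)"
proof (rule weak_star_density[where M="det_bound TYPE('n) L"])
  have Lf: "Lip (F n i)" "Lip (G i)" for n i using L unfolding Lip_def by blast+
  show "jac (F n) \<in> borel_measurable lebesgue" "jac G \<in> borel_measurable lebesgue" for n
    using jac_measurable Lf by blast+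
  show "AE x in lebesgue. \<bar>jac (F n) x\<bar> \<le> det_bound TYPE('n) L" "AE x in lebesgue. \<bar>jac G x\<bar> \<le> det_bound TYPE('n) L" for n
    using jac_bounded L by blast+
  show "integrable lebesgue p" by fact
  fix h :: "real^'n \<Rightarrow> real" assume h: "Lip h" "bsupp h"
  obtain M where M: "M-lipschitz_on UNIV h" using h unfolding Lip_def by blast
  obtain R where R: "\<And>x. R \<le> norm x \<Longrightarrow> h x = 0" using h(2) unfolding bsupp_def by blast
  have L0: "0 \<le> L" using lipschitz_on_nonneg[OF L(2)] .
  \<comment> \<open>After integration by parts the test function h is one of the rows, so its
    Lipschitz constant M enters the bound.\<close>
  define K where "K = max L M"
  have "(\<lambda>n. \<integral>x. h x * jac (mix S (F n) G) x \<partial>lebesgue) \<longlonglongrightarrow> (\<integral>x. h x * jac G x \<partial>lebesgue)" if "finite S" for S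
    using that
  proof (induction S)
    case empty then show ?case by (simp add: mix_empty)
  next
    case (insert k S)
    let ?m = "\<lambda>n. mix S (F n) G"
    have Lm: "L-lipschitz_on UNIV (?m n i)" for n i using L by (auto simp: mix_def)
    have Lm': "Lip (?m n i)" for n i using Lm unfolding Lip_def by blast
    have LK: "K-lipschitz_on UNIV (((?m n)(k := h)) i)" for n i
      using lipschitz_on_mono[OF Lm[of n i], of UNIV K] lipschitz_on_mono[OF M, of UNIV K] by (auto simp: K_def)
    have B: "\<exists>B. \<forall>n. \<bar>F n k 0\<bar> \<le> B"
      using convergent_imp_Bseq[OF convergentI[OF lim[of k 0]]] unfolding Bseq_def by auto
    then obtain B where B: "\<And>n. \<bar>F n k 0\<bar> \<le> B" by blast
    have eq: "(\<integral>x. h x * jac (mix (insert k S) (F n) G) x \<partial>lebesgue)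
      = (\<integral>x. h x * jac (?m n) x \<partial>lebesgue) - (\<integral>x. (F n k x - G k x) * jac ((?m n)(k := h)) x \<partial>lebesgue)" for n
      using integral_jac_upd_diff[where f="?m n" and k=k and u=h and g="F n k" and h="G k", OF Lm' h Lf]
      by (simp add: mix_insert mix_upd insert.hyps)
    have "(\<lambda>n. \<integral>x. (F n k x - G k x) * jac ((?m n)(k := h)) x \<partial>lebesgue) \<longlonglongrightarrow> (\<integral>x. 0 \<partial>(lebesgue :: (real^'n) measure))"
    proof (rule integral_dominated_convergence[where w="\<lambda>x. ((B + L * \<bar>R\<bar>) + (\<bar>G k 0\<bar> + L * \<bar>R\<bar>)) * det_bound TYPE('n) K * indicator (cball 0 R) x"])
      have bd: "AE x in lebesgue. \<bar>jac ((?m n)(k := h)) x\<bar> \<le> det_bound TYPE('n) K" for n using jac_bounded[OF LK] .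
      have "AE x in lebesgue. \<forall>n. \<bar>jac ((?m n)(k := h)) x\<bar> \<le> det_bound TYPE('n) K" using bd by (simp add: AE_all_countable)
      then show "AE x in lebesgue. (\<lambda>n. (F n k x - G k x) * jac ((?m n)(k := h)) x) \<longlonglongrightarrow> 0"
      proof (rule eventually_mono)
        fix x assume *: "\<forall>n. \<bar>jac ((?m n)(k := h)) x\<bar> \<le> det_bound TYPE('n) K"
        have "(\<lambda>n. (F n k x - G k x)) \<longlonglongrightarrow> 0" using lim[of k x] by (simp add: LIM_zero)
        then have "(\<lambda>n. \<bar>F n k x - G k x\<bar> * det_bound TYPE('n) K) \<longlonglongrightarrow> 0"
          by (intro tendsto_mult_left_zero tendsto_rabs_zero)
        then show "(\<lambda>n. (F n k x - G k x) * jac ((?m n)(k := h)) x) \<longlonglongrightarrow> 0"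
          by (rule Lim_null_comparison[rotated]) (use * in \<open>auto simp: abs_mult intro!: always_eventually mult_left_mono\<close>)
      qed
      show "AE x in lebesgue. norm ((F n k x - G k x) * jac ((?m n)(k := h)) x) \<le> ((B + L * \<bar>R\<bar>) + (\<bar>G k 0\<bar> + L * \<bar>R\<bar>)) * det_bound TYPE('n) K * indicator (cball 0 R) x" for n
        using bd[of n]
      proof (rule eventually_mono)
        fix x assume b: "\<bar>jac ((?m n)(k := h)) x\<bar> \<le> det_bound TYPE('n) K"
        show "norm ((F n k x - G k x) * jac ((?m n)(k := h)) x) \<le> ((B + L * \<bar>R\<bar>) + (\<bar>G k 0\<bar> + L * \<bar>R\<bar>)) * det_bound TYPE('n) K * indicator (cball 0 R) x"
        proof (cases "norm x \<le> R")
          case True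
          have "\<bar>F n k x\<bar> \<le> \<bar>F n k 0\<bar> + L * norm x" using lipschitz_onD[OF L(1)[of n k], of x 0] by (simp add: dist_norm)
          also have "\<dots> \<le> B + L * \<bar>R\<bar>" using B True L0 by (intro add_mono mult_left_mono) auto
          finally have 1: "\<bar>F n k x\<bar> \<le> B + L * \<bar>R\<bar>" .
          have "\<bar>G k x\<bar> \<le> \<bar>G k 0\<bar> + L * norm x" using lipschitz_onD[OF L(2)[of k], of x 0] by (simp add: dist_norm)
          also have "\<dots> \<le> \<bar>G k 0\<bar> + L * \<bar>R\<bar>" using True L0 by (intro add_mono mult_left_mono) auto
          finally have "\<bar>F n k x - G k x\<bar> \<le> (B + L * \<bar>R\<bar>) + (\<bar>G k 0\<bar> + L * \<bar>R\<bar>)" using 1 by linarith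
          then show ?thesis using True b by (auto simp: abs_mult intro!: mult_mono)
        next
          case False
          then have "jac ((?m n)(k := h)) x = 0" by (intro jac_zero_outside[of R _ k]) (use R in auto)
          then show ?thesis using False by simp
        qed
      qed
      show "integrable lebesgue (\<lambda>x::real^'n. ((B + L * \<bar>R\<bar>) + (\<bar>G k 0\<bar> + L * \<bar>R\<bar>)) * det_bound TYPE('n) K * indicator (cball 0 R) x :: real)"
        by (rule integrable_const_cball)
      show "(\<lambda>x. (F n k x - G k x) * jac ((?m n)(k := h)) x) \<in> borel_measurable lebesgue" for n
        by (intro borel_measurable_times borel_measurable_diff Lip_measurable Lf jac_measurable) (use Lm' h in auto)
    qed simp
    from tendsto_diff[OF insert.IH this] show ?case unfolding eq by simp
  qed
  from this[OF finite_class.finite_UNIV] show "(\<lambda>n. \<integral>x. h x * jac (F n) x \<partial>lebesgue) \<longlonglongrightarrow> (\<integral>x. h x * jac G x \<partial>lebesgue)"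
    by (simp add: mix_UNIV)
qed

text \<open>\<open>pn n\<close> tends to p in L1 and \<open>Dn n\<close> stays bounded, so the
  integral of \<open>(pn n - p) * Dn n\<close> tends to 0; the rest is weak-star convergence against
  the fixed p.\<close>

lemma strong_weak_star:
  fixes D :: "'a::euclidean_space \<Rightarrow> real"
  assumes D: "\<And>n. Dn n \<in> borel_measurable lebesgue" "\<And>n. AE x in lebesgue. \<bar>Dn n x\<bar> \<le> M"
    and conv: "\<And>p. integrable lebesgue p \<Longrightarrow> (\<lambda>n. \<integral>x. p x * Dn n x \<partial>lebesgue) \<longlonglongrightarrow> (\<integral>x. p x * D x \<partial>lebesgue)"
    and p: "\<And>n. pn n \<in> borel_measurable lebesgue" "\<And>n. AE x in lebesgue. \<bar>pn n x\<bar> \<le> C * indicator (cball 0 R) x"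
    and lim: "AE x in lebesgue. (\<lambda>n. pn n x) \<longlonglongrightarrow> p x"
  shows "(\<lambda>n. \<integral>x. pn n x * Dn n x \<partial>lebesgue) \<longlonglongrightarrow> (\<integral>x. p x * D x \<partial>lebesgue)"
proof -
  let ?w = "\<lambda>x::'a. C * indicator (cball 0 R) x :: real"
  have pm: "p \<in> borel_measurable lebesgue" by (rule borel_measurable_LIMSEQ_AE[OF p(1) lim])
  have bd: "AE x in lebesgue. \<forall>n. \<bar>pn n x\<bar> \<le> ?w x" using p(2) by (simp add: AE_all_countable)
  have pb: "AE x in lebesgue. \<bar>p x\<bar> \<le> ?w x"
    using bd lim
  proof eventually_elim
    case (elim x) show ?case by (rule LIMSEQ_le_const2[OF tendsto_rabs[OF elim(2)]]) (use elim(1) in blast)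
  qed
  have pi: "integrable lebesgue p" by (rule integrable_bounded_support[OF pm pb])
  have pni: "integrable lebesgue (pn n)" for n by (rule integrable_bounded_support[OF p(1) p(2)])
  have int: "integrable lebesgue (\<lambda>x. q x * Dn n x)" if "integrable lebesgue q" for q n
    by (rule integrable_mult_bounded[OF that D(1) D(2)])
  have "(\<lambda>n. \<integral>x. \<bar>pn n x - p x\<bar> \<partial>lebesgue) \<longlonglongrightarrow> (\<integral>x. 0 \<partial>(lebesgue :: 'a measure))"
  proof (rule integral_dominated_convergence[where w="\<lambda>x. 2 * ?w x"])
    show "AE x in lebesgue. (\<lambda>n. \<bar>pn n x - p x\<bar>) \<longlonglongrightarrow> 0"
      using lim by (rule eventually_mono) (auto intro!: tendsto_eq_intros)
    show "AE x in lebesgue. norm \<bar>pn n x - p x\<bar> \<le> 2 * ?w x" for n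
      using p(2)[of n] pb
    proof eventually_elim
      case (elim x)
      have "norm \<bar>pn n x - p x\<bar> \<le> \<bar>pn n x\<bar> + \<bar>p x\<bar>" using abs_triangle_ineq4[of "pn n x" "p x"] by simp
      also have "\<dots> \<le> 2 * ?w x" using elim by linarith
      finally show ?case .
    qed
    show "integrable lebesgue (\<lambda>x. 2 * ?w x)" by (intro integrable_mult_right integrable_const_cball)
  qed (use p pm in auto)
  then have "(\<lambda>n. \<bar>M\<bar> * (\<integral>x. \<bar>pn n x - p x\<bar> \<partial>lebesgue)) \<longlonglongrightarrow> 0" by (auto intro!: tendsto_eq_intros)
  then have "(\<lambda>n. \<integral>x. (pn n x - p x) * Dn n x \<partial>lebesgue) \<longlonglongrightarrow> 0"
  proof (rule Lim_null_comparison[rotated], intro always_eventually allI)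
    fix n
    have "norm (\<integral>x. (pn n x - p x) * Dn n x \<partial>lebesgue) \<le> (\<integral>x. norm ((pn n x - p x) * Dn n x) \<partial>lebesgue)"
      by (rule integral_norm_bound)
    also have "\<dots> \<le> (\<integral>x. \<bar>M\<bar> * \<bar>pn n x - p x\<bar> \<partial>lebesgue)"
    proof (rule integral_mono_AE)
      show "AE x in lebesgue. norm ((pn n x - p x) * Dn n x) \<le> \<bar>M\<bar> * \<bar>pn n x - p x\<bar>"
        using D(2)[of n]
      proof (rule eventually_mono)
        fix x assume "\<bar>Dn n x\<bar> \<le> M"
        then have "\<bar>pn n x - p x\<bar> * \<bar>Dn n x\<bar> \<le> \<bar>pn n x - p x\<bar> * \<bar>M\<bar>" by (intro mult_left_mono) auto
        then show "norm ((pn n x - p x) * Dn n x) \<le> \<bar>M\<bar> * \<bar>pn n x - p x\<bar>" by (simp add: abs_mult mult.commute)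
      qed
    qed (use int[of "\<lambda>x. pn n x - p x" n] pi pni in auto)
    finally show "norm (\<integral>x. (pn n x - p x) * Dn n x \<partial>lebesgue) \<le> \<bar>M\<bar> * (\<integral>x. \<bar>pn n x - p x\<bar> \<partial>lebesgue)" by simp
  qed
  from tendsto_add[OF this conv[OF pi]]
  show ?thesis using int[OF pi] int[OF pni] by (simp add: left_diff_distrib)
qed

lemma LIMSEQ_of_bounded_quotient:
  fixes c :: real
  assumes "\<And>n. \<bar>real (Suc n) * (s n - c)\<bar> \<le> C"
  shows "s \<longlonglongrightarrow> c"
proof -
  have "(\<lambda>n. C * (1 / real (Suc n))) \<longlonglongrightarrow> C * 0"
    using LIMSEQ_inverse_real_of_nat by (intro tendsto_mult_left) (simp add: inverse_eq_divide)
  then have "(\<lambda>n. s n - c) \<longlonglongrightarrow> 0"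
  proof (rule Lim_null_comparison[rotated, OF tendsto_eq_rhs], simp, intro always_eventually allI)
    fix n
    have "\<bar>s n - c\<bar> * real (Suc n) \<le> C" using assms[of n] by (simp add: abs_mult mult.commute)
    then show "norm (s n - c) \<le> C * (1 / real (Suc n))" by (simp add: field_simps)
  qed
  then show ?thesis by (rule LIM_zero_cancel)
qed

text \<open>The difference of determinants telescopes over the rows. By parts, row k contributes
  minus its own difference quotient times a Jacobian with u in row k; the quotient converges
  boundedly almost everywhere and the Jacobian weakly-star.\<close>

lemma jac_difference_quotient:
  fixes X :: "nat \<Rightarrow> 'n::finite \<Rightarrow> real^'n \<Rightarrow> real"
  assumes L: "\<And>n i. L-lipschitz_on UNIV (X n i)" "\<And>i. L-lipschitz_on UNIV (Y i)"
    and C: "\<And>n i x. \<bar>real (Suc n) * (X n i x - Y i x)\<bar> \<le> C"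
    and W: "AE x in lebesgue. \<forall>i. (\<lambda>n. real (Suc n) * (X n i x - Y i x)) \<longlonglongrightarrow> W i x"
    and u: "Lip u" "bsupp u"
  shows "(\<lambda>n. real (Suc n) * ((\<integral>x. u x * jac (X n) x \<partial>lebesgue) - (\<integral>x. u x * jac Y x \<partial>lebesgue)))
    \<longlonglongrightarrow> - (\<Sum>i\<in>UNIV. \<integral>x. W i x * jac (Y(i := u)) x \<partial>lebesgue)"
proof -
  have Lf: "Lip (X n i)" "Lip (Y i)" for n i using L unfolding Lip_def by blast+
  obtain M where M: "M-lipschitz_on UNIV u" using u unfolding Lip_def by blast
  obtain R where R: "\<And>x. R \<le> norm x \<Longrightarrow> u x = 0" using u(2) unfolding bsupp_def by blast
  define K where "K = max L M"
  have lim: "(\<lambda>n. X n i x) \<longlonglongrightarrow> Y i x" for i x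
    by (rule LIMSEQ_of_bounded_quotient[OF C])
  have "(\<lambda>n. real (Suc n) * ((\<integral>x. u x * jac (mix S (X n) Y) x \<partial>lebesgue) - (\<integral>x. u x * jac Y x \<partial>lebesgue)))
    \<longlonglongrightarrow> - (\<Sum>i\<in>S. \<integral>x. W i x * jac (Y(i := u)) x \<partial>lebesgue)" if "finite S" for S
    using that
  proof (induction S)
    case empty then show ?case by (simp add: mix_empty)
  next
    case (insert k S)
    let ?m = "\<lambda>n. mix S (X n) Y"
    \<comment> \<open>The quotient is bounded but need not be integrable; the cutoff is harmless
      because the Jacobian with u in row k vanishes outside the ball.\<close>
    let ?V = "\<lambda>n x. indicator (cball 0 R) x * (real (Suc n) * (X n k x - Y k x))"
    have Lm: "L-lipschitz_on UNIV (?m n i)" for n i using L by (auto simp: mix_def)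
    have Lm': "Lip (?m n i)" for n i using Lm unfolding Lip_def by blast
    have LK: "K-lipschitz_on UNIV (((?m n)(k := u)) i)" "K-lipschitz_on UNIV ((Y(k := u)) i)" for n i
      using lipschitz_on_mono[OF Lm[of n i], of UNIV K] lipschitz_on_mono[OF M, of UNIV K] lipschitz_on_mono[OF L(2)[of i], of UNIV K]
      by (auto simp: K_def)
    have zero: "indicator (cball 0 R) x * jac (Z(k := u)) x = jac (Z(k := u)) x" for Z x
      by (cases "norm x \<le> R") (use jac_zero_outside[of R "Z(k := u)" k x] R in auto)
    have eq: "real (Suc n) * ((\<integral>x. u x * jac (mix (insert k S) (X n) Y) x \<partial>lebesgue) - (\<integral>x. u x * jac Y x \<partial>lebesgue))
      = real (Suc n) * ((\<integral>x. u x * jac (?m n) x \<partial>lebesgue) - (\<integral>x. u x * jac Y x \<partial>lebesgue))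
       - (\<integral>x. ?V n x * jac ((?m n)(k := u)) x \<partial>lebesgue)" for n
    proof -
      have "(\<integral>x. ?V n x * jac ((?m n)(k := u)) x \<partial>lebesgue) = (\<integral>x. real (Suc n) * ((X n k x - Y k x) * jac ((?m n)(k := u)) x) \<partial>lebesgue)"
        by (intro Bochner_Integration.integral_cong refl) (subst zero[symmetric], simp add: mult_ac)
      also have "\<dots> = real (Suc n) * (\<integral>x. (X n k x - Y k x) * jac ((?m n)(k := u)) x \<partial>lebesgue)"
        by (rule integral_mult_right_zero)
      also have "(\<integral>x. (X n k x - Y k x) * jac ((?m n)(k := u)) x \<partial>lebesgue)
         = (\<integral>x. u x * jac (?m n) x \<partial>lebesgue) - (\<integral>x. u x * jac (mix (insert k S) (X n) Y) x \<partial>lebesgue)"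
        using integral_jac_upd_diff[where f="?m n" and k=k and u=u and g="X n k" and h="Y k", OF Lm' u Lf]
        by (simp add: mix_insert mix_upd insert.hyps)
      finally have V: "(\<integral>x. ?V n x * jac ((?m n)(k := u)) x \<partial>lebesgue)
        = real (Suc n) * ((\<integral>x. u x * jac (?m n) x \<partial>lebesgue) - (\<integral>x. u x * jac (mix (insert k S) (X n) Y) x \<partial>lebesgue))" .
      have "r * (b - c) = r * (a - c) - r * (a - b)" for r a b c :: real by (simp add: algebra_simps)
      then show ?thesis unfolding V .
    qed
    have "(\<lambda>n. \<integral>x. ?V n x * jac ((?m n)(k := u)) x \<partial>lebesgue) \<longlonglongrightarrow> (\<integral>x. (indicator (cball 0 R) x * W k x) * jac (Y(k := u)) x \<partial>lebesgue)"
    proof (rule strong_weak_star[where M="det_bound TYPE('n) K" and C="\<bar>C\<bar>" and R=R])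
      show "jac ((?m n)(k := u)) \<in> borel_measurable lebesgue" for n
        by (rule jac_measurable) (use Lm' u in auto)
      show "AE x in lebesgue. \<bar>jac ((?m n)(k := u)) x\<bar> \<le> det_bound TYPE('n) K" for n using jac_bounded[OF LK(1)] .
      show "(\<lambda>n. \<integral>x. p x * jac ((?m n)(k := u)) x \<partial>lebesgue) \<longlonglongrightarrow> (\<integral>x. p x * jac (Y(k := u)) x \<partial>lebesgue)"
        if "integrable lebesgue p" for p
      proof (rule jac_weak_star[OF LK _ that])
        show "(\<lambda>n. ((?m n)(k := u)) i x) \<longlonglongrightarrow> (Y(k := u)) i x" for i x
          by (cases "i = k"; cases "i \<in> S") (auto simp: mix_def lim)
      qed
      show "?V n \<in> borel_measurable lebesgue" for n
        using Lip_measurable[OF Lf(1)[of n k]] Lip_measurable[OF Lf(2)[of k]]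
        by (intro borel_measurable_times borel_measurable_indicator borel_measurable_diff) auto
      show "AE x in lebesgue. \<bar>?V n x\<bar> \<le> \<bar>C\<bar> * indicator (cball 0 R) x" for n
        using order.trans[OF C[of n k] abs_ge_self] by (intro AE_I2) (auto simp: indicator_def)
      show "AE x in lebesgue. (\<lambda>n. ?V n x) \<longlonglongrightarrow> indicator (cball 0 R) x * W k x"
        using W by (rule eventually_mono) (auto intro: tendsto_mult_left)
    qed
    moreover have "(\<integral>x. (indicator (cball 0 R) x * W k x) * jac (Y(k := u)) x \<partial>lebesgue) = (\<integral>x. W k x * jac (Y(k := u)) x \<partial>lebesgue)"
      by (intro Bochner_Integration.integral_cong refl) (subst (2) zero[symmetric], simp add: mult_ac)
    ultimately have "(\<lambda>n. \<integral>x. ?V n x * jac ((?m n)(k := u)) x \<partial>lebesgue) \<longlonglongrightarrow> (\<integral>x. W k x * jac (Y(k := u)) x \<partial>lebesgue)"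
      by (rule tendsto_eq_rhs)
    note lim_k = this
    have arith: "- a - b = - (b + a)" for a b :: real by simp
    have sm: "(\<Sum>i\<in>insert k S. Z i) = Z k + (\<Sum>i\<in>S. Z i)" for Z :: "'n \<Rightarrow> real"
      using insert.hyps by simp
    from tendsto_diff[OF insert.IH lim_k] show ?case
      unfolding eq sm by (rule tendsto_eq_rhs) (rule arith)
  qed
  from this[OF finite_class.finite_UNIV] show ?thesis by (simp add: mix_UNIV)
qed

text \<open>The terms with \<open>W\<close> come from integrating by parts; the expansion
  \<open>\<Sum>i. (\<nabla>Y i \<bullet> a) det (Y with row i := \<nabla>u) = (a \<bullet> \<nabla>u) det (\<nabla>Y)\<close> turns them into a transport derivative of \<open>u\<close>.\<close>
lemma transport_difference_quotient:
  fixes X :: "nat \<Rightarrow> 'n::finite \<Rightarrow> real^'n \<Rightarrow> real"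
  assumes L: "\<And>n i. L-lipschitz_on UNIV (X n i)" "\<And>i. L-lipschitz_on UNIV (Y i)"
    and C: "\<And>n i x. \<bar>real (Suc n) * (X n i x - Y i x)\<bar> \<le> C"
    and W: "AE x in lebesgue. \<forall>i. (\<lambda>n. real (Suc n) * (X n i x - Y i x)) \<longlonglongrightarrow> - (a x \<bullet> grad (Y i) x)"
    and u: "Lip u" "\<And>n. Lip (v n)" "\<And>x. R \<le> norm x \<Longrightarrow> u x = 0" "\<And>n x. R \<le> norm x \<Longrightarrow> v n x = 0"
    and Cu: "\<And>n x. \<bar>real (Suc n) * (v n x - u x)\<bar> \<le> C"
    and ut: "AE x in lebesgue. (\<lambda>n. real (Suc n) * (v n x - u x)) \<longlonglongrightarrow> ut x"
  shows "(\<lambda>n. real (Suc n) * ((\<integral>x. v n x * jac (X n) x \<partial>lebesgue) - (\<integral>x. u x * jac Y x \<partial>lebesgue)))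
    \<longlonglongrightarrow> (\<integral>x. (ut x + a x \<bullet> grad u x) * jac Y x \<partial>lebesgue)"
    and "integrable lebesgue (\<lambda>x. (ut x + a x \<bullet> grad u x) * jac Y x)"
proof -
  have Lf: "Lip (X n i)" "Lip (Y i)" for n i using L unfolding Lip_def by blast+
  obtain M where M: "M-lipschitz_on UNIV u" using u unfolding Lip_def by blast
  have bs: "bsupp u" "bsupp (v n)" for n using u unfolding bsupp_def by blast+
  define K where "K = max L M"
  have L0: "0 \<le> L" using lipschitz_on_nonneg[OF L(2)] .
  have C0: "0 \<le> C" using C[of 0 undefined undefined] by linarith
  have LK: "K-lipschitz_on UNIV ((Y(k := u)) i)" for i k
    using lipschitz_on_mono[OF M, of UNIV K] lipschitz_on_mono[OF L(2)[of i], of UNIV K] by (auto simp: K_def)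
  have lim: "(\<lambda>n. X n i x) \<longlonglongrightarrow> Y i x" for i x
    by (rule LIMSEQ_of_bounded_quotient[OF C])
  define J where "J i x = - (a x \<bullet> grad (Y i) x)" for i x
  have J1: "(\<lambda>n. real (Suc n) * ((\<integral>x. u x * jac (X n) x \<partial>lebesgue) - (\<integral>x. u x * jac Y x \<partial>lebesgue)))
    \<longlonglongrightarrow> - (\<Sum>i\<in>UNIV. \<integral>x. J i x * jac (Y(i := u)) x \<partial>lebesgue)"
    unfolding J_def by (rule jac_difference_quotient[OF L C W u(1) bs(1)])
  have J2: "(\<lambda>n. \<integral>x. real (Suc n) * (v n x - u x) * jac (X n) x \<partial>lebesgue) \<longlonglongrightarrow> (\<integral>x. ut x * jac Y x \<partial>lebesgue)"
  proof (rule strong_weak_star[where M="det_bound TYPE('n) L" and C=C and R=R])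
    show "jac (X n) \<in> borel_measurable lebesgue" for n by (rule jac_measurable[OF Lf(1)])
    show "AE x in lebesgue. \<bar>jac (X n) x\<bar> \<le> det_bound TYPE('n) L" for n by (rule jac_bounded[OF L(1)])
    show "(\<lambda>x. real (Suc n) * (v n x - u x)) \<in> borel_measurable lebesgue" for n
      using Lip_measurable[OF u(1)] Lip_measurable[OF u(2)[of n]] by auto
    show "AE x in lebesgue. \<bar>real (Suc n) * (v n x - u x)\<bar> \<le> C * indicator (cball 0 R) x" for n
    proof (rule AE_I2)
      fix x show "\<bar>real (Suc n) * (v n x - u x)\<bar> \<le> C * indicator (cball 0 R) x"
        using Cu[of n x] u(3,4)[of x] by (cases "norm x \<le> R") auto
    qed
  qed (use ut in \<open>auto intro: jac_weak_star[OF L lim]\<close>)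
  have int: "integrable lebesgue (\<lambda>x. h x * jac Z x)" if "Lip h" "bsupp h" "\<And>i. L-lipschitz_on UNIV (Z i)" for h and Z :: "'n \<Rightarrow> real^'n \<Rightarrow> real"
    by (rule integrable_mult_bounded[OF Lip_bsupp_integrable[OF that(1,2)] jac_measurable jac_bounded[OF that(3)]])
       (use that(3) in \<open>auto simp: Lip_def\<close>)
  \<comment> \<open>Discrete product rule: the increment of the weight is paired with the new
    Jacobian, the increment of the Jacobian with the old weight.\<close>
  have eq: "real (Suc n) * ((\<integral>x. v n x * jac (X n) x \<partial>lebesgue) - (\<integral>x. u x * jac Y x \<partial>lebesgue))
     = (\<integral>x. real (Suc n) * (v n x - u x) * jac (X n) x \<partial>lebesgue)
      + real (Suc n) * ((\<integral>x. u x * jac (X n) x \<partial>lebesgue) - (\<integral>x. u x * jac Y x \<partial>lebesgue))" for n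
  proof -
    have "(\<integral>x. real (Suc n) * (v n x - u x) * jac (X n) x \<partial>lebesgue) = (\<integral>x. real (Suc n) * (v n x * jac (X n) x - u x * jac (X n) x) \<partial>lebesgue)"
      by (intro Bochner_Integration.integral_cong refl) (simp add: algebra_simps)
    also have "\<dots> = real (Suc n) * ((\<integral>x. v n x * jac (X n) x \<partial>lebesgue) - (\<integral>x. u x * jac (X n) x \<partial>lebesgue))"
      using int[of "v n" "X n", OF u(2) bs(2) L(1)] int[of u "X n", OF u(1) bs(1) L(1)]
      by (simp add: Bochner_Integration.integral_diff)
    finally show ?thesis by (simp add: algebra_simps)
  qed
  have Wb: "AE x in lebesgue. \<bar>J i x\<bar> \<le> C" for i
    using W
  proof (rule eventually_mono)
    fix x assume "\<forall>i. (\<lambda>n. real (Suc n) * (X n i x - Y i x)) \<longlonglongrightarrow> - (a x \<bullet> grad (Y i) x)"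
    then have "(\<lambda>n. real (Suc n) * (X n i x - Y i x)) \<longlonglongrightarrow> J i x" by (simp add: J_def)
    from LIMSEQ_le_const2[OF tendsto_rabs[OF this]] show "\<bar>J i x\<bar> \<le> C" using C by blast
  qed
  \<comment> \<open>Measurability of \<open>a x . grad (Y i) x\<close> is read off from the
    difference quotients, as \<open>a\<close> is an arbitrary function here.\<close>
  have Jm: "J i \<in> borel_measurable lebesgue" for i
  proof (rule borel_measurable_LIMSEQ_AE)
    show "(\<lambda>x. real (Suc n) * (X n i x - Y i x)) \<in> borel_measurable lebesgue" for n
      using Lip_measurable[OF Lf(1)[of n i]] Lip_measurable[OF Lf(2)[of i]] by auto
    show "AE x in lebesgue. (\<lambda>n. real (Suc n) * (X n i x - Y i x)) \<longlonglongrightarrow> J i x"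
      using W by (rule eventually_mono) (simp add: J_def)
  qed
  have iJ: "integrable lebesgue (\<lambda>x. J i x * jac (Y(i := u)) x)" for i
  proof -
    have "integrable lebesgue (jac (Y(i := u)))" by (rule jac_integrable[where k=i]) (use Lf u bs in auto)
    from integrable_mult_bounded[OF this Jm Wb] show ?thesis by (simp add: mult.commute)
  qed
  have utm: "ut \<in> borel_measurable lebesgue"
  proof (rule borel_measurable_LIMSEQ_AE[OF _ ut])
    show "(\<lambda>x. real (Suc n) * (v n x - u x)) \<in> borel_measurable lebesgue" for n
      using Lip_measurable[OF u(1)] Lip_measurable[OF u(2)[of n]] by auto
  qed
  have utb: "AE x in lebesgue. \<bar>ut x\<bar> \<le> C * indicator (cball 0 R) x"
    using ut
  proof (rule eventually_mono)
    fix x assume l: "(\<lambda>n. real (Suc n) * (v n x - u x)) \<longlonglongrightarrow> ut x"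
    have "\<bar>real (Suc n) * (v n x - u x)\<bar> \<le> C * indicator (cball 0 R) x" for n
      using Cu[of n x] u(3,4)[of x] by (cases "norm x \<le> R") auto
    then show "\<bar>ut x\<bar> \<le> C * indicator (cball 0 R) x" using LIMSEQ_le_const2[OF tendsto_rabs[OF l]] by blast
  qed
  have iut: "integrable lebesgue (\<lambda>x. ut x * jac Y x)"
    by (rule integrable_mult_bounded[OF integrable_bounded_support[OF utm utb] jac_measurable[OF Lf(2)] jac_bounded[OF L(2)]])
  have pw: "ut x * jac Y x - (\<Sum>i\<in>UNIV. J i x * jac (Y(i := u)) x) = (ut x + a x \<bullet> grad u x) * jac Y x" for x
  proof -
    have "(\<Sum>i\<in>UNIV. J i x * jac (Y(i := u)) x) = - (\<Sum>i\<in>UNIV. (grad (Y i) x \<bullet> a x) * rdet ((\<lambda>i. grad (Y i) x)(i := grad u x)))"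
      unfolding jac_upd J_def by (simp add: sum_negf inner_commute)
    also have "\<dots> = - ((a x \<bullet> grad u x) * jac Y x)"
      unfolding jac_def by (subst rdet_replace_sum[of "\<lambda>i. grad (Y i) x"]) simp
    finally show ?thesis by (simp add: algebra_simps)
  qed
  have iS: "integrable lebesgue (\<lambda>x. ut x * jac Y x - (\<Sum>i\<in>UNIV. J i x * jac (Y(i := u)) x))"
    using iJ iut by simp
  then show "integrable lebesgue (\<lambda>x. (ut x + a x \<bullet> grad u x) * jac Y x)" unfolding pw .
  have "(\<integral>x. (ut x + a x \<bullet> grad u x) * jac Y x \<partial>lebesgue) = (\<integral>x. ut x * jac Y x \<partial>lebesgue) + - (\<Sum>i\<in>UNIV. \<integral>x. J i x * jac (Y(i := u)) x \<partial>lebesgue)"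
    unfolding pw[symmetric] using iJ iut by (simp add: Bochner_Integration.integral_sum)
  then show "(\<lambda>n. real (Suc n) * ((\<integral>x. v n x * jac (X n) x \<partial>lebesgue) - (\<integral>x. u x * jac Y x \<partial>lebesgue)))
    \<longlonglongrightarrow> (\<integral>x. (ut x + a x \<bullet> grad u x) * jac Y x \<partial>lebesgue)"
    unfolding eq using tendsto_add[OF J2 J1] by simp
qed

section \<open>The integrated conservation law along a flow\<close>

section \<open>Conservation in time\<close>

lemma AE_lebesgue_neq: "AE x::real in lebesgue. x \<noteq> c"
  by (intro AE_completion AE_lborel_singleton)

text \<open>F - F s, frozen outside [s, t] and led back to 0 by a linear ramp on [t, t + 1], is
  Lipschitz with bounded support. Its derivative integrates to 0, and the ramp accounts for exactly
  \<open>F t - F s\<close>.\<close>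

lemma lipschitz_ftc:
  fixes F G :: "real \<Rightarrow> real"
  assumes F: "Lip F" and st: "s \<le> t"
    and G: "AE r in lebesgue. r \<in> {s<..<t} \<longrightarrow> (\<lambda>n. real (Suc n) * (F (r + 1 / real (Suc n)) - F r)) \<longlonglongrightarrow> G r"
  shows "integrable lebesgue (\<lambda>r. indicator {s<..<t} r * G r)"
    and "F t - F s = (\<integral>r. indicator {s<..<t} r * G r \<partial>lebesgue)"
proof -
  \<comment> \<open>The ramp: 0 up to t, \<open>r - t\<close> on [t, t + 1], 1 afterwards.\<close>
  define c where "c r = max 0 (1 - max 0 (t + 1 - r))" for r :: real
  define f where "f r = F (max s (- max (- r) (- t))) - F s - (F t - F s) * c r" for r
  have Lid: "Lip (\<lambda>x::real. x)" unfolding Lip_def by (intro exI[of _ 1] lipschitz_on_id)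
  have Lf: "Lip f" unfolding f_def c_def
    using Lip_cmult[OF Lip_max[OF Lip_cmult[OF Lid, of "-1"] Lip_const[of "- t"]], of "-1"]
    by (intro Lip_diff Lip_const Lip_cmult Lip_max Lid Lip_compose[OF F]) simp
  have f_left: "f r = 0" if "r \<le> s" for r
  proof -
    have "max s (- max (- r) (- t)) = s" "c r = 0" using that st by (auto simp: c_def)
    then show ?thesis by (simp add: f_def)
  qed
  have f_mid: "f r = F r - F s" if "s \<le> r" "r \<le> t" for r
  proof -
    have "max s (- max (- r) (- t)) = r" "c r = 0" using that by (auto simp: c_def)
    then show ?thesis by (simp add: f_def)
  qed
  have f_ramp: "f r = F t - F s - (F t - F s) * (r - t)" if "t \<le> r" "r \<le> t + 1" for r
  proof -
    have "max s (- max (- r) (- t)) = t" "c r = r - t" using that st by (auto simp: c_def)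
    then show ?thesis by (simp add: f_def)
  qed
  have f_right: "f r = 0" if "t + 1 \<le> r" for r
  proof -
    have "max s (- max (- r) (- t)) = t" "c r = 1" using that st by (auto simp: c_def)
    then show ?thesis by (simp add: f_def)
  qed
  have bf: "bsupp f"
    unfolding bsupp_def
  proof (intro exI allI impI)
    fix r :: real assume r: "\<bar>s\<bar> + \<bar>t\<bar> + 1 \<le> norm r"
    then have "r \<le> s \<or> t + 1 \<le> r" by (auto simp: abs_if split: if_splits)
    then show "f r = 0" using f_left f_right by blast
  qed
  have ev: "eventually (\<lambda>n. r + 1 / real (Suc n) < b) sequentially" if "r < b" for r b :: real
  proof -
    have "(\<lambda>n. r + 1 / real (Suc n)) \<longlonglongrightarrow> r + 0"
      using LIMSEQ_inverse_real_of_nat by (intro tendsto_intros) (simp add: inverse_eq_divide)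
    then show ?thesis using that by (intro order_tendstoD) auto
  qed
  have ae: "AE r in lebesgue. dd 1 f r + (F t - F s) * indicator {t<..<t + 1} r = indicator {s<..<t} r * G r"
    using Lip_AE_diffable_along[OF Lf, of 1] G AE_lebesgue_neq[of s] AE_lebesgue_neq[of t] AE_lebesgue_neq[of "t + 1"]
  proof eventually_elim
    case (elim r)
    have d: "(\<lambda>n. real (Suc n) * (f (r + 1 / real (Suc n)) - f r)) \<longlonglongrightarrow> dd 1 f r"
      using dq_tendsto[OF elim(1)] by (simp add: dq_def)
    have pos: "0 < 1 / real (Suc n)" for n by simp
    consider "r < s" | "s < r" "r < t" | "t < r" "r < t + 1" | "t + 1 < r" using elim by linarith
    then show ?case
    proof cases
      case 1
      have "eventually (\<lambda>n. real (Suc n) * (f (r + 1 / real (Suc n)) - f r) = 0) sequentially"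
        using ev[OF 1]
      proof eventually_elim
        case (elim n)
        have "f r = 0" "f (r + 1 / real (Suc n)) = 0" using 1 elim by (auto intro!: f_left)
        then show ?case by simp
      qed
      then have "dd 1 f r = 0" by (rule LIMSEQ_unique[OF d tendsto_eventually])
      then show ?thesis using 1 st by simp
    next
      case 2
      have "eventually (\<lambda>n. real (Suc n) * (F (r + 1 / real (Suc n)) - F r) = real (Suc n) * (f (r + 1 / real (Suc n)) - f r)) sequentially"
        using ev[OF 2(2)]
      proof eventually_elim
        case (elim n)
        have "f (r + 1 / real (Suc n)) = F (r + 1 / real (Suc n)) - F s" "f r = F r - F s"
          using 2 elim pos[of n] by (intro f_mid; linarith)+
        then show ?case by simp
      qed
      then have "(\<lambda>n. real (Suc n) * (f (r + 1 / real (Suc n)) - f r)) \<longlonglongrightarrow> G r"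
        using elim(2) 2 by (auto intro: Lim_transform_eventually)
      then have "dd 1 f r = G r" by (rule LIMSEQ_unique[OF d])
      then show ?thesis using 2 by simp
    next
      case 3
      have "eventually (\<lambda>n. real (Suc n) * (f (r + 1 / real (Suc n)) - f r) = - (F t - F s)) sequentially"
        using ev[OF 3(2)]
      proof eventually_elim
        case (elim n)
        have arith: "p - d * (r + h - t) - (p - d * (r - t)) = - d * h" for p d h :: real by (simp add: algebra_simps)
        have "f (r + 1 / real (Suc n)) = F t - F s - (F t - F s) * (r + 1 / real (Suc n) - t)" "f r = F t - F s - (F t - F s) * (r - t)"
          using 3 elim pos[of n] by (intro f_ramp; linarith)+
        then have "f (r + 1 / real (Suc n)) - f r = - (F t - F s) * (1 / real (Suc n))"
          by (simp only: arith)
        then show ?case by simp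
      qed
      then have "dd 1 f r = - (F t - F s)" by (rule LIMSEQ_unique[OF d tendsto_eventually])
      then show ?thesis using 3 by simp
    next
      case 4
      have "f (r + 1 / real (Suc n)) = f r" for n
        using 4 pos[of n] f_right[of r] f_right[of "r + 1 / real (Suc n)"] by linarith
      then have "dd 1 f r = 0" using d by (simp add: LIMSEQ_const_iff)
      then show ?thesis using 4 st by simp
    qed
  qed
  have i1: "integrable lebesgue (dd 1 f)" by (rule dd_bsupp_integrable[OF Lf bf])
  have i2: "integrable lebesgue (\<lambda>r. (F t - F s) * indicator {t<..<t + 1} r :: real)"
    by (intro integrable_mult_right integrable_real_indicator) auto
  have i3: "integrable lebesgue (\<lambda>r. dd 1 f r + (F t - F s) * indicator {t<..<t + 1} r)" using i1 i2 by simp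
  show "integrable lebesgue (\<lambda>r. indicator {s<..<t} r * G r)" by (rule integrable_AE_eq(1)[OF i3 ae])
  have "(\<integral>r. indicator {s<..<t} r * G r \<partial>lebesgue) = (\<integral>r. dd 1 f r + (F t - F s) * indicator {t<..<t + 1} r \<partial>lebesgue)"
    by (rule integrable_AE_eq(2)[OF i3 ae, symmetric])
  also have "\<dots> = F t - F s" using i1 i2 integral_dd_zero[OF Lf bf, of 1] by simp
  finally show "F t - F s = (\<integral>r. indicator {s<..<t} r * G r \<partial>lebesgue)" by simp
qed

definition Lip2 :: "(real \<Rightarrow> 'a::real_normed_vector \<Rightarrow> real) \<Rightarrow> bool" where
  "Lip2 w \<longleftrightarrow> Lip (\<lambda>z. w (fst z) (snd z))"

lemma Lip2_bounds:
  assumes "Lip2 w"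
  obtains L where "0 \<le> L" "\<And>t. L-lipschitz_on UNIV (w t)" "\<And>s t x. \<bar>w s x - w t x\<bar> \<le> L * \<bar>s - t\<bar>"
proof -
  obtain L where L: "L-lipschitz_on UNIV (\<lambda>z. w (fst z) (snd z))" using assms unfolding Lip2_def Lip_def by blast
  have L0: "0 \<le> L" using lipschitz_on_nonneg[OF L] .
  have "L-lipschitz_on UNIV (w t)" for t
  proof (rule lipschitz_onI[OF _ L0])
    fix x y show "dist (w t x) (w t y) \<le> L * dist x y"
      using lipschitz_onD[OF L, of "(t, x)" "(t, y)"] by (simp add: dist_Pair_Pair)
  qed
  moreover have "\<bar>w s x - w t x\<bar> \<le> L * \<bar>s - t\<bar>" for s t x
    using lipschitz_onD[OF L, of "(s, x)" "(t, x)"] by (simp add: dist_Pair_Pair dist_real_def)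
  ultimately show ?thesis using that L0 by blast
qed

lemma Lip2_Lip: "Lip2 w \<Longrightarrow> Lip (w t)"
  by (metis Lip2_bounds Lip_def)

lemma Lip2_mult: "Lip2 f \<Longrightarrow> (\<And>t x. \<bar>f t x\<bar> \<le> A) \<Longrightarrow> Lip2 g \<Longrightarrow> (\<And>t x. \<bar>g t x\<bar> \<le> B) \<Longrightarrow> Lip2 (\<lambda>t x. f t x * g t x)"
  unfolding Lip2_def by (rule Lip_mult) auto

lemma Lip2_const: "Lip2 (\<lambda>t x. c)"
  unfolding Lip2_def by (rule Lip_const)

lemma Lip2_space: "Lip f \<Longrightarrow> Lip2 (\<lambda>t x. f x)"
  unfolding Lip2_def
proof (erule Lip_compose)
  show "Lip (snd :: real \<times> 'a \<Rightarrow> 'a)"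
    unfolding Lip_def by (intro exI[of _ 1] lipschitz_onI) (auto simp: dist_snd_le)
qed

lemma Lip2_bounded_support:
  fixes w :: "real \<Rightarrow> real^'n \<Rightarrow> real"
  assumes w: "Lip2 w" and R: "\<And>t x. R \<le> norm x \<Longrightarrow> w t x = 0"
  obtains C where "0 \<le> C" "\<And>t x. \<bar>w t x\<bar> \<le> C * indicator (cball 0 R) x"
proof -
  obtain L where L0: "0 \<le> L" and L: "\<And>t. L-lipschitz_on UNIV (w t)" using Lip2_bounds[OF w] by metis
  \<comment> \<open>A point at which w vanishes for all t; the spatial Lipschitz constant then
    bounds w on the ball uniformly in time.\<close>
  obtain y :: "real^'n" where y: "norm y = \<bar>R\<bar>" using vector_choose_size[of "\<bar>R\<bar>"] by auto
  have "\<bar>w t x\<bar> \<le> (L * (2 * \<bar>R\<bar>)) * indicator (cball 0 R) x" for t x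
  proof (cases "norm x \<le> R")
    case True
    have "\<bar>w t x\<bar> \<le> L * dist x y" using lipschitz_onD[OF L, of x y t] R[of y t] y by (simp add: dist_real_def)
    also have "\<dots> \<le> L * (2 * \<bar>R\<bar>)"
      using L0 True y norm_triangle_ineq4[of x y] by (intro mult_left_mono) (auto simp: dist_norm)
    finally show ?thesis using True by simp
  qed (use R in auto)
  then show ?thesis using that[of "L * (2 * \<bar>R\<bar>)"] L0 by simp
qed

text \<open>The quantitative form of the row exchange: as many exchanges as rows, each costing at
  most D times a Jacobian bound times the volume of the ball. It yields Lipschitz dependence on
  time.\<close>

lemma jac_integral_difference_bound:
  fixes X Y :: "'n::finite \<Rightarrow> real^'n \<Rightarrow> real"
  assumes L: "\<And>i. L-lipschitz_on UNIV (X i)" "\<And>i. L-lipschitz_on UNIV (Y i)" "L-lipschitz_on UNIV u"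
    and D: "\<And>i x. \<bar>X i x - Y i x\<bar> \<le> D" and R: "\<And>x. R \<le> norm x \<Longrightarrow> u x = 0"
  shows "\<bar>(\<integral>x. u x * jac X x \<partial>lebesgue) - (\<integral>x. u x * jac Y x \<partial>lebesgue)\<bar>
    \<le> real CARD('n) * (D * det_bound TYPE('n) L * measure lebesgue (cball (0::real^'n) R))"
proof -
  have Lf: "Lip (X i)" "Lip (Y i)" "Lip u" for i using L unfolding Lip_def by blast+
  have bs: "bsupp u" using R unfolding bsupp_def by blast
  have D0: "0 \<le> D" using order.trans[OF abs_ge_zero D] .
  let ?V = "D * det_bound TYPE('n) L * measure lebesgue (cball (0::real^'n) R)"
  have "\<bar>(\<integral>x. u x * jac (mix S X Y) x \<partial>lebesgue) - (\<integral>x. u x * jac Y x \<partial>lebesgue)\<bar> \<le> real (card S) * ?V" if "finite S" for S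
    using that
  proof (induction S)
    case empty then show ?case by (simp add: mix_empty)
  next
    case (insert k S)
    let ?m = "mix S X Y"
    have Lm: "L-lipschitz_on UNIV (?m i)" for i using L by (auto simp: mix_def)
    have Lm': "Lip (?m i)" for i using Lm unfolding Lip_def by blast
    have LK: "L-lipschitz_on UNIV ((?m(k := u)) i)" for i using Lm L by auto
    have eq: "(\<integral>x. u x * jac (mix (insert k S) X Y) x \<partial>lebesgue)
      = (\<integral>x. u x * jac ?m x \<partial>lebesgue) - (\<integral>x. (X k x - Y k x) * jac (?m(k := u)) x \<partial>lebesgue)"
      using integral_jac_upd_diff[where f="?m" and k=k and u=u and g="X k" and h="Y k", OF Lm' Lf(3) bs Lf(1,2)]
      by (simp add: mix_insert mix_upd insert.hyps)
    have Ld: "Lip (\<lambda>x. X k x - Y k x)" by (intro Lip_diff Lf)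
    have "AE x in lebesgue. \<bar>(X k x - Y k x) * jac (?m(k := u)) x\<bar> \<le> (D * det_bound TYPE('n) L) * indicator (cball 0 R) x"
      using jac_bounded[OF LK]
    proof (rule eventually_mono)
      fix x assume b: "\<bar>jac (?m(k := u)) x\<bar> \<le> det_bound TYPE('n) L"
      show "\<bar>(X k x - Y k x) * jac (?m(k := u)) x\<bar> \<le> (D * det_bound TYPE('n) L) * indicator (cball 0 R) x"
      proof (cases "norm x \<le> R")
        case True then show ?thesis using b D[of k x] D0 by (auto simp: abs_mult intro!: mult_mono)
      next
        case False
        then have "jac (?m(k := u)) x = 0" by (intro jac_zero_outside[of R _ k]) (use R in auto)
        then show ?thesis using False by simp
      qed
    qed
    from integral_bounded_support[OF integral_jac_by_parts(3)[where f="?m" and k=k, OF Lm' Lf(3) bs Ld] this]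
    have "\<bar>\<integral>x. (X k x - Y k x) * jac (?m(k := u)) x \<partial>lebesgue\<bar> \<le> ?V" .
    then show ?case using insert unfolding eq by (simp add: algebra_simps)
  qed
  from this[OF finite_class.finite_UNIV] show ?thesis by (simp add: mix_UNIV)
qed

text \<open>Almost every t first, then almost every x, because the quotients are formed after
  integration in x at a fixed t. Including \<open>pd\<close> lets product and chain rules act
  pointwise.\<close>

definition solves :: "real \<Rightarrow> (real \<Rightarrow> real^'n \<Rightarrow> real^'n) \<Rightarrow> (real \<Rightarrow> real^'n \<Rightarrow> real) \<Rightarrow> bool" where
  "solves T a w \<longleftrightarrow> (AE t in lebesgue. t \<in> {0<..<T} \<longrightarrow> (AE x in lebesgue.
     pd (w t) x \<and> ((\<lambda>s. w s x) has_real_derivative - (a t x \<bullet> grad (w t) x)) (at t)))"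

text \<open>The integral is Lipschitz in t by the row-exchange bound, its difference quotients
  converge at almost every t by \<open>transport_difference_quotient\<close>, and
  \<open>lipschitz_ftc\<close> integrates the limit.\<close>

lemma transport_conservation:
  fixes X :: "real \<Rightarrow> 'n::finite \<Rightarrow> real^'n \<Rightarrow> real"
  assumes X: "\<And>i. Lip2 (\<lambda>t. X t i)" "\<And>i. solves T a (\<lambda>t. X t i)"
    and u: "Lip2 u" "\<And>t x. R \<le> norm x \<Longrightarrow> u t x = 0"
    and ut: "AE t in lebesgue. t \<in> {0<..<T} \<longrightarrow> (AE x in lebesgue. ((\<lambda>s. u s x) has_real_derivative ut t x) (at t))"
  shows "Lip (\<lambda>t. \<integral>x. u t x * jac (X t) x \<partial>lebesgue)"
    and "AE t in lebesgue. t \<in> {0<..<T} \<longrightarrow> integrable lebesgue (\<lambda>x. (ut t x + a t x \<bullet> grad (u t) x) * jac (X t) x)"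
    and "0 \<le> s \<Longrightarrow> s \<le> t \<Longrightarrow> t \<le> T \<Longrightarrow> integrable lebesgue (\<lambda>r. indicator {s<..<t} r * (\<integral>x. (ut r x + a r x \<bullet> grad (u r) x) * jac (X r) x \<partial>lebesgue))"
    and "0 \<le> s \<Longrightarrow> s \<le> t \<Longrightarrow> t \<le> T \<Longrightarrow> (\<integral>x. u t x * jac (X t) x \<partial>lebesgue) - (\<integral>x. u s x * jac (X s) x \<partial>lebesgue)
      = (\<integral>r. indicator {s<..<t} r * (\<integral>x. (ut r x + a r x \<bullet> grad (u r) x) * jac (X r) x \<partial>lebesgue) \<partial>lebesgue)"
proof -
  let ?F = "\<lambda>t. \<integral>x. u t x * jac (X t) x \<partial>lebesgue"
  have "\<forall>i. \<exists>l. 0 \<le> l \<and> (\<forall>t. l-lipschitz_on UNIV (X t i)) \<and> (\<forall>s t x. \<bar>X s i x - X t i x\<bar> \<le> l * \<bar>s - t\<bar>)"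
    using Lip2_bounds[OF X(1)] by metis
  then obtain l where l: "\<And>i. 0 \<le> l i" "\<And>i t. (l i)-lipschitz_on UNIV (X t i)" "\<And>i s t x. \<bar>X s i x - X t i x\<bar> \<le> l i * \<bar>s - t\<bar>"
    by metis
  obtain m where m: "0 \<le> m" "\<And>t. m-lipschitz_on UNIV (u t)" "\<And>s t x. \<bar>u s x - u t x\<bar> \<le> m * \<bar>s - t\<bar>"
    using Lip2_bounds[OF u(1)] by metis
  define L where "L = m + (\<Sum>i\<in>UNIV. l i)"
  have lL: "l i \<le> L" for i using member_le_sum[of i UNIV l] l(1) m(1) by (auto simp: L_def intro: add_increasing)
  have mL: "m \<le> L" using sum_nonneg[of UNIV l] l(1) by (simp add: L_def)
  have L0: "0 \<le> L" using m(1) mL by simp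
  have LX: "L-lipschitz_on UNIV (X t i)" for t i by (rule lipschitz_on_mono[OF l(2)]) (use lL in auto)
  have Lu: "L-lipschitz_on UNIV (u t)" for t by (rule lipschitz_on_mono[OF m(2)]) (use mL in auto)
  have dX: "\<bar>X s i x - X t i x\<bar> \<le> L * \<bar>s - t\<bar>" for s t i x
    by (rule order.trans[OF l(3)]) (use lL in \<open>auto intro!: mult_right_mono\<close>)
  have du: "\<bar>u s x - u t x\<bar> \<le> L * \<bar>s - t\<bar>" for s t x
    by (rule order.trans[OF m(3)]) (use mL in \<open>auto intro!: mult_right_mono\<close>)
  have LfX: "Lip (X t i)" and Lfu: "Lip (u t)" for t i using LX Lu unfolding Lip_def by blast+
  have bs: "bsupp (u t)" for t using u(2) unfolding bsupp_def by blast
  have ji: "integrable lebesgue (\<lambda>x. u s x * jac (X t) x)" for s t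
    by (rule integrable_mult_bounded[OF Lip_bsupp_integrable[OF Lfu bs] jac_measurable[OF LfX] jac_bounded[OF LX]])
  let ?V = "det_bound TYPE('n) L * measure lebesgue (cball (0::real^'n) R)"
  have V0: "0 \<le> ?V" using L0 by (simp add: det_bound_def)
  show LF: "Lip ?F"
    unfolding Lip_def
  proof (intro exI lipschitz_onI)
    fix s t :: real
    have 1: "\<bar>(\<integral>x. u t x * jac (X s) x \<partial>lebesgue) - (\<integral>x. u t x * jac (X t) x \<partial>lebesgue)\<bar>
       \<le> real CARD('n) * (L * \<bar>s - t\<bar> * det_bound TYPE('n) L * measure lebesgue (cball (0::real^'n) R))"
      by (rule jac_integral_difference_bound[OF LX LX Lu dX u(2)])
    have 2: "\<bar>\<integral>x. (u s x - u t x) * jac (X s) x \<partial>lebesgue\<bar> \<le> (L * \<bar>s - t\<bar> * det_bound TYPE('n) L) * measure lebesgue (cball (0::real^'n) R)"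
    proof (rule integral_bounded_support)
      show "integrable lebesgue (\<lambda>x. (u s x - u t x) * jac (X s) x)"
        using ji[of s s] ji[of t s] by (simp add: left_diff_distrib)
      show "AE x in lebesgue. \<bar>(u s x - u t x) * jac (X s) x\<bar> \<le> (L * \<bar>s - t\<bar> * det_bound TYPE('n) L) * indicator (cball 0 R) x"
        using jac_bounded[where f="X s", OF LX]
      proof (rule eventually_mono)
        fix x assume b: "\<bar>jac (X s) x\<bar> \<le> det_bound TYPE('n) L"
        show "\<bar>(u s x - u t x) * jac (X s) x\<bar> \<le> (L * \<bar>s - t\<bar> * det_bound TYPE('n) L) * indicator (cball 0 R) x"
          by (cases "norm x \<le> R") (use b du[of s x t] L0 u(2) in \<open>auto simp: abs_mult intro!: mult_mono\<close>)
      qed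
    qed
    have "?F s - ?F t = (\<integral>x. (u s x - u t x) * jac (X s) x \<partial>lebesgue)
       + ((\<integral>x. u t x * jac (X s) x \<partial>lebesgue) - (\<integral>x. u t x * jac (X t) x \<partial>lebesgue))"
      using ji[of s s] ji[of t s] by (simp add: left_diff_distrib)
    then have "\<bar>?F s - ?F t\<bar> \<le> (L * \<bar>s - t\<bar> * det_bound TYPE('n) L) * measure lebesgue (cball (0::real^'n) R) + real CARD('n) * (L * \<bar>s - t\<bar> * det_bound TYPE('n) L * measure lebesgue (cball (0::real^'n) R))"
      using 1 2 by linarith
    then show "dist (?F s) (?F t) \<le> (L * ?V * (1 + real CARD('n))) * dist s t"
      by (simp add: dist_real_def algebra_simps)
  qed (use L0 V0 in simp)
  have SX: "AE t in lebesgue. \<forall>i. t \<in> {0<..<T} \<longrightarrow> (AE x in lebesgue.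
     pd (X t i) x \<and> ((\<lambda>s. X s i x) has_real_derivative - (a t x \<bullet> grad (X t i) x)) (at t))"
    using X(2) unfolding solves_def by (intro eventually_all_finite) auto
  have main: "(\<lambda>n. real (Suc n) * (?F (t + 1 / real (Suc n)) - ?F t)) \<longlonglongrightarrow> (\<integral>x. (ut t x + a t x \<bullet> grad (u t) x) * jac (X t) x \<partial>lebesgue)
      \<and> integrable lebesgue (\<lambda>x. (ut t x + a t x \<bullet> grad (u t) x) * jac (X t) x)"
    if S: "\<forall>i. AE x in lebesgue. pd (X t i) x \<and> ((\<lambda>s. X s i x) has_real_derivative - (a t x \<bullet> grad (X t i) x)) (at t)"
      and U: "AE x in lebesgue. ((\<lambda>s. u s x) has_real_derivative ut t x) (at t)" for t
  proof -
    have q: "\<bar>real (Suc n) * c\<bar> \<le> L" if c: "\<bar>c\<bar> \<le> L * \<bar>(t + 1 / real (Suc n)) - t\<bar>" for n c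
    proof -
      have "real (Suc n) * \<bar>c\<bar> \<le> real (Suc n) * (L * (1 / real (Suc n)))" using c by (intro mult_left_mono) auto
      then show ?thesis by (simp add: abs_mult)
    qed
    have W: "AE x in lebesgue. \<forall>i. (\<lambda>n. real (Suc n) * (X (t + 1 / real (Suc n)) i x - X t i x)) \<longlonglongrightarrow> - (a t x \<bullet> grad (X t i) x)"
    proof (rule eventually_all_finite)
      fix i
      have "AE x in lebesgue. pd (X t i) x \<and> ((\<lambda>s. X s i x) has_real_derivative - (a t x \<bullet> grad (X t i) x)) (at t)" using S by blast
      then show "AE x in lebesgue. (\<lambda>n. real (Suc n) * (X (t + 1 / real (Suc n)) i x - X t i x)) \<longlonglongrightarrow> - (a t x \<bullet> grad (X t i) x)"
      proof (rule eventually_mono)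
        fix x assume "pd (X t i) x \<and> ((\<lambda>s. X s i x) has_real_derivative - (a t x \<bullet> grad (X t i) x)) (at t)"
        then have "((\<lambda>s. X s i x) has_vector_derivative - (a t x \<bullet> grad (X t i) x)) (at t)"
          by (simp add: has_real_derivative_iff_has_vector_derivative)
        from LIMSEQ_quotient[OF this]
        show "(\<lambda>n. real (Suc n) * (X (t + 1 / real (Suc n)) i x - X t i x)) \<longlonglongrightarrow> - (a t x \<bullet> grad (X t i) x)" by simp
      qed
    qed
    have U': "AE x in lebesgue. (\<lambda>n. real (Suc n) * (u (t + 1 / real (Suc n)) x - u t x)) \<longlonglongrightarrow> ut t x"
      using U
    proof (rule eventually_mono)
      fix x assume "((\<lambda>s. u s x) has_real_derivative ut t x) (at t)"
      then have "((\<lambda>s. u s x) has_vector_derivative ut t x) (at t)"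
        by (simp add: has_real_derivative_iff_has_vector_derivative)
      from LIMSEQ_quotient[OF this]
      show "(\<lambda>n. real (Suc n) * (u (t + 1 / real (Suc n)) x - u t x)) \<longlonglongrightarrow> ut t x" by simp
    qed
    note tdq = transport_difference_quotient[where X="\<lambda>n. X (t + 1 / real (Suc n))" and Y="X t" and v="\<lambda>n. u (t + 1 / real (Suc n))"
        and u="u t" and a="a t" and ut="ut t", OF LX LX q[OF dX] W Lfu Lfu u(2) u(2) q[OF du] U']
    show ?thesis using tdq by blast
  qed
  have ae: "AE t in lebesgue. t \<in> {0<..<T} \<longrightarrow>
      (\<lambda>n. real (Suc n) * (?F (t + 1 / real (Suc n)) - ?F t)) \<longlonglongrightarrow> (\<integral>x. (ut t x + a t x \<bullet> grad (u t) x) * jac (X t) x \<partial>lebesgue)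
      \<and> integrable lebesgue (\<lambda>x. (ut t x + a t x \<bullet> grad (u t) x) * jac (X t) x)"
    using SX ut by eventually_elim (use main in blast)
  then show "AE t in lebesgue. t \<in> {0<..<T} \<longrightarrow> integrable lebesgue (\<lambda>x. (ut t x + a t x \<bullet> grad (u t) x) * jac (X t) x)"
    by (rule eventually_mono) blast
  assume st: "0 \<le> s" "s \<le> t" "t \<le> T"
  have "AE r in lebesgue. r \<in> {s<..<t} \<longrightarrow> (\<lambda>n. real (Suc n) * (?F (r + 1 / real (Suc n)) - ?F r)) \<longlonglongrightarrow> (\<integral>x. (ut r x + a r x \<bullet> grad (u r) x) * jac (X r) x \<partial>lebesgue)"
    using ae by (rule eventually_mono) (use st in auto)
  note ftc = lipschitz_ftc[OF LF st(2) this]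
  show "integrable lebesgue (\<lambda>r. indicator {s<..<t} r * (\<integral>x. (ut r x + a r x \<bullet> grad (u r) x) * jac (X r) x \<partial>lebesgue))" by (rule ftc(1))
  show "?F t - ?F s = (\<integral>r. indicator {s<..<t} r * (\<integral>x. (ut r x + a r x \<bullet> grad (u r) x) * jac (X r) x \<partial>lebesgue) \<partial>lebesgue)" by (rule ftc(2))
qed

section \<open>Transported quantities form an algebra, and multiply the conservation law\<close>

section \<open>Solutions of the transport equation\<close>

lemma solves_diff:
  assumes "solves T a v" "solves T a w" shows "solves T a (\<lambda>t x. v t x - w t x)"
  using assms unfolding solves_def
proof eventually_elim
  case (elim t)
  show ?case
  proof
    assume t: "t \<in> {0<..<T}"
    from elim(1)[rule_format, OF t] elim(2)[rule_format, OF t]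
    show "AE x in lebesgue. pd (\<lambda>x. v t x - w t x) x \<and> ((\<lambda>s. v s x - w s x) has_real_derivative - (a t x \<bullet> grad (\<lambda>x. v t x - w t x) x)) (at t)"
    proof eventually_elim
      case (elim x)
      then have "pd (v t) x" "pd (w t) x" by auto
      note g = grad_diff[OF this]
      have "((\<lambda>s. v s x - w s x) has_real_derivative - (a t x \<bullet> (grad (v t) x - grad (w t) x))) (at t)"
        by (rule DERIV_cong[OF DERIV_diff[OF conjunct2[OF elim(1)] conjunct2[OF elim(2)]]]) (simp add: inner_diff_right)
      then show ?case using g(1) unfolding g(2) by blast
    qed
  qed
qed

lemma solves_mult:
  assumes "solves T a v" "solves T a w" shows "solves T a (\<lambda>t x. v t x * w t x)"
  using assms unfolding solves_def
proof eventually_elim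
  case (elim t)
  show ?case
  proof
    assume t: "t \<in> {0<..<T}"
    from elim(1)[rule_format, OF t] elim(2)[rule_format, OF t]
    show "AE x in lebesgue. pd (\<lambda>x. v t x * w t x) x \<and> ((\<lambda>s. v s x * w s x) has_real_derivative - (a t x \<bullet> grad (\<lambda>x. v t x * w t x) x)) (at t)"
    proof eventually_elim
      case (elim x)
      then have "pd (v t) x" "pd (w t) x" by auto
      note g = grad_mult[OF this]
      have "((\<lambda>s. v s x * w s x) has_real_derivative - (a t x \<bullet> (v t x *\<^sub>R grad (w t) x + w t x *\<^sub>R grad (v t) x))) (at t)"
        by (rule DERIV_cong[OF DERIV_mult[OF conjunct2[OF elim(1)] conjunct2[OF elim(2)]]]) (simp add: inner_add_right algebra_simps)
      then show ?case using g(1) unfolding g(2) by blast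
    qed
  qed
qed

lemma solves_const: "solves T a (\<lambda>t x. c)"
  unfolding solves_def by (intro AE_I2 impI) (simp add: grad_const)

lemma solves_compose:
  assumes w: "solves T a w" and b: "\<And>y. (b has_real_derivative b' y) (at y)" shows "solves T a (\<lambda>t x. b (w t x))"
  using w unfolding solves_def
proof eventually_elim
  case (elim t)
  show ?case
  proof
    assume t: "t \<in> {0<..<T}"
    from elim(1)[rule_format, OF t]
    show "AE x in lebesgue. pd (\<lambda>x. b (w t x)) x \<and> ((\<lambda>s. b (w s x)) has_real_derivative - (a t x \<bullet> grad (\<lambda>x. b (w t x)) x)) (at t)"
    proof eventually_elim
      case (elim x)
      then have "pd (w t) x" by auto
      note g = grad_compose[OF this b]
      have "((\<lambda>s. b (w s x)) has_real_derivative - (a t x \<bullet> (b' (w t x) *\<^sub>R grad (w t) x))) (at t)"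
        by (rule DERIV_cong[OF DERIV_chain2[OF b conjunct2[OF elim]]]) simp
      then show ?case using g(1) unfolding g(2) by blast
    qed
  qed
qed

lemma solves_prod:
  assumes "finite A" "\<And>i. i \<in> A \<Longrightarrow> solves T a (w i)" shows "solves T a (\<lambda>t x. \<Prod>i\<in>A. w i t x)"
  using assms by (induction A) (auto intro: solves_const solves_mult)

lemma Lip2_prod:
  assumes "finite A" "\<And>i. i \<in> A \<Longrightarrow> Lip2 (w i)" "\<And>i t x. \<bar>w i t x\<bar> \<le> 1" shows "Lip2 (\<lambda>t x. \<Prod>i\<in>A. w i t x)"
  using assms(1,2)
proof (induction A)
  case (insert i A)
  have "\<bar>\<Prod>i\<in>A. w i t x\<bar> \<le> 1" for t x
    unfolding abs_prod using assms(3) by (intro prod_le_1) auto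
  then show ?case using insert assms(3) by (auto intro!: Lip2_mult[where A=1 and B=1])
qed (simp add: Lip2_const)

text \<open>The conservation law for the weight \<open>p * w\<close>. Since
  \<open>w_t = - a . grad w\<close>, all derivatives of w cancel and w survives only as a factor.
  Boundedness of w keeps the product Lipschitz.\<close>

theorem transport_identity:
  fixes X :: "real \<Rightarrow> 'n::finite \<Rightarrow> real^'n \<Rightarrow> real"
  assumes X: "\<And>i. Lip2 (\<lambda>t. X t i)" "\<And>i. solves T a (\<lambda>t. X t i)"
    and p: "Lip2 p" "\<And>t x. R \<le> norm x \<Longrightarrow> p t x = 0"
    and pt: "AE t in lebesgue. t \<in> {0<..<T} \<longrightarrow> (AE x in lebesgue. ((\<lambda>s. p s x) has_real_derivative pt t x) (at t))"
    and w: "Lip2 w" "\<And>t x. \<bar>w t x\<bar> \<le> B" "solves T a w"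
  defines "K \<equiv> \<lambda>t x. (pt t x + a t x \<bullet> grad (p t) x) * jac (X t) x"
  shows "AE t in lebesgue. t \<in> {0<..<T} \<longrightarrow> integrable lebesgue (\<lambda>x. w t x * K t x)"
    and "0 \<le> s \<Longrightarrow> s \<le> t \<Longrightarrow> t \<le> T \<Longrightarrow> integrable lebesgue (\<lambda>r. indicator {s<..<t} r * (\<integral>x. w r x * K r x \<partial>lebesgue))"
    and "0 \<le> s \<Longrightarrow> s \<le> t \<Longrightarrow> t \<le> T \<Longrightarrow> (\<integral>x. w t x * (p t x * jac (X t) x) \<partial>lebesgue) - (\<integral>x. w s x * (p s x * jac (X s) x) \<partial>lebesgue)
      = (\<integral>r. indicator {s<..<t} r * (\<integral>x. w r x * K r x \<partial>lebesgue) \<partial>lebesgue)"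
proof -
  obtain C where C: "0 \<le> C" "\<And>t x. \<bar>p t x\<bar> \<le> C * indicator (cball 0 R) x" using Lip2_bounded_support[OF p] by metis
  have C': "\<bar>p t x\<bar> \<le> C" for t x using order.trans[OF C(2)] C(1) by (cases "norm x \<le> R") (use C(2)[of t x] in auto)
  let ?u = "\<lambda>t x. p t x * w t x"
  let ?ut = "\<lambda>t x. pt t x * w t x - (a t x \<bullet> grad (w t) x) * p t x"
  have Lu: "Lip2 ?u" by (rule Lip2_mult[OF p(1) C' w(1,2)])
  have Ru: "?u t x = 0" if "R \<le> norm x" for t x using p(2) that by simp
  have du: "AE t in lebesgue. t \<in> {0<..<T} \<longrightarrow> (AE x in lebesgue. ((\<lambda>s. ?u s x) has_real_derivative ?ut t x) (at t))"
    using pt w(3) unfolding solves_def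
  proof eventually_elim
    case (elim t)
    show ?case
    proof
      assume t: "t \<in> {0<..<T}"
      from elim(1)[rule_format, OF t] elim(2)[rule_format, OF t]
      show "AE x in lebesgue. ((\<lambda>s. ?u s x) has_real_derivative ?ut t x) (at t)"
      proof eventually_elim
        case (elim x)
        show ?case by (rule DERIV_cong[OF DERIV_mult[OF elim(1) conjunct2[OF elim(2)]]]) simp
      qed
    qed
  qed
  have TC2: "AE t in lebesgue. t \<in> {0<..<T} \<longrightarrow> integrable lebesgue (\<lambda>x. (?ut t x + a t x \<bullet> grad (?u t) x) * jac (X t) x)"
    by (rule transport_conservation(2)[OF X Lu Ru du])
  have eq: "AE t in lebesgue. t \<in> {0<..<T} \<longrightarrow> (AE x in lebesgue. (?ut t x + a t x \<bullet> grad (?u t) x) * jac (X t) x = w t x * K t x)"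
    using w(3) unfolding solves_def
  proof eventually_elim
    case (elim t)
    show ?case
    proof
      assume t: "t \<in> {0<..<T}"
      from elim[rule_format, OF t] Lip_AE_pd[OF Lip2_Lip[OF p(1), of t]]
      show "AE x in lebesgue. (?ut t x + a t x \<bullet> grad (?u t) x) * jac (X t) x = w t x * K t x"
      proof eventually_elim
        case (elim x)
        have "grad (?u t) x = p t x *\<^sub>R grad (w t) x + w t x *\<^sub>R grad (p t) x"
          by (rule grad_mult(2)) (use elim in auto)
        then show ?case by (simp add: K_def inner_add_right algebra_simps)
      qed
    qed
  qed
  show "AE t in lebesgue. t \<in> {0<..<T} \<longrightarrow> integrable lebesgue (\<lambda>x. w t x * K t x)"
    using eq TC2
  proof eventually_elim
    case (elim t)
    show ?case
    proof
      assume t: "t \<in> {0<..<T}"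
      from elim t have e: "AE x in lebesgue. (?ut t x + a t x \<bullet> grad (?u t) x) * jac (X t) x = w t x * K t x"
        and i: "integrable lebesgue (\<lambda>x. (?ut t x + a t x \<bullet> grad (?u t) x) * jac (X t) x)" by auto
      show "integrable lebesgue (\<lambda>x. w t x * K t x)"
        by (rule integrable_AE_eq(1)[OF i e])
    qed
  qed
  have eqI: "AE t in lebesgue. t \<in> {0<..<T} \<longrightarrow> (\<integral>x. (?ut t x + a t x \<bullet> grad (?u t) x) * jac (X t) x \<partial>lebesgue) = (\<integral>x. w t x * K t x \<partial>lebesgue)"
    using eq TC2
  proof eventually_elim
    case (elim t)
    show ?case
    proof
      assume t: "t \<in> {0<..<T}"
      from elim t have e: "AE x in lebesgue. (?ut t x + a t x \<bullet> grad (?u t) x) * jac (X t) x = w t x * K t x"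
        and i: "integrable lebesgue (\<lambda>x. (?ut t x + a t x \<bullet> grad (?u t) x) * jac (X t) x)" by auto
      show "(\<integral>x. (?ut t x + a t x \<bullet> grad (?u t) x) * jac (X t) x \<partial>lebesgue) = (\<integral>x. w t x * K t x \<partial>lebesgue)"
        by (rule integrable_AE_eq(2)[OF i e])
    qed
  qed
  assume st: "0 \<le> s" "s \<le> t" "t \<le> T"
  let ?G = "\<lambda>r. indicator {s<..<t} r * (\<integral>x. (?ut r x + a r x \<bullet> grad (?u r) x) * jac (X r) x \<partial>lebesgue)"
  let ?H = "\<lambda>r. indicator {s<..<t} r * (\<integral>x. w r x * K r x \<partial>lebesgue)"
  have iG: "integrable lebesgue ?G" by (rule transport_conservation(3)[OF X Lu Ru du st])
  have e: "AE r in lebesgue. ?G r = ?H r" using eqI by (rule eventually_mono) (use st in \<open>auto simp: indicator_def\<close>)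
  show "integrable lebesgue ?H" by (rule integrable_AE_eq(1)[OF iG e])
  have "(\<integral>x. w t x * (p t x * jac (X t) x) \<partial>lebesgue) - (\<integral>x. w s x * (p s x * jac (X s) x) \<partial>lebesgue) = integral\<^sup>L lebesgue ?G"
    using transport_conservation(4)[OF X Lu Ru du st] by (simp add: mult_ac)
  also have "\<dots> = integral\<^sup>L lebesgue ?H"
    by (rule integrable_AE_eq(2)[OF iG e])
  finally show "(\<integral>x. w t x * (p t x * jac (X t) x) \<partial>lebesgue) - (\<integral>x. w s x * (p s x * jac (X s) x) \<partial>lebesgue) = integral\<^sup>L lebesgue ?H" .
qed

section \<open>From a vector-valued flow on [0, T] to scalar solutions on all of space-time\<close>

section \<open>Components of a transport flow\<close>

text \<open>Fubini for null sets, passing through Borel measures: Lebesgue measure on a product is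
  the completion of a product, not a product of completions.\<close>

lemma AE_lebesgue_pair:
  assumes "AE z in (lebesgue :: ('a::euclidean_space \<times> 'b::euclidean_space) measure). P z"
  shows "AE s in lebesgue. AE x in lebesgue. P (s, x)"
proof -
  have "AE z in (lborel :: ('a \<times> 'b) measure). P z" using assms by (simp add: AE_completion_iff)
  then have "AE z in (lborel :: 'a measure) \<Otimes>\<^sub>M (lborel :: 'b measure). P z" by (subst lborel_prod)
  then have "AE s in lborel. AE x in lborel. P (s, x)" by (rule lborel_pair.AE_pair)
  then show ?thesis by (simp add: AE_completion_iff)
qed

text \<open>Time is clamped to \<open>[0, T]\<close>, which makes the components Lipschitz on the whole of space-time.\<close>
definition flow_comp :: "real \<Rightarrow> (real \<Rightarrow> real^'n \<Rightarrow> real^'n) \<Rightarrow> real \<Rightarrow> 'n \<Rightarrow> real^'n \<Rightarrow> real" where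
  "flow_comp T X t i x = X (max 0 (min T t)) x $ i"

lemma flow_comp_eq: "t \<in> {0..T} \<Longrightarrow> flow_comp T X t i x = X t x $ i"
  by (simp add: flow_comp_def)

lemma vector_derivative_vec_nth:
  fixes f :: "real \<Rightarrow> real^'n"
  assumes "(f has_vector_derivative D) (at s)" shows "((\<lambda>s. f s $ i) has_real_derivative D $ i) (at s)"
  using bounded_linear.has_vector_derivative[OF bounded_linear_vec_nth assms]
  by (simp add: has_real_derivative_iff_has_vector_derivative)

lemma vector_derivative_vec:
  fixes f :: "real \<Rightarrow> real^'n"
  assumes "\<And>i. ((\<lambda>s. f s $ i) has_real_derivative D $ i) (at s)" shows "(f has_vector_derivative D) (at s)"
  unfolding has_vector_derivative_def
proof (subst has_derivative_componentwise_within, rule ballI)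
  fix b :: "real^'n" assume "b \<in> Basis"
  then obtain i where b: "b = axis i 1" by (auto simp: Basis_vec_def)
  have "((\<lambda>s. f s $ i) has_vector_derivative D $ i) (at s)"
    using assms by (simp add: has_real_derivative_iff_has_vector_derivative)
  then show "((\<lambda>x. f x \<bullet> b) has_derivative (\<lambda>x. x *\<^sub>R D \<bullet> b)) (at s)"
    unfolding has_vector_derivative_def b by (simp add: inner_axis)
qed

text \<open>Partial derivatives of all components assemble into a vector derivative, so
  \<open>dd\<close> takes its true value in \<open>Jac\<close>; elsewhere neither determinant is
  controlled.\<close>

lemma Jac_eq_jac:
  fixes X :: "real \<Rightarrow> real^'n \<Rightarrow> real^'n"
  assumes t: "t \<in> {0..T}" and pd: "\<forall>i. pd (flow_comp T X t i) x"
  shows "Jac X t x = jac (flow_comp T X t) x"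
proof -
  have "pd_x X t j x = (\<chi> i. grad (flow_comp T X t i) x $ j)" for j
    unfolding pd_x_def
  proof (rule dd_eqI, rule vector_derivative_vec)
    fix i show "((\<lambda>s. X t (x + s *\<^sub>R axis j 1) $ i) has_real_derivative (\<chi> i. grad (flow_comp T X t i) x $ j) $ i) (at 0)"
      using pd_DERIV[OF pd[rule_format], of i j] by (simp add: flow_comp_eq[OF t])
  qed
  then have "(\<chi> i j. pd_x X t j x $ i) = (\<chi> i. grad (flow_comp T X t i) x)" by (simp add: vec_eq_iff)
  then show ?thesis by (simp add: Jac_def jac_def rdet_def)
qed

lemma clamp_dist: "\<bar>max 0 (min T s) - max 0 (min T t)\<bar> \<le> \<bar>s - t\<bar>" for s t T :: real
  by (auto simp: max_def min_def abs_if)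

context
  fixes T :: real and a :: "real \<Rightarrow> real^'n \<Rightarrow> real^'n" and X :: "real \<Rightarrow> real^'n \<Rightarrow> real^'n"
  assumes T: "0 < T" and flow: "transport_flow T a X"
begin

lemma flow_comp_Lip2: "Lip2 (\<lambda>t. flow_comp T X t i)"
proof -
  obtain L where L: "L-lipschitz_on ({0..T} \<times> UNIV) (\<lambda>z. X (fst z) (snd z))"
    using flow unfolding transport_flow_def by blast
  have L0: "0 \<le> L" using lipschitz_on_nonneg[OF L] .
  show ?thesis unfolding Lip2_def Lip_def
  proof (intro exI lipschitz_onI)
    fix z w :: "real \<times> (real^'n)"
    let ?c = "\<lambda>t. max 0 (min T t)"
    have "dist (flow_comp T X (fst z) i (snd z)) (flow_comp T X (fst w) i (snd w)) \<le> norm (X (?c (fst z)) (snd z) - X (?c (fst w)) (snd w))"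
      unfolding flow_comp_def dist_real_def vector_minus_component[symmetric] by (rule component_le_norm_cart)
    also have "\<dots> \<le> L * dist (?c (fst z), snd z) (?c (fst w), snd w)"
      using lipschitz_onD[OF L, of "(?c (fst z), snd z)" "(?c (fst w), snd w)"] T by (simp add: dist_norm)
    also have "\<dots> \<le> L * dist z w"
    proof (rule mult_left_mono[OF _ L0])
      have "(dist (?c (fst z)) (?c (fst w)))\<^sup>2 \<le> (dist (fst z) (fst w))\<^sup>2"
        using clamp_dist by (intro power_mono) (auto simp: dist_real_def)
      then show "dist (?c (fst z), snd z) (?c (fst w), snd w) \<le> dist z w"
        by (cases z; cases w) (simp add: dist_Pair_Pair)
    qed
    finally show "dist (flow_comp T X (fst z) i (snd z)) (flow_comp T X (fst w) i (snd w)) \<le> L * dist z w" .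
  qed (rule L0)
qed

lemma flow_comp_uniform_lipschitz:
  obtains L where "0 \<le> L" "\<And>t i. L-lipschitz_on UNIV (flow_comp T X t i)"
proof -
  have "\<forall>i. \<exists>l. 0 \<le> l \<and> (\<forall>t. l-lipschitz_on UNIV (flow_comp T X t i))"
    using Lip2_bounds[OF flow_comp_Lip2] by metis
  then obtain l where l: "\<And>i. 0 \<le> l i" "\<And>i t. (l i)-lipschitz_on UNIV (flow_comp T X t i)" by metis
  show ?thesis
  proof (rule that[of "\<Sum>i\<in>UNIV. l i"])
    show "(\<Sum>i\<in>UNIV. l i)-lipschitz_on UNIV (flow_comp T X t i)" for t i
      by (rule lipschitz_on_mono[OF l(2)]) (auto intro!: member_le_sum l(1))
  qed (auto intro: sum_nonneg l(1))
qed

lemma flow_comp_AE_pd: "AE x in lebesgue. \<forall>i. pd (flow_comp T X t i) x"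
  by (rule AE_pd_all[OF Lip2_Lip[OF flow_comp_Lip2]])

lemma flow_comp_solves: "solves T a (\<lambda>t. flow_comp T X t i)"
proof -
  have "AE z in lebesgue. z \<in> {0<..<T} \<times> UNIV \<longrightarrow>
        (\<lambda>s. X s (snd z)) differentiable (at (fst z)) \<and>
        (\<forall>j. (\<lambda>s. X (fst z) (snd z + s *\<^sub>R axis j 1)) differentiable (at 0)) \<and>
        pd_t X (fst z) (snd z) + (\<Sum>j\<in>UNIV. a (fst z) (snd z) $ j *\<^sub>R pd_x X (fst z) j (snd z)) = 0"
    using flow unfolding transport_flow_def by blast
  from AE_lebesgue_pair[OF this] show ?thesis
    unfolding solves_def
  proof eventually_elim
    case (elim t)
    show ?case
    proof
      assume t: "t \<in> {0<..<T}"
      from elim show "AE x in lebesgue. pd (flow_comp T X t i) x \<and> ((\<lambda>s. flow_comp T X s i x) has_real_derivative - (a t x \<bullet> grad (flow_comp T X t i) x)) (at t)"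
      proof eventually_elim
        case (elim x)
        then have d: "(\<lambda>s. X s x) differentiable (at t)" "\<And>j. (\<lambda>s. X t (x + s *\<^sub>R axis j 1)) differentiable (at 0)"
          and eq: "pd_t X t x + (\<Sum>j\<in>UNIV. a t x $ j *\<^sub>R pd_x X t j x) = 0" using t by auto
        have "((\<lambda>s. flow_comp T X t i (x + s *\<^sub>R axis j 1)) has_real_derivative (\<chi> j. pd_x X t j x $ i) $ j) (at 0)" for j
          using vector_derivative_vec_nth[OF dd_works[where f="X t" and x=x and v="axis j 1", OF d(2)], of i] t
          by (simp add: flow_comp_def pd_x_def)
        note g = pdI[OF this]
        have "((\<lambda>s. X s x) has_vector_derivative pd_t X t x) (at t)"
          using d(1) unfolding pd_t_def by (simp add: vector_derivative_works)
        then have "((\<lambda>s. X s x $ i) has_real_derivative pd_t X t x $ i) (at t)" by (rule vector_derivative_vec_nth)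
        \<comment> \<open>For t strictly between 0 and T the clamp is the identity near t and leaves
          the time derivative unchanged.\<close>
        then have "((\<lambda>s. flow_comp T X s i x) has_real_derivative pd_t X t x $ i) (at t)"
          by (rule has_field_derivative_transform_within_open[where S="{0<..<T}"]) (use t in \<open>auto simp: flow_comp_def\<close>)
        moreover have "pd_t X t x $ i = - (a t x \<bullet> grad (flow_comp T X t i) x)"
        proof -
          have "(pd_t X t x + (\<Sum>j\<in>UNIV. a t x $ j *\<^sub>R pd_x X t j x)) $ i = 0" using eq by simp
          then have "pd_t X t x $ i + (\<Sum>j\<in>UNIV. a t x $ j * pd_x X t j x $ i) = 0" by (simp add: sum_component)
          then show ?thesis unfolding g(2) by (simp add: inner_vec_def)
        qed
        ultimately show ?case using g(1) by simp
      qed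
    qed
  qed
qed

lemma flow_comp_jac_nonneg_AE: "AE t in lebesgue. t \<in> {0<..<T} \<longrightarrow> (AE x in lebesgue. 0 \<le> jac (flow_comp T X t) x)"
proof -
  have "AE z in lebesgue. z \<in> {0<..<T} \<times> UNIV \<longrightarrow> Jac X (fst z) (snd z) \<ge> 0"
    using flow unfolding transport_flow_def by blast
  from AE_lebesgue_pair[OF this] show ?thesis
  proof eventually_elim
    case (elim t)
    show ?case
    proof
      assume t: "t \<in> {0<..<T}"
      from elim flow_comp_AE_pd[of t] show "AE x in lebesgue. 0 \<le> jac (flow_comp T X t) x"
      proof eventually_elim
        case (elim x)
        then show ?case using Jac_eq_jac[of t T X x] t by simp
      qed
    qed
  qed
qed

lemma flow_comp_final: "flow_comp T X T i x = x $ i"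
  using flow T unfolding transport_flow_def by (simp add: flow_comp_def)

lemma flow_comp_final_jac: "jac (flow_comp T X T) x = 1"
proof -
  have "flow_comp T X T i = (\<lambda>x. axis i 1 \<bullet> x)" for i by (simp add: fun_eq_iff flow_comp_final inner_axis')
  then have "jac (flow_comp T X T) x = rdet (\<lambda>i::'n. axis i 1)" by (simp add: jac_def grad_inner)
  also have "\<dots> = 1"
  proof -
    have "((\<chi> i. axis i 1) :: real^'n^'n) = mat 1" by (auto simp: vec_eq_iff mat_def axis_def)
    then show ?thesis by (simp add: rdet_def)
  qed
  finally show ?thesis .
qed

lemma Jac_final: "Jac X T x = 1"
proof -
  have "flow_comp T X T i = (\<lambda>x. axis i 1 \<bullet> x)" for i by (simp add: fun_eq_iff flow_comp_final inner_axis')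
  then have "Jac X T x = jac (flow_comp T X T) x" using T by (intro Jac_eq_jac) (auto simp: grad_inner)
  then show ?thesis by (simp add: flow_comp_final_jac)
qed

text \<open>X is the identity at time T and Lipschitz in time, so points move by at most L T.
  Preimages of balls are therefore bounded, uniformly in t.\<close>

lemma finite_speed:
  obtains D where "0 \<le> D" "\<And>t x. norm (X (max 0 (min T t)) x - x) \<le> D"
proof -
  obtain L where L: "L-lipschitz_on ({0..T} \<times> UNIV) (\<lambda>z. X (fst z) (snd z))"
    using flow unfolding transport_flow_def by blast
  have L0: "0 \<le> L" using lipschitz_on_nonneg[OF L] .
  have XT: "X T x = x" for x using flow unfolding transport_flow_def by blast
  have "norm (X (max 0 (min T t)) x - x) \<le> L * T" for t x
  proof -
    have "norm (X (max 0 (min T t)) x - x) \<le> L * dist (max 0 (min T t), x) (T, x)"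
      using lipschitz_onD[OF L, of "(max 0 (min T t), x)" "(T, x)"] T XT by (simp add: dist_norm)
    also have "\<dots> \<le> L * T" using T L0 by (intro mult_left_mono) (auto simp: dist_Pair_Pair dist_real_def)
    finally show ?thesis .
  qed
  then show ?thesis using that[of "L * T"] L0 T by simp
qed

end

text \<open>The indicator of a bounded piece of \<open>{x. J x < 0}\<close> is an L1 limit of
  nonnegative Lipschitz functions, so the integral of J over that piece is nonnegative and the piece
  is null.\<close>

lemma weak_nonneg:
  fixes J :: "'a::euclidean_space \<Rightarrow> real"
  assumes J: "J \<in> borel_measurable lebesgue" "AE x in lebesgue. \<bar>J x\<bar> \<le> M"
    and pos: "\<And>p. Lip p \<Longrightarrow> bsupp p \<Longrightarrow> (\<And>x. 0 \<le> p x) \<Longrightarrow> 0 \<le> (\<integral>x. p x * J x \<partial>lebesgue)"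
  shows "AE x in lebesgue. 0 \<le> J x"
proof -
  have "AE x in lebesgue. x \<in> cball 0 (real n) \<longrightarrow> 0 \<le> J x" for n
  proof -
    define A where "A = {x. J x < 0} \<inter> cball 0 (real n)"
    have A: "A \<in> sets lebesgue"
      unfolding A_def using J(1) by (intro sets.Int) (auto simp: borel_measurable_iff_less)
    have fin: "emeasure lebesgue A < \<infinity>"
      by (rule le_less_trans[OF emeasure_mono[of A "cball 0 (real n)"]]) (use emeasure_bounded_finite[OF bounded_cball] in \<open>auto simp: A_def\<close>)
    have iA: "integrable lebesgue (indicator A :: 'a \<Rightarrow> real)" using A fin by (intro integrable_real_indicator)
    have iAJ: "integrable lebesgue (\<lambda>x. indicator A x * J x)" by (rule integrable_mult_bounded[OF iA J])
    have "- e \<le> (\<integral>x. indicator A x * J x \<partial>lebesgue)" if e: "e > 0" for e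
    proof -
      have "e / (\<bar>M\<bar> + 1) > 0" using e by simp
      then obtain h where h: "Lip h" "bsupp h" "(\<integral>x. \<bar>indicator A x - h x\<bar> \<partial>lebesgue) < e / (\<bar>M\<bar> + 1)"
        using integrable_imp_L1_approx[OF iA] unfolding L1_approx_def by blast
      \<comment> \<open>\<open>|h|\<close> is a permitted test function, and it is no farther from
        the indicator than h.\<close>
      have h': "Lip (\<lambda>x. \<bar>h x\<bar>)" "bsupp (\<lambda>x. \<bar>h x\<bar>)" using h Lip_abs unfolding bsupp_def by auto
      have ih: "integrable lebesgue h" "integrable lebesgue (\<lambda>x. \<bar>h x\<bar>)" using Lip_bsupp_integrable h h' by auto
      have ihJ: "integrable lebesgue (\<lambda>x. \<bar>h x\<bar> * J x)" by (rule integrable_mult_bounded[OF ih(2) J])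
      have idJ: "integrable lebesgue (\<lambda>x. \<bar>indicator A x - h x\<bar> * J x)" by (rule integrable_mult_bounded[OF _ J]) (use iA ih in simp)
      have "(\<integral>x. \<bar>h x\<bar> * J x \<partial>lebesgue) - (\<integral>x. indicator A x * J x \<partial>lebesgue) = (\<integral>x. \<bar>h x\<bar> * J x - indicator A x * J x \<partial>lebesgue)"
        using ihJ iAJ by simp
      also have "\<dots> \<le> (\<integral>x. (\<bar>M\<bar> + 1) * \<bar>indicator A x - h x\<bar> \<partial>lebesgue)"
      proof (rule integral_mono_AE)
        show "AE x in lebesgue. \<bar>h x\<bar> * J x - indicator A x * J x \<le> (\<bar>M\<bar> + 1) * \<bar>indicator A x - h x\<bar>"
          using J(2)
        proof (rule eventually_mono)
          fix x assume M: "\<bar>J x\<bar> \<le> M"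
          have "\<bar>h x\<bar> * J x - indicator A x * J x = (\<bar>h x\<bar> - indicator A x) * J x" by (simp add: left_diff_distrib)
          also have "\<dots> \<le> \<bar>\<bar>h x\<bar> - indicator A x\<bar> * \<bar>J x\<bar>" by (metis abs_ge_self abs_mult)
          also have "\<dots> \<le> \<bar>indicator A x - h x\<bar> * (\<bar>M\<bar> + 1)"
            using M by (intro mult_mono) (auto simp: indicator_def)
          finally show "\<bar>h x\<bar> * J x - indicator A x * J x \<le> (\<bar>M\<bar> + 1) * \<bar>indicator A x - h x\<bar>" by (simp add: mult.commute)
        qed
      qed (use ihJ iAJ iA ih in auto)
      also have "\<dots> = (\<bar>M\<bar> + 1) * (\<integral>x. \<bar>indicator A x - h x\<bar> \<partial>lebesgue)" by simp
      also have "\<dots> \<le> (\<bar>M\<bar> + 1) * (e / (\<bar>M\<bar> + 1))" using h(3) by (intro mult_left_mono) auto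
      also have "\<dots> = e" by (simp add: add_nonneg_eq_0_iff)
      finally have "(\<integral>x. \<bar>h x\<bar> * J x \<partial>lebesgue) - (\<integral>x. indicator A x * J x \<partial>lebesgue) \<le> e" .
      moreover have "0 \<le> (\<integral>x. \<bar>h x\<bar> * J x \<partial>lebesgue)" using h' by (intro pos) auto
      ultimately show ?thesis by linarith
    qed
    then have "0 \<le> (\<integral>x. indicator A x * J x \<partial>lebesgue) + e" if "e > 0" for e using that by force
    then have "0 \<le> (\<integral>x. indicator A x * J x \<partial>lebesgue)" by (rule field_le_epsilon)
    moreover have "(\<integral>x. indicator A x * J x \<partial>lebesgue) \<le> 0"
    proof -
      have "0 \<le> (\<integral>x. - (indicator A x * J x) \<partial>lebesgue)" by (rule integral_nonneg_AE) (auto simp: A_def indicator_def)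
      then show ?thesis by simp
    qed
    ultimately have "(\<integral>x. - (indicator A x * J x) \<partial>lebesgue) = 0" by simp
    moreover have "AE x in lebesgue. 0 \<le> - (indicator A x * J x)" by (auto simp: A_def indicator_def)
    ultimately have "AE x in lebesgue. - (indicator A x * J x) = 0"
      using integral_nonneg_eq_0_iff_AE[of lebesgue "\<lambda>x. - (indicator A x * J x)"] iAJ by simp
    then show ?thesis by (rule eventually_mono) (auto simp: A_def indicator_def split: if_splits)
  qed
  then have "AE x in lebesgue. \<forall>n. x \<in> cball 0 (real n) \<longrightarrow> 0 \<le> J x" unfolding AE_all_countable by blast
  then show ?thesis
  proof (rule eventually_mono)
    fix x :: 'a assume *: "\<forall>n. x \<in> cball 0 (real n) \<longrightarrow> 0 \<le> J x"
    obtain n where "norm x \<le> real n" using real_arch_simple by blast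
    then show "0 \<le> J x" using * by auto
  qed
qed

text \<open>Nonnegativity is given for almost every t only. Integrals of a fixed weight against the
  Jacobian are continuous in t, so they are nonnegative for every t, the endpoints included.\<close>

lemma flow_comp_jac_nonneg:
  assumes T: "0 < T" and flow: "transport_flow T a X" and t: "t \<in> {0..T}"
  shows "AE x in lebesgue. 0 \<le> jac (flow_comp T X t) x"
proof -
  have LX: "Lip (flow_comp T X t i)" for t i by (rule Lip2_Lip[OF flow_comp_Lip2[OF T flow]])
  obtain L where L: "\<And>i. L-lipschitz_on UNIV (flow_comp T X t i)" using Lip_common[of "flow_comp T X t", OF LX] by blast
  show ?thesis
  proof (rule weak_nonneg[OF jac_measurable[OF LX] jac_bounded[OF L]])
    fix p :: "real^'a \<Rightarrow> real" assume p: "Lip p" "bsupp p" "\<And>x. 0 \<le> p x"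
    obtain R where R: "\<And>x. R \<le> norm x \<Longrightarrow> p x = 0" using p(2) unfolding bsupp_def by blast
    let ?F = "\<lambda>t. \<integral>x. p x * jac (flow_comp T X t) x \<partial>lebesgue"
    have "Lip ?F"
      by (rule transport_conservation(1)[OF flow_comp_Lip2[OF T flow] flow_comp_solves[OF T flow] Lip2_space[OF p(1)] R, where ut="\<lambda>t x. 0"]) auto
    then have c: "continuous_on UNIV ?F" by (rule Lip_continuous_on)
    have ae: "AE s in lebesgue. s \<in> {0<..<T} \<longrightarrow> 0 \<le> ?F s"
      using flow_comp_jac_nonneg_AE[OF T flow]
      by (rule eventually_mono) (auto intro!: integral_nonneg_AE elim!: eventually_mono simp: p(3))
    show "0 \<le> ?F t"
    proof (rule ccontr)
      assume "\<not> 0 \<le> ?F t"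
      then have "t \<in> {s. ?F s < 0}" by simp
      moreover have "open {s. ?F s < 0}" by (intro open_Collect_less c continuous_intros)
      ultimately obtain e where e: "e > 0" "ball t e \<subseteq> {s. ?F s < 0}" using open_contains_ball by blast
      \<comment> \<open>Intersecting with (0, T) leaves an interval of positive length even when t
        is 0 or T.\<close>
      define l u where "l = max 0 (t - e)" and "u = min T (t + e)"
      have lu: "l < u" using t T e by (auto simp: l_def u_def)
      have "AE s in lebesgue. s \<notin> {l<..<u}"
        using ae
      proof (rule eventually_mono)
        fix s assume s: "s \<in> {0<..<T} \<longrightarrow> 0 \<le> ?F s"
        show "s \<notin> {l<..<u}"
        proof
          assume "s \<in> {l<..<u}"
          then have "s \<in> {0<..<T}" "s \<in> ball t e" by (auto simp: l_def u_def dist_real_def)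
          then show False using s e(2) by fastforce
        qed
      qed
      then have "{l<..<u} \<in> null_sets lebesgue" by (simp add: AE_iff_null_sets)
      then show False using lu by (simp add: null_sets_def)
    qed
  qed
qed

section \<open>Continuously differentiable approximations of the indicator of an interval\<close>

section \<open>Bump functions\<close>

lemma DERIV_max0_square: "((\<lambda>x. (max 0 x)\<^sup>2) has_real_derivative 2 * max 0 x) (at x)" for x :: real
proof -
  consider "x > 0" | "x < 0" | "x = 0" by linarith
  then show ?thesis
  proof cases
    case 1
    have "((\<lambda>x. x\<^sup>2) has_real_derivative 2 * x) (at x)" by (auto intro!: derivative_eq_intros)
    then have "((\<lambda>x. (max 0 x)\<^sup>2) has_real_derivative 2 * x) (at x)"
      by (rule has_field_derivative_transform_within_open[where S="{0<..}"]) (use 1 in auto)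
    then show ?thesis using 1 by simp
  next
    case 2
    have "((\<lambda>x. (max 0 x)\<^sup>2) has_real_derivative 0) (at x)"
      by (rule has_field_derivative_transform_within_open[OF DERIV_const, of "{..<0}" _ 0]) (use 2 in auto)
    then show ?thesis using 2 by simp
  next
    case 3
    have "((\<lambda>h. ((max 0 (0 + h))\<^sup>2 - (max 0 0)\<^sup>2) / h) \<longlongrightarrow> 0) (at (0::real))"
    proof (rule Lim_null_comparison[where g="\<lambda>h. \<bar>h\<bar>"])
      show "eventually (\<lambda>h::real. norm (((max 0 (0 + h))\<^sup>2 - (max 0 0)\<^sup>2) / h) \<le> \<bar>h\<bar>) (at 0)"
        by (intro always_eventually allI) (auto simp: max_def power2_eq_square)
      show "((\<lambda>h::real. \<bar>h\<bar>) \<longlongrightarrow> 0) (at 0)" by (auto intro!: tendsto_eq_intros)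
    qed
    then show ?thesis using 3 by (simp add: DERIV_def)
  qed
qed

text \<open>The squared positive parts make the denominator continuously differentiable and confine
  the support to [l, u]; inside, the function rises to 1 as n grows.\<close>

definition bump :: "nat \<Rightarrow> real \<Rightarrow> real \<Rightarrow> real \<Rightarrow> real" where
  "bump n l u s = 1 - inverse (1 + real n * ((max 0 (s - l))\<^sup>2 * (max 0 (u - s))\<^sup>2))"

lemma bump_pos_denom: "1 \<le> 1 + real n * ((max 0 (s - l))\<^sup>2 * (max 0 (u - s))\<^sup>2)"
  by simp

lemma bump_bounds: "0 \<le> bump n l u s" "bump n l u s \<le> 1"
  using bump_pos_denom[of n s l u] by (auto simp: bump_def inverse_le_1_iff)

lemma bump_outside: "s \<notin> {l<..<u} \<Longrightarrow> bump n l u s = 0"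
  by (auto simp: bump_def max_def)

lemma bump_positive: "s \<in> {l<..<u} \<Longrightarrow> 0 < n \<Longrightarrow> 0 < bump n l u s"
proof -
  assume "s \<in> {l<..<u}" "0 < n"
  then have "1 < 1 + real n * ((max 0 (s - l))\<^sup>2 * (max 0 (u - s))\<^sup>2)" by auto
  then have "inverse (1 + real n * ((max 0 (s - l))\<^sup>2 * (max 0 (u - s))\<^sup>2)) < 1" by (rule inverse_less_1_iff[THEN iffD2, OF disjI2])
  then show ?thesis by (simp add: bump_def)
qed

lemma bump_tendsto: "(\<lambda>n. bump n l u s) \<longlonglongrightarrow> indicator {l<..<u} s"
proof (cases "s \<in> {l<..<u}")
  case True
  let ?c = "(max 0 (s - l))\<^sup>2 * (max 0 (u - s))\<^sup>2"
  have c: "?c > 0" using True by auto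
  have "filterlim (\<lambda>n. 1 + real n * ?c) at_top sequentially"
    by (intro filterlim_tendsto_add_at_top[OF tendsto_const] filterlim_at_top_mult_tendsto_pos[OF tendsto_const c] filterlim_real_sequentially)
  then have "(\<lambda>n. inverse (1 + real n * ?c)) \<longlonglongrightarrow> 0" by (rule tendsto_inverse_0_at_top)
  then have "(\<lambda>n. 1 - inverse (1 + real n * ?c)) \<longlonglongrightarrow> 1 - 0" by (intro tendsto_intros)
  then show ?thesis using True by (simp add: bump_def)
next
  case False then show ?thesis by (simp add: bump_outside)
qed

definition bump' :: "nat \<Rightarrow> real \<Rightarrow> real \<Rightarrow> real \<Rightarrow> real" where
  "bump' n l u s = real n * (2 * max 0 (s - l) * (max 0 (u - s))\<^sup>2 - (max 0 (s - l))\<^sup>2 * (2 * max 0 (u - s)))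
     * inverse ((1 + real n * ((max 0 (s - l))\<^sup>2 * (max 0 (u - s))\<^sup>2))\<^sup>2)"

lemma bump_DERIV: "(bump n l u has_real_derivative bump' n l u s) (at s)"
proof -
  have 1: "((\<lambda>s. (max 0 (s - l))\<^sup>2) has_real_derivative 2 * max 0 (s - l)) (at s)"
  proof -
    have "((\<lambda>s. s - l) has_real_derivative 1) (at s)" by (auto intro!: derivative_eq_intros)
    from DERIV_chain2[OF DERIV_max0_square this] show ?thesis by simp
  qed
  have 2: "((\<lambda>s. (max 0 (u - s))\<^sup>2) has_real_derivative - (2 * max 0 (u - s))) (at s)"
  proof -
    have "((\<lambda>s. u - s) has_real_derivative -1) (at s)" by (auto intro!: derivative_eq_intros)
    from DERIV_chain2[OF DERIV_max0_square this] show ?thesis by simp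
  qed
  let ?d = "1 + real n * ((max 0 (s - l))\<^sup>2 * (max 0 (u - s))\<^sup>2)"
  have nz: "?d \<noteq> 0" using bump_pos_denom[of n s l u] by linarith
  have d: "((\<lambda>s. 1 + real n * ((max 0 (s - l))\<^sup>2 * (max 0 (u - s))\<^sup>2)) has_real_derivative
     real n * (2 * max 0 (s - l) * (max 0 (u - s))\<^sup>2 - (max 0 (s - l))\<^sup>2 * (2 * max 0 (u - s)))) (at s)"
    by (rule DERIV_cong[OF DERIV_add[OF DERIV_const DERIV_cmult[OF DERIV_mult[OF 1 2]]]]) (simp add: algebra_simps)
  show ?thesis
    unfolding bump_def[abs_def] bump'_def
    by (rule DERIV_cong[OF DERIV_diff[OF DERIV_const DERIV_inverse'[OF d nz]]]) (simp add: power2_eq_square)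
qed

lemma Lip_of_bounded_derivative:
  fixes b :: "real \<Rightarrow> real"
  assumes "\<And>s. (b has_real_derivative b' s) (at s)" "\<And>s. \<bar>b' s\<bar> \<le> C"
  shows "Lip b"
  unfolding Lip_def
proof (intro exI lipschitz_onI)
  fix x y :: real
  have "norm (b x - b y) \<le> C * norm (x - y)"
    by (rule field_differentiable_bound[of UNIV b b']) (use assms in auto)
  then show "dist (b x) (b y) \<le> C * dist x y" by (simp add: dist_norm)
qed (use assms(2)[of 0] in linarith)

lemma Lip_bump: "Lip (bump n l u)"
proof -
  have nz: "(1 + real n * ((max 0 (s - l))\<^sup>2 * (max 0 (u - s))\<^sup>2))\<^sup>2 \<noteq> 0" for s
  proof -
    have "1 + real n * ((max 0 (s - l))\<^sup>2 * (max 0 (u - s))\<^sup>2) \<noteq> 0" using bump_pos_denom[of n s l u] by linarith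
    then show ?thesis by (simp only: power_eq_0_iff) simp
  qed
  have c: "continuous_on UNIV (bump' n l u)"
    unfolding bump'_def
    using nz by (intro continuous_intros) auto
  have "compact (bump' n l u ` {l..u})" by (intro compact_continuous_image continuous_on_subset[OF c]) auto
  then obtain C where C: "\<And>s. s \<in> {l..u} \<Longrightarrow> \<bar>bump' n l u s\<bar> \<le> C"
    using compact_imp_bounded[THEN bounded_iff[THEN iffD1]] by fastforce
  have "\<bar>bump' n l u s\<bar> \<le> \<bar>C\<bar>" for s
  proof (cases "s \<in> {l..u}")
    case True then show ?thesis using C[OF True] by linarith
  next
    case False
    then have "bump' n l u s = 0" by (auto simp: bump'_def max_def)
    then show ?thesis by simp
  qed
  then show ?thesis by (rule Lip_of_bounded_derivative[OF bump_DERIV])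
qed

lemma Lip2_compose: "Lip b \<Longrightarrow> Lip2 w \<Longrightarrow> Lip2 (\<lambda>t x. b (w t x))" for b :: "real \<Rightarrow> real"
  unfolding Lip2_def by (rule Lip_compose)

section \<open>A monotone class argument from smooth to bounded Borel functions of the flow\<close>

section \<open>Testing against bounded Borel functions of the flow\<close>

definition flow_map :: "real \<Rightarrow> (real \<Rightarrow> real^'n \<Rightarrow> real^'n) \<Rightarrow> real \<Rightarrow> real^'n \<Rightarrow> real^'n" where
  "flow_map T X t = X (max 0 (min T t))"

lemma flow_map_nth: "flow_map T X t x $ i = flow_comp T X t i x"
  by (simp add: flow_map_def flow_comp_def)

text \<open>\<open>p\<close> is the weight that bounds supports and \<open>pt\<close> its time
  derivative. It is instantiated with cutoffs and Lipschitz functions constant in time, and with the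
  test functions of the equation.\<close>

locale transport_test =
  fixes T :: real and a :: "real \<Rightarrow> real^'n \<Rightarrow> real^'n" and X :: "real \<Rightarrow> real^'n \<Rightarrow> real^'n"
    and p pt :: "real \<Rightarrow> real^'n \<Rightarrow> real" and R :: real
  assumes T: "0 < T" and a: "Linf_field T a" and flow: "transport_flow T a X"
    and p: "Lip2 p" "\<And>t x. R \<le> norm x \<Longrightarrow> p t x = 0"
    and pt: "AE t in lebesgue. t \<in> {0<..<T} \<longrightarrow> (AE x in lebesgue. ((\<lambda>s. p s x) has_real_derivative pt t x) (at t))"
begin

abbreviation "Y \<equiv> flow_comp T X"
abbreviation "V \<equiv> flow_map T X"

definition P :: "real \<Rightarrow> real^'n \<Rightarrow> real" where "P t x = p t x * jac (Y t) x"
text \<open>The density whose space integral is the time derivative of the integral of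
  \<open>P\<close>; a transported factor \<open>g (V t x)\<close> passes through unchanged.\<close>

definition K :: "real \<Rightarrow> real^'n \<Rightarrow> real" where "K t x = (pt t x + a t x \<bullet> grad (p t) x) * jac (Y t) x"

lemma V_continuous: "continuous_on UNIV (V t)"
proof -
  have "V t = (\<lambda>x. \<chi> i. Y t i x)" by (simp add: fun_eq_iff vec_eq_iff flow_map_nth)
  then show ?thesis
    using Lip_continuous_on[OF Lip2_Lip[OF flow_comp_Lip2[OF T flow]]] by (auto intro!: continuous_on_vec_lambda)
qed

lemma V_measurable: "V t \<in> borel_measurable lebesgue"
  by (intro measurable_completion) (simp add: borel_measurable_continuous_onI V_continuous)

lemma gV_measurable: "g \<in> borel_measurable borel \<Longrightarrow> (\<lambda>x. g (V t x)) \<in> borel_measurable lebesgue"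
  by (rule measurable_compose[OF V_measurable])

lemma Y_Lip: "Lip (Y t i)"
  by (rule Lip2_Lip[OF flow_comp_Lip2[OF T flow]])

lemma p_bsupp: "bsupp (p t)"
  using p(2) unfolding bsupp_def by blast

lemma P_integrable: "integrable lebesgue (P t)"
proof -
  obtain L where L: "\<And>i. L-lipschitz_on UNIV (Y t i)" using Lip_common[of "Y t", OF Y_Lip] by blast
  show ?thesis unfolding P_def[abs_def]
    by (rule integrable_mult_bounded[OF Lip_bsupp_integrable[OF Lip2_Lip[OF p(1)] p_bsupp] jac_measurable[OF Y_Lip] jac_bounded[OF L]])
qed

lemma gP_integrable:
  assumes g: "g \<in> borel_measurable borel" "\<And>y. \<bar>g y\<bar> \<le> B"
  shows "integrable lebesgue (\<lambda>x. g (V t x) * P t x)"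
  using integrable_mult_bounded[OF P_integrable[of t] gV_measurable[OF g(1), of t], of B] g(2) by (simp add: mult.commute)

text \<open>Integrability of \<open>K t\<close>, measurability included, comes from the transport
  identity with w = 1; the bound comes from the essential bound of a and the Lipschitz constants of
  p and of the flow.\<close>

lemma K_bound:
  obtains C where "0 \<le> C"
    "AE t in lebesgue. t \<in> {0<..<T} \<longrightarrow> integrable lebesgue (K t) \<and> (AE x in lebesgue. \<bar>K t x\<bar> \<le> C * indicator (cball 0 R) x)"
proof -
  have int: "AE t in lebesgue. t \<in> {0<..<T} \<longrightarrow> integrable lebesgue (\<lambda>x. 1 * K t x)"
    unfolding K_def
    by (rule transport_identity(1)[OF flow_comp_Lip2[OF T flow] flow_comp_solves[OF T flow] p pt Lip2_const _ solves_const, where B=1]) auto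
  obtain A where A: "AE z in lebesgue. z \<in> {0<..<T} \<times> UNIV \<longrightarrow> norm (a (fst z) (snd z)) \<le> A"
    using a unfolding Linf_field_def by blast
  obtain L where L: "0 \<le> L" "\<And>t. L-lipschitz_on UNIV (p t)" "\<And>s t x. \<bar>p s x - p t x\<bar> \<le> L * \<bar>s - t\<bar>"
    using Lip2_bounds[OF p(1)] by metis
  obtain M where M0: "0 \<le> M" and LY: "\<And>t i. M-lipschitz_on UNIV (Y t i)"
    by (rule flow_comp_uniform_lipschitz[OF T flow]) blast
  \<comment> \<open>\<open>pt\<close> is bounded by L, each of the N partial derivatives of p by L,
    the field by |A|, and the Jacobian by the last factor.\<close>
  define C where "C = (L + \<bar>A\<bar> * (real CARD('n) * L)) * det_bound TYPE('n) M"
  have "0 \<le> C" using L(1) M0 by (simp add: C_def det_bound_def)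
  moreover have "AE t in lebesgue. t \<in> {0<..<T} \<longrightarrow> integrable lebesgue (K t) \<and> (AE x in lebesgue. \<bar>K t x\<bar> \<le> C * indicator (cball 0 R) x)"
    using int AE_lebesgue_pair[OF A] pt
  proof eventually_elim
    case (elim t)
    show ?case
    proof (intro impI conjI)
      assume t: "t \<in> {0<..<T}"
      show "integrable lebesgue (K t)" using elim(1) t by simp
      from elim(2) elim(3)[rule_format, OF t] jac_bounded[where f="Y t", OF LY] Lip_AE_pd[OF Lip2_Lip[OF p(1), of t]]
      show "AE x in lebesgue. \<bar>K t x\<bar> \<le> C * indicator (cball 0 R) x"
      proof eventually_elim
        case (elim x)
        show ?case
        proof (cases "norm x \<le> R")
          case True
          have q: "(\<lambda>n. real (Suc n) * (p (t + 1 / real (Suc n)) x - p t x)) \<longlonglongrightarrow> pt t x"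
            using LIMSEQ_quotient[of "\<lambda>s. p s x" "pt t x" t] elim(2) by (simp add: has_real_derivative_iff_has_vector_derivative)
          have "\<bar>real (Suc n) * (p (t + 1 / real (Suc n)) x - p t x)\<bar> \<le> L" for n
          proof -
            have "real (Suc n) * \<bar>p (t + 1 / real (Suc n)) x - p t x\<bar> \<le> real (Suc n) * (L * \<bar>t + 1 / real (Suc n) - t\<bar>)"
              by (intro mult_left_mono L(3)) simp
            then show ?thesis by (simp add: abs_mult)
          qed
          then have 1: "\<bar>pt t x\<bar> \<le> L" using LIMSEQ_le_const2[OF tendsto_rabs[OF q]] by blast
          have "norm (grad (p t) x) \<le> (\<Sum>j\<in>UNIV. \<bar>grad (p t) x $ j\<bar>)" by (rule norm_le_l1_cart)
          also have "\<dots> \<le> (\<Sum>j\<in>(UNIV::'n set). L)" by (intro sum_mono grad_bounded[OF L(2)]) (use elim in auto)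
          finally have 2: "norm (grad (p t) x) \<le> real CARD('n) * L" by simp
          have "\<bar>a t x \<bullet> grad (p t) x\<bar> \<le> norm (a t x) * norm (grad (p t) x)" by (rule Cauchy_Schwarz_ineq2)
          also have "\<dots> \<le> \<bar>A\<bar> * (real CARD('n) * L)" using elim(1) t 2 by (intro mult_mono) auto
          finally have "\<bar>pt t x + a t x \<bullet> grad (p t) x\<bar> \<le> L + \<bar>A\<bar> * (real CARD('n) * L)" using 1 by linarith
          then have "\<bar>K t x\<bar> \<le> C" unfolding K_def C_def abs_mult using elim(3) L(1) by (intro mult_mono) auto
          then show ?thesis using True by simp
        next
          case False
          have "((\<lambda>s. p s x) has_real_derivative 0) (at t)" using False by (simp add: p(2))
          then have "pt t x = 0" using elim(2) DERIV_unique by blast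
          moreover have "grad (p t) x = 0" using False by (intro grad_zero_outside(2)[of R] p(2)) auto
          ultimately show ?thesis using False by (simp add: K_def)
        qed
      qed
    qed
  qed
  ultimately show ?thesis by (rule that)
qed

text \<open>The class for the monotone class argument: bounded Borel g for which the transport
  identity holds with w = g(V). Integrability in r is part of it, since otherwise the right-hand
  integral could be 0 by convention.\<close>

definition balanced :: "(real^'n \<Rightarrow> real) \<Rightarrow> bool" where
  "balanced g \<longleftrightarrow> g \<in> borel_measurable borel \<and> (\<exists>B. \<forall>y. \<bar>g y\<bar> \<le> B) \<and>
     (\<forall>s t. 0 \<le> s \<longrightarrow> s \<le> t \<longrightarrow> t \<le> T \<longrightarrow>
        integrable lebesgue (\<lambda>r. indicator {s<..<t} r * (\<integral>x. g (V r x) * K r x \<partial>lebesgue)) \<and>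
        (\<integral>x. g (V t x) * P t x \<partial>lebesgue) - (\<integral>x. g (V s x) * P s x \<partial>lebesgue)
          = (\<integral>r. indicator {s<..<t} r * (\<integral>x. g (V r x) * K r x \<partial>lebesgue) \<partial>lebesgue))"

lemma gK_integrable:
  assumes "g \<in> borel_measurable borel" "\<And>y. \<bar>g y\<bar> \<le> B"
  shows "integrable lebesgue (K t) \<Longrightarrow> integrable lebesgue (\<lambda>x. g (V t x) * K t x)"
  using integrable_mult_bounded[OF _ gV_measurable[OF assms(1), of t], of "K t" B] assms(2) by (simp add: mult.commute)

lemma gK_bound:
  assumes g: "g \<in> borel_measurable borel" "\<And>y. \<bar>g y\<bar> \<le> B"
    and K: "integrable lebesgue (K r)" "AE x in lebesgue. \<bar>K r x\<bar> \<le> C * indicator (cball 0 R) x"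
  shows "AE x in lebesgue. \<bar>g (V r x) * K r x\<bar> \<le> (B * C) * indicator (cball 0 R) x"
    and "\<bar>\<integral>x. g (V r x) * K r x \<partial>lebesgue\<bar> \<le> B * C * measure lebesgue (cball (0::real^'n) R)"
proof -
  have B0: "0 \<le> B" using order.trans[OF abs_ge_zero g(2)] .
  show bd: "AE x in lebesgue. \<bar>g (V r x) * K r x\<bar> \<le> (B * C) * indicator (cball 0 R) x"
    using K(2)
  proof (rule eventually_mono)
    fix x assume "\<bar>K r x\<bar> \<le> C * indicator (cball 0 R) x"
    then have "\<bar>g (V r x)\<bar> * \<bar>K r x\<bar> \<le> B * (C * indicator (cball 0 R) x)" using g(2) B0 by (intro mult_mono) auto
    then show "\<bar>g (V r x) * K r x\<bar> \<le> (B * C) * indicator (cball 0 R) x" by (simp only: abs_mult mult.assoc)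
  qed
  show "\<bar>\<integral>x. g (V r x) * K r x \<partial>lebesgue\<bar> \<le> B * C * measure lebesgue (cball (0::real^'n) R)"
    by (rule integral_bounded_support[OF gK_integrable[OF g K(1)] bd])
qed

text \<open>Dominated convergence twice: in x at almost every r, then in r with the constant
  obtained from the first step. The bound B must be common to the sequence.\<close>

lemma balanced_limit:
  assumes g: "\<And>n. balanced (g n)" and B: "\<And>n y. \<bar>g n y\<bar> \<le> B" and lim: "\<And>y. (\<lambda>n. g n y) \<longlonglongrightarrow> h y"
  shows "balanced h"
proof -
  have gm: "g n \<in> borel_measurable borel" for n using g unfolding balanced_def by blast
  have hm: "h \<in> borel_measurable borel" by (rule borel_measurable_LIMSEQ_real[OF lim gm])
  have hB: "\<bar>h y\<bar> \<le> B" for y by (rule LIMSEQ_le_const2[OF tendsto_rabs[OF lim]]) (use B in blast)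
  have B0: "0 \<le> B" using order.trans[OF abs_ge_zero B] .
  obtain C where C0: "0 \<le> C" and C: "AE t in lebesgue. t \<in> {0<..<T} \<longrightarrow> integrable lebesgue (K t) \<and> (AE x in lebesgue. \<bar>K t x\<bar> \<le> C * indicator (cball 0 R) x)"
    using K_bound by blast
  let ?vol = "measure lebesgue (cball (0::real^'n) R)"
  have inner: "AE r in lebesgue. r \<in> {0<..<T} \<longrightarrow>
      (\<lambda>n. \<integral>x. g n (V r x) * K r x \<partial>lebesgue) \<longlonglongrightarrow> (\<integral>x. h (V r x) * K r x \<partial>lebesgue) \<and> (\<forall>n. \<bar>\<integral>x. g n (V r x) * K r x \<partial>lebesgue\<bar> \<le> B * C * ?vol)"
    using C
  proof eventually_elim
    case (elim r)
    show ?case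
    proof (intro impI conjI allI)
      assume r: "r \<in> {0<..<T}"
      have iK: "integrable lebesgue (K r)" and bK: "AE x in lebesgue. \<bar>K r x\<bar> \<le> C * indicator (cball 0 R) x" using elim r by auto
      note bd = gK_bound(1)[OF gm B iK bK]
      show "(\<lambda>n. \<integral>x. g n (V r x) * K r x \<partial>lebesgue) \<longlonglongrightarrow> (\<integral>x. h (V r x) * K r x \<partial>lebesgue)"
      proof (rule integral_dominated_convergence[where w="\<lambda>x. (B * C) * indicator (cball 0 R) x"])
        show "(\<lambda>x. h (V r x) * K r x) \<in> borel_measurable lebesgue" "(\<lambda>x. g n (V r x) * K r x) \<in> borel_measurable lebesgue" for n
          using gK_integrable[OF hm hB iK] gK_integrable[OF gm B iK, of n] by auto
        show "AE x in lebesgue. (\<lambda>n. g n (V r x) * K r x) \<longlonglongrightarrow> h (V r x) * K r x"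
          by (intro AE_I2 tendsto_mult_right lim)
        show "AE x in lebesgue. norm (g n (V r x) * K r x) \<le> (B * C) * indicator (cball 0 R) x" for n using bd[of n] by simp
      qed (rule integrable_const_cball)
      show "\<bar>\<integral>x. g n (V r x) * K r x \<partial>lebesgue\<bar> \<le> B * C * ?vol" for n by (rule gK_bound(2)[OF gm B iK bK])
    qed
  qed
  have fin: "integrable lebesgue (\<lambda>r. indicator {s<..<t} r * (\<integral>x. h (V r x) * K r x \<partial>lebesgue)) \<and>
        (\<integral>x. h (V t x) * P t x \<partial>lebesgue) - (\<integral>x. h (V s x) * P s x \<partial>lebesgue)
          = (\<integral>r. indicator {s<..<t} r * (\<integral>x. h (V r x) * K r x \<partial>lebesgue) \<partial>lebesgue)"
    if st: "0 \<le> s" "s \<le> t" "t \<le> T" for s t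
  proof -
    let ?G = "\<lambda>g r. indicator {s<..<t} r * (\<integral>x. g (V r x) * K r x \<partial>lebesgue) :: real"
    have iG: "integrable lebesgue (?G (g n))" for n using g[of n] st unfolding balanced_def by blast
    have ae: "AE r in lebesgue. (\<lambda>n. ?G (g n) r) \<longlonglongrightarrow> ?G h r"
      using inner
    proof (rule eventually_mono)
      fix r assume *: "r \<in> {0<..<T} \<longrightarrow>
        (\<lambda>n. \<integral>x. g n (V r x) * K r x \<partial>lebesgue) \<longlonglongrightarrow> (\<integral>x. h (V r x) * K r x \<partial>lebesgue) \<and> (\<forall>n. \<bar>\<integral>x. g n (V r x) * K r x \<partial>lebesgue\<bar> \<le> B * C * ?vol)"
      show "(\<lambda>n. ?G (g n) r) \<longlonglongrightarrow> ?G h r"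
        using * st by (cases "r \<in> {s<..<t}") auto
    qed
    have bd: "AE r in lebesgue. norm (?G (g n) r) \<le> (B * C * ?vol) * indicator {s<..<t} r" for n
      using inner by (rule eventually_mono) (use st in \<open>auto simp: indicator_def\<close>)
    have iw: "integrable lebesgue (\<lambda>r. (B * C * ?vol) * indicator {s<..<t} r :: real)"
      using st by (intro integrable_mult_right integrable_real_indicator) auto
    have mG: "?G h \<in> borel_measurable lebesgue" by (rule borel_measurable_LIMSEQ_AE[OF borel_measurable_integrable[OF iG] ae])
    note dc = mG borel_measurable_integrable[OF iG] iw ae bd
    have lim1: "(\<lambda>n. integral\<^sup>L lebesgue (?G (g n))) \<longlonglongrightarrow> integral\<^sup>L lebesgue (?G h)"
      by (rule integral_dominated_convergence[OF dc])
    have lim2: "(\<lambda>n. \<integral>x. g n (V q x) * P q x \<partial>lebesgue) \<longlonglongrightarrow> (\<integral>x. h (V q x) * P q x \<partial>lebesgue)" for q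
    proof (rule integral_dominated_convergence[where w="\<lambda>x. B * \<bar>P q x\<bar>"])
      show "(\<lambda>x. h (V q x) * P q x) \<in> borel_measurable lebesgue" "(\<lambda>x. g n (V q x) * P q x) \<in> borel_measurable lebesgue" for n
        using gP_integrable[OF hm hB, of q] gP_integrable[OF gm B, of n q] by auto
      show "AE x in lebesgue. (\<lambda>n. g n (V q x) * P q x) \<longlonglongrightarrow> h (V q x) * P q x"
        by (intro AE_I2 tendsto_mult_right lim)
      show "AE x in lebesgue. norm (g n (V q x) * P q x) \<le> B * \<bar>P q x\<bar>" for n
        by (intro AE_I2) (auto simp: abs_mult intro!: mult_right_mono B)
      show "integrable lebesgue (\<lambda>x. B * \<bar>P q x\<bar>)" using P_integrable[of q] by simp
    qed
    have "(\<integral>x. g n (V t x) * P t x \<partial>lebesgue) - (\<integral>x. g n (V s x) * P s x \<partial>lebesgue) = integral\<^sup>L lebesgue (?G (g n))" for n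
      using g[of n] st unfolding balanced_def by blast
    then have "(\<lambda>n. (\<integral>x. g n (V t x) * P t x \<partial>lebesgue) - (\<integral>x. g n (V s x) * P s x \<partial>lebesgue)) \<longlonglongrightarrow> integral\<^sup>L lebesgue (?G h)"
      using lim1 by simp
    from LIMSEQ_unique[OF this tendsto_diff[OF lim2 lim2]] integrable_dominated_convergence[OF dc]
    show ?thesis by simp
  qed
  show ?thesis unfolding balanced_def using hm hB fin by blast
qed

lemma balanced_lin:
  assumes g: "balanced g" and h: "balanced h"
  shows "balanced (\<lambda>y. c * g y + d * h y)"
proof -
  have gm: "g \<in> borel_measurable borel" and hm: "h \<in> borel_measurable borel" using g h unfolding balanced_def by blast+
  obtain A B where A: "\<And>y. \<bar>g y\<bar> \<le> A" and B: "\<And>y. \<bar>h y\<bar> \<le> B" using g h unfolding balanced_def by blast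
  obtain C where C: "AE t in lebesgue. t \<in> {0<..<T} \<longrightarrow> integrable lebesgue (K t) \<and> (AE x in lebesgue. \<bar>K t x\<bar> \<le> C * indicator (cball 0 R) x)"
    using K_bound by blast
  have m: "(\<lambda>y. c * g y + d * h y) \<in> borel_measurable borel" using gm hm by auto
  have "\<bar>c * g y + d * h y\<bar> \<le> \<bar>c\<bar> * A + \<bar>d\<bar> * B" for y
  proof -
    have "\<bar>c * g y + d * h y\<bar> \<le> \<bar>c\<bar> * \<bar>g y\<bar> + \<bar>d\<bar> * \<bar>h y\<bar>" by (metis abs_mult abs_triangle_ineq)
    also have "\<dots> \<le> \<bar>c\<bar> * A + \<bar>d\<bar> * B" by (intro add_mono mult_left_mono A B) auto
    finally show ?thesis .
  qed
  then have bd: "\<exists>B. \<forall>y. \<bar>c * g y + d * h y\<bar> \<le> B" by blast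
  have sP: "(\<integral>x. (c * g (V q x) + d * h (V q x)) * P q x \<partial>lebesgue)
      = c * (\<integral>x. g (V q x) * P q x \<partial>lebesgue) + d * (\<integral>x. h (V q x) * P q x \<partial>lebesgue)" for q
    using gP_integrable[OF gm A, of q] gP_integrable[OF hm B, of q] by (simp add: distrib_right mult.assoc)
  have sK: "AE r in lebesgue. r \<in> {0<..<T} \<longrightarrow> (\<integral>x. (c * g (V r x) + d * h (V r x)) * K r x \<partial>lebesgue)
      = c * (\<integral>x. g (V r x) * K r x \<partial>lebesgue) + d * (\<integral>x. h (V r x) * K r x \<partial>lebesgue)"
    using C
  proof (rule eventually_mono, intro impI)
    fix r assume "r \<in> {0<..<T} \<longrightarrow> integrable lebesgue (K r) \<and> (AE x in lebesgue. \<bar>K r x\<bar> \<le> C * indicator (cball 0 R) x)" "r \<in> {0<..<T}"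
    then have iK: "integrable lebesgue (K r)" by blast
    show "(\<integral>x. (c * g (V r x) + d * h (V r x)) * K r x \<partial>lebesgue)
      = c * (\<integral>x. g (V r x) * K r x \<partial>lebesgue) + d * (\<integral>x. h (V r x) * K r x \<partial>lebesgue)"
      using gK_integrable[OF gm A iK] gK_integrable[OF hm B iK] by (simp add: distrib_right mult.assoc)
  qed
  have "integrable lebesgue (\<lambda>r. indicator {s<..<t} r * (\<integral>x. (c * g (V r x) + d * h (V r x)) * K r x \<partial>lebesgue)) \<and>
        (\<integral>x. (c * g (V t x) + d * h (V t x)) * P t x \<partial>lebesgue) - (\<integral>x. (c * g (V s x) + d * h (V s x)) * P s x \<partial>lebesgue)
          = (\<integral>r. indicator {s<..<t} r * (\<integral>x. (c * g (V r x) + d * h (V r x)) * K r x \<partial>lebesgue) \<partial>lebesgue)"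
    if st: "0 \<le> s" "s \<le> t" "t \<le> T" for s t
  proof -
    let ?G = "\<lambda>g r. indicator {s<..<t} r * (\<integral>x. g (V r x) * K r x \<partial>lebesgue) :: real"
    let ?S = "\<lambda>r. c * ?G g r + d * ?G h r"
    have i: "integrable lebesgue (?G g)" "integrable lebesgue (?G h)" using g h st unfolding balanced_def by blast+
    have iS: "integrable lebesgue ?S" using i by simp
    have e: "AE r in lebesgue. ?S r = ?G (\<lambda>y. c * g y + d * h y) r"
      using sK by (rule eventually_mono) (use st in \<open>auto simp: indicator_def\<close>)
    have "integrable lebesgue (?G (\<lambda>y. c * g y + d * h y))" by (rule integrable_AE_eq(1)[OF iS e])
    moreover have "integral\<^sup>L lebesgue (?G (\<lambda>y. c * g y + d * h y)) = integral\<^sup>L lebesgue ?S"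
      by (rule integrable_AE_eq(2)[OF iS e, symmetric])
    moreover have "integral\<^sup>L lebesgue ?S = c * integral\<^sup>L lebesgue (?G g) + d * integral\<^sup>L lebesgue (?G h)"
      using i by simp
    moreover have "integral\<^sup>L lebesgue (?G g) = (\<integral>x. g (V t x) * P t x \<partial>lebesgue) - (\<integral>x. g (V s x) * P s x \<partial>lebesgue)"
      "integral\<^sup>L lebesgue (?G h) = (\<integral>x. h (V t x) * P t x \<partial>lebesgue) - (\<integral>x. h (V s x) * P s x \<partial>lebesgue)"
      using g h st unfolding balanced_def by auto
    ultimately show ?thesis unfolding sP by (simp add: algebra_simps)
  qed
  then show ?thesis unfolding balanced_def using m bd by blast
qed

text \<open>A product of one-variable functions of the components solves the transport equation by
  the product rule and the one-variable chain rule.\<close>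

lemma balanced_bump: "balanced (\<lambda>y. \<Prod>i\<in>UNIV. bump n (l $ i) (u $ i) (y $ i))"
proof -
  have b: "\<bar>bump n (l $ i) (u $ i) s\<bar> \<le> 1" for i s using bump_bounds[of n "l $ i" "u $ i" s] by simp
  have Bd: "\<bar>\<Prod>i\<in>UNIV. bump n (l $ i) (u $ i) (y $ i)\<bar> \<le> 1" for y
    unfolding abs_prod using b by (intro prod_le_1) auto
  have m: "(\<lambda>y. \<Prod>i\<in>UNIV. bump n (l $ i) (u $ i) (y $ i)) \<in> borel_measurable borel"
    by (intro borel_measurable_continuous_onI continuous_on_prod continuous_on_compose2[OF Lip_continuous_on[OF Lip_bump, of UNIV]] continuous_intros) auto
  define w where "w t x = (\<Prod>i\<in>UNIV. bump n (l $ i) (u $ i) (Y t i x))" for t x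
  have w: "Lip2 w" "\<And>t x. \<bar>w t x\<bar> \<le> 1" "solves T a w"
  proof -
    show "Lip2 w" unfolding w_def
      by (rule Lip2_prod) (auto intro: Lip2_compose Lip_bump flow_comp_Lip2[OF T flow] b)
    show "\<bar>w t x\<bar> \<le> 1" for t x unfolding w_def abs_prod using b by (intro prod_le_1) auto
    show "solves T a w" unfolding w_def
      by (rule solves_prod) (auto intro: solves_compose[OF flow_comp_solves[OF T flow] bump_DERIV])
  qed
  have wV: "(\<Prod>i\<in>UNIV. bump n (l $ i) (u $ i) (V t x $ i)) = w t x" for t x by (simp add: w_def flow_map_nth)
  show ?thesis
    unfolding balanced_def
  proof (intro conjI allI impI)
    show "\<exists>B. \<forall>y. \<bar>\<Prod>i\<in>UNIV. bump n (l $ i) (u $ i) (y $ i)\<bar> \<le> B" using Bd by blast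
    fix s t assume st: "0 \<le> s" "s \<le> t" "t \<le> T"
    show "integrable lebesgue (\<lambda>r. indicator {s<..<t} r * (\<integral>x. (\<Prod>i\<in>UNIV. bump n (l $ i) (u $ i) (V r x $ i)) * K r x \<partial>lebesgue))"
      unfolding wV K_def
      by (rule transport_identity(2)[OF flow_comp_Lip2[OF T flow] flow_comp_solves[OF T flow] p pt w st])
    show "(\<integral>x. (\<Prod>i\<in>UNIV. bump n (l $ i) (u $ i) (V t x $ i)) * P t x \<partial>lebesgue) - (\<integral>x. (\<Prod>i\<in>UNIV. bump n (l $ i) (u $ i) (V s x $ i)) * P s x \<partial>lebesgue)
      = (\<integral>r. indicator {s<..<t} r * (\<integral>x. (\<Prod>i\<in>UNIV. bump n (l $ i) (u $ i) (V r x $ i)) * K r x \<partial>lebesgue) \<partial>lebesgue)"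
      unfolding wV K_def P_def
      by (rule transport_identity(3)[OF flow_comp_Lip2[OF T flow] flow_comp_solves[OF T flow] p pt w st])
  qed (rule m)
qed

lemma balanced_box: "balanced (indicator (box l u))"
proof (rule balanced_limit[OF balanced_bump, where B=1])
  fix y
  have "indicator (box l u) y = (\<Prod>i\<in>UNIV. indicator {l $ i<..<u $ i} (y $ i) :: real)"
  proof (cases "y \<in> box l u")
    case True then show ?thesis by (simp add: mem_box_cart)
  next
    case False
    then obtain i where "y $ i \<notin> {l $ i<..<u $ i}" by (auto simp: mem_box_cart)
    then have "(\<Prod>i\<in>UNIV. indicator {l $ i<..<u $ i} (y $ i) :: real) = 0" by (intro prod_zero bexI[of _ i]) auto
    then show ?thesis using False by simp
  qed
  then show "(\<lambda>n. \<Prod>i\<in>UNIV. bump n (l $ i) (u $ i) (y $ i)) \<longlonglongrightarrow> indicator (box l u) y"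
    by (simp only:) (intro tendsto_prod bump_tendsto)
  show "\<bar>\<Prod>i\<in>UNIV. bump n (l $ i) (u $ i) (y $ i)\<bar> \<le> 1" for n
    unfolding abs_prod using bump_bounds by (intro prod_le_1) (auto simp: abs_le_iff order.trans[OF _ bump_bounds(1)])
qed

lemma balanced_one: "balanced (\<lambda>y. 1)"
proof (rule balanced_limit[where B=1])
  show "balanced (indicator (box (\<chi> i. - real n) (\<chi> i. real n)))" for n by (rule balanced_box)
  show "(\<lambda>n. indicator (box (\<chi> i. - real n) (\<chi> i. real n)) y) \<longlonglongrightarrow> (1::real)" for y :: "real^'n"
  proof -
    obtain N where N: "norm y < real N" using reals_Archimedean2 by blast
    have "eventually (\<lambda>n. indicator (box (\<chi> i. - real n) (\<chi> i. real n)) y = (1::real)) sequentially"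
    proof (rule eventually_sequentiallyI[of N])
      fix n assume "N \<le> n"
      then have "\<bar>y $ i\<bar> < real n" for i using component_le_norm_cart[of y i] N by linarith
      then show "indicator (box (\<chi> i. - real n) (\<chi> i. real n)) y = (1::real)"
        by (intro indicator_simps(1)) (auto simp: mem_box_cart abs_less_iff minus_less_iff)
    qed
    then show ?thesis by (rule tendsto_eventually)
  qed
qed auto

text \<open>Dynkin's theorem: boxes are stable under intersection and generate the Borel sets, while
  linearity and bounded limits give complements and disjoint unions.\<close>

lemma balanced_indicator: "A \<in> sets borel \<Longrightarrow> balanced (indicator A)"
proof -
  assume "A \<in> sets borel"
  then have A: "A \<in> sigma_sets UNIV (range (\<lambda>(a, b). box a b))" unfolding borel_eq_box by simp
  have "Int_stable (range (\<lambda>(a, b). box a (b::real^'n)))" by (auto simp: Int_stable_def box_Int_box)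
  moreover have "range (\<lambda>(a, b). box a (b::real^'n)) \<subseteq> Pow UNIV" by auto
  ultimately show ?thesis using A
  proof (induction rule: sigma_sets_induct_disjoint)
    case (basic A) then show ?case by (auto intro: balanced_box)
  next
    case empty
    show ?case using balanced_lin[OF balanced_one balanced_one, of 0 0] by simp
  next
    case (compl A)
    have "(indicator (UNIV - A) :: real^'n \<Rightarrow> real) = (\<lambda>y. 1 * 1 + (-1) * indicator A y)" by (auto simp: fun_eq_iff indicator_def)
    then show ?case using balanced_lin[OF balanced_one compl(2), of 1 "-1"] by simp
  next
    case (union F)
    have fin: "balanced (indicator (\<Union>i<n. F i))" for n :: nat
    proof (induction n)
      case 0
      show ?case using balanced_lin[OF balanced_one balanced_one, of 0 0] by simp
    next
      case (Suc n)
      have "(indicator (\<Union>i<Suc n. F i) :: real^'n \<Rightarrow> real) = (\<lambda>y. 1 * indicator (\<Union>i<n. F i) y + 1 * indicator (F n) y)"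
      proof
        fix y
        have "\<not> (y \<in> (\<Union>i<n. F i) \<and> y \<in> F n)" 
        proof
          assume "y \<in> (\<Union>i<n. F i) \<and> y \<in> F n"
          then obtain i where "i < n" "y \<in> F i" "y \<in> F n" by blast
          then show False using union(1) unfolding disjoint_family_on_def by (metis IntI UNIV_I emptyE less_irrefl)
        qed
        then show "indicator (\<Union>i<Suc n. F i) y = 1 * indicator (\<Union>i<n. F i) y + 1 * (indicator (F n) y :: real)"
          by (auto simp: indicator_def less_Suc_eq)
      qed
      then show ?case using balanced_lin[OF Suc union(3)[of n], of 1 1] by simp
    qed
    show ?case
    proof (rule balanced_limit[OF fin, where B=1])
      fix y
      show "(\<lambda>n. indicator (\<Union>i<n. F i) y :: real) \<longlonglongrightarrow> indicator (\<Union>(range F)) y"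
      proof (cases "y \<in> \<Union>(range F)")
        case True
        then obtain j where "y \<in> F j" by blast
        then have "eventually (\<lambda>n. indicator (\<Union>i<n. F i) y = (1::real)) sequentially"
          by (intro eventually_sequentiallyI[of "Suc j"] indicator_simps(1)) auto
        then show ?thesis using True by (simp add: tendsto_eventually)
      next
        case False
        then have "indicator (\<Union>i<n. F i) y = (0::real)" for n by (intro indicator_simps(2)) auto
        then show ?thesis using False by simp
      qed
    qed (auto simp: indicator_def)
  qed
qed

lemma balanced_nonneg:
  assumes g: "g \<in> borel_measurable borel" "\<And>y. 0 \<le> g y" and B: "\<And>y. g y \<le> B"
  shows "balanced g"
proof -
  \<comment> \<open>The bound is quantified inside the induction because the building blocks of g
    satisfy bounds of their own.\<close>
  have "\<forall>B. (\<forall>y. g y \<le> B) \<longrightarrow> balanced g"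
    using g
  proof (induction rule: borel_measurable_induct_real)
    case (set A) then show ?case by (auto intro: balanced_indicator)
  next
    case (mult u c)
    show ?case
    proof (intro allI impI)
      fix B assume B: "\<forall>y. c * u y \<le> B"
      show "balanced (\<lambda>y. c * u y)"
      \<comment> \<open>For c = 0 the bound on \<open>c * u\<close> says nothing about u, but the
        product is the zero function.\<close>
      proof (cases "c = 0")
        case True then show ?thesis using balanced_lin[OF balanced_one balanced_one, of 0 0] by simp
      next
        case False
        then have "\<forall>y. u y \<le> B / c" using B mult(1) by (auto simp: field_simps)
        then have "balanced u" using mult by blast
        then show ?thesis using balanced_lin[of u u c 0] by simp
      qed
    qed
  next
    case (add u v)
    show ?case
    proof (intro allI impI)
      fix B assume B: "\<forall>y. v y + u y \<le> B"
      have "0 \<le> u y" "0 \<le> v y" for y using add.hyps by blast+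
      moreover have "v y + u y \<le> B" for y using B by blast
      note uv = this calculation
      have "v y \<le> B" "u y \<le> B" for y using uv(1)[of y] uv(2)[of y] uv(3)[of y] by linarith+
      then have "balanced v" "balanced u" using add by blast+
      then show "balanced (\<lambda>y. v y + u y)" using balanced_lin[of v u 1 1] by simp
    qed
  next
    case (seq U)
    show ?case
    proof (intro allI impI)
      fix B assume B: "\<forall>y. g y \<le> B"
      have U: "incseq U" "\<And>y. (\<lambda>i. U i y) \<longlonglongrightarrow> g y" "\<And>i y. 0 \<le> U i y"
        "\<And>i. \<forall>B. (\<forall>y. U i y \<le> B) \<longrightarrow> balanced (U i)"
        using seq by simp_all
      have le: "U i y \<le> g y" for i y
        by (rule incseq_le[OF _ U(2)]) (use U(1) in \<open>auto simp: incseq_def le_fun_def\<close>)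
      then have "\<forall>y. U i y \<le> B" for i using B order_trans by blast
      then have bU: "balanced (U i)" for i using U(4) by blast
      show "balanced g"
      proof (rule balanced_limit[OF bU])
        show "\<bar>U i y\<bar> \<le> B" for i y using \<open>\<And>i. \<forall>y. U i y \<le> B\<close> U(3) by simp
        show "(\<lambda>i. U i y) \<longlonglongrightarrow> g y" for y by (rule U(2))
      qed
    qed
  qed
  then show ?thesis using B by blast
qed

lemma balanced_borel:
  assumes g: "g \<in> borel_measurable borel" and B: "\<And>y. \<bar>g y\<bar> \<le> B"
  shows "balanced g"
proof -
  have "balanced (\<lambda>y. max 0 (g y))" "balanced (\<lambda>y. max 0 (- g y))"
    using g B order.trans[OF abs_ge_zero B] by (auto intro!: balanced_nonneg[where B=B] simp: abs_le_iff)
  from balanced_lin[OF this, of 1 "-1"]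
  have "balanced (\<lambda>y. 1 * max 0 (g y) + (-1) * max 0 (- g y))" .
  moreover have "(\<lambda>y. 1 * max 0 (g y) + (-1) * max 0 (- g y)) = g" by (auto simp: fun_eq_iff max_def)
  ultimately show ?thesis by simp
qed

text \<open>The identity bounds increments by \<open>t - s\<close> times a bound for the integral of
  g(V) K, so the function is even Lipschitz in t.\<close>

lemma balanced_continuous:
  assumes g: "g \<in> borel_measurable borel" and B: "\<And>y. \<bar>g y\<bar> \<le> B"
  shows "continuous_on {0..T} (\<lambda>t. \<integral>x. g (V t x) * P t x \<partial>lebesgue)"
proof -
  have B0: "0 \<le> B" using order.trans[OF abs_ge_zero B] .
  obtain C where C0: "0 \<le> C" and C: "AE t in lebesgue. t \<in> {0<..<T} \<longrightarrow> integrable lebesgue (K t) \<and> (AE x in lebesgue. \<bar>K t x\<bar> \<le> C * indicator (cball 0 R) x)"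
    using K_bound by blast
  let ?vol = "measure lebesgue (cball (0::real^'n) R)"
  let ?F = "\<lambda>t. \<integral>x. g (V t x) * P t x \<partial>lebesgue"
  have inner: "AE r in lebesgue. r \<in> {0<..<T} \<longrightarrow> \<bar>\<integral>x. g (V r x) * K r x \<partial>lebesgue\<bar> \<le> B * C * ?vol"
    using C by (rule eventually_mono) (blast intro: gK_bound(2)[OF g B])
  have lip: "\<bar>?F t - ?F s\<bar> \<le> (B * C * ?vol) * (t - s)" if st: "0 \<le> s" "s \<le> t" "t \<le> T" for s t
  proof -
    let ?G = "\<lambda>r. indicator {s<..<t} r * (\<integral>x. g (V r x) * K r x \<partial>lebesgue) :: real"
    have iG: "integrable lebesgue ?G" and eq: "?F t - ?F s = integral\<^sup>L lebesgue ?G"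
      using balanced_borel[OF g B] st unfolding balanced_def by blast+
    have "\<bar>integral\<^sup>L lebesgue ?G\<bar> \<le> (\<integral>r. \<bar>?G r\<bar> \<partial>lebesgue)" by (rule integral_abs_bound)
    also have "\<dots> \<le> (\<integral>r. (B * C * ?vol) * indicator {s<..<t} r \<partial>lebesgue)"
    proof (rule integral_mono_AE)
      show "integrable lebesgue (\<lambda>r. (B * C * ?vol) * indicator {s<..<t} r :: real)"
        using st by (intro integrable_mult_right integrable_real_indicator) auto
      show "AE r in lebesgue. \<bar>?G r\<bar> \<le> (B * C * ?vol) * indicator {s<..<t} r"
        using inner by (rule eventually_mono) (use st in \<open>auto simp: indicator_def\<close>)
    qed (use iG in simp)
    also have "\<dots> = (B * C * ?vol) * (t - s)" using st by simp
    finally show ?thesis unfolding eq .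
  qed
  have "(B * C * ?vol)-lipschitz_on {0..T} ?F"
  proof (rule lipschitz_onI)
    fix s t assume "s \<in> {0..T}" "t \<in> {0..T}"
    then show "dist (?F s) (?F t) \<le> (B * C * ?vol) * dist s t"
      using lip[of s t] lip[of t s] by (cases "s \<le> t") (auto simp: dist_real_def abs_minus_commute)
  qed (use B0 C0 in simp)
  then show ?thesis by (rule lipschitz_on_continuous_on)
qed

end

section \<open>Null sets under the flow, and independence of the choice of flow\<close>

section \<open>Uniqueness\<close>

definition cut :: "real \<Rightarrow> 'a::real_normed_vector \<Rightarrow> real" where
  "cut R x = max 0 (1 - max 0 (norm x - (R - 1)))"

lemma Lip_cut: "Lip (cut R)"
  unfolding cut_def[abs_def] by (intro Lip_max Lip_const Lip_diff Lip_norm)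

lemma cut_outside: "R \<le> norm x \<Longrightarrow> cut R x = 0"
  by (simp add: cut_def)

lemma cut_inside: "norm x \<le> R - 1 \<Longrightarrow> cut R x = 1"
  by (simp add: cut_def)

lemma cut_nonneg: "0 \<le> cut R x"
  by (simp add: cut_def)

lemma grad_cut_inside: "norm x < R - 1 \<Longrightarrow> grad (cut R) x = 0"
proof -
  assume x: "norm x < R - 1"
  have U: "open (ball (0::real^'a) (R - 1))" "x \<in> ball 0 (R - 1)" using x by auto
  have "(1::real) = cut R y" if "y \<in> ball 0 (R - 1)" for y :: "real^'a" using that by (simp add: cut_inside)
  from grad_transform(2)[OF U this grad_const(1)] show ?thesis by (simp add: grad_const)
qed

lemma transport_test_cut:
  assumes "0 < T" "Linf_field T a" "transport_flow T a X"
  shows "transport_test T a X (\<lambda>t. cut R) (\<lambda>t x. 0) R"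
  by unfold_locales (use assms in \<open>auto intro: Lip2_space Lip_cut cut_outside\<close>)

lemma vanish_of_integral:
  fixes W J :: "'a::euclidean_space \<Rightarrow> real"
  assumes W: "\<And>x. 0 \<le> W x" "\<And>x. W x \<noteq> 0 \<Longrightarrow> norm x < R - 1" and J: "AE x in lebesgue. 0 \<le> J x"
    and i: "integrable lebesgue (\<lambda>x. W x * (cut R x * J x))" and z: "(\<integral>x. W x * (cut R x * J x) \<partial>lebesgue) = 0"
  shows "AE x in lebesgue. W x * J x = 0"
proof -
  have "AE x in lebesgue. 0 \<le> W x * (cut R x * J x)"
    using J by (rule eventually_mono) (auto intro!: mult_nonneg_nonneg W cut_nonneg)
  then have "AE x in lebesgue. W x * (cut R x * J x) = 0"
    using integral_nonneg_eq_0_iff_AE[OF i] z by blast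
  then show ?thesis
  proof (rule eventually_mono)
    fix x assume *: "W x * (cut R x * J x) = 0"
    show "W x * J x = 0"
    proof (cases "W x = 0")
      case False
      then have "cut R x = 1" using W(2)[of x] by (intro cut_inside) simp
      then show ?thesis using * by simp
    qed simp
  qed
qed

context
  fixes T :: real and a :: "real \<Rightarrow> real^'n \<Rightarrow> real^'n" and X :: "real \<Rightarrow> real^'n \<Rightarrow> real^'n"
  assumes T: "0 < T" and a: "Linf_field T a" and flow: "transport_flow T a X"
begin

lemma flow_map_final: "flow_map T X T x = x"
  using flow_comp_final[OF T flow] by (simp add: vec_eq_iff flow_map_nth)

text \<open>With g the indicator of a bounded part of Z, the integral of g(V) J against the cutoff
  is constant in time, since the cutoff is 1 near the support of g(V). At time T it is an integral
  over a null set, and J is nonnegative.\<close>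

lemma flow_null:
  assumes Z: "Z \<in> null_sets lborel" and t: "t \<in> {0..T}"
  shows "AE x in lebesgue. flow_map T X t x \<in> Z \<longrightarrow> jac (flow_comp T X t) x = 0"
proof -
  obtain D where D: "0 \<le> D" "\<And>t x. norm (flow_map T X t x - x) \<le> D"
    using finite_speed[OF T flow] unfolding flow_map_def by metis
  have "AE x in lebesgue. flow_map T X t x \<in> Z \<inter> cball 0 (real m) \<longrightarrow> jac (flow_comp T X t) x = 0" for m
  proof -
    \<comment> \<open>Points mapped into the ball of radius m have norm at most
      \<open>m + D\<close>, which is \<open>R - 2\<close>: the cutoff is 1 and its gradient vanishes
      there.\<close>
    define R where "R = real m + D + 2"
    interpret transport_test T a X "\<lambda>t. cut R" "\<lambda>t x. 0" R by (rule transport_test_cut[OF T a flow])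
    let ?g = "indicator (Z \<inter> cball 0 (real m)) :: real^'n \<Rightarrow> real"
    have gm: "?g \<in> borel_measurable borel" using Z by (intro borel_measurable_indicator) auto
    have gB: "\<bar>?g y\<bar> \<le> 1" for y by (simp add: indicator_def)
    have near: "norm x < R - 1" if "?g (flow_map T X r x) \<noteq> 0" for r x
    proof -
      have "norm (flow_map T X r x) \<le> real m" using that by (auto simp: indicator_def split: if_splits)
      moreover have "norm x \<le> norm (flow_map T X r x) + norm (flow_map T X r x - x)"
        by (metis norm_triangle_sub norm_minus_commute add.commute)
      ultimately show ?thesis using D(2)[of r x] by (simp add: R_def)
    qed
    have gK: "?g (flow_map T X r x) * K r x = 0" for r x
      using near[of r x] by (cases "?g (flow_map T X r x) = 0") (auto simp: K_def grad_cut_inside)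
    have "(\<integral>x. ?g (flow_map T X T x) * P T x \<partial>lebesgue) - (\<integral>x. ?g (flow_map T X t x) * P t x \<partial>lebesgue) = 0"
      using balanced_borel[OF gm gB] t unfolding balanced_def gK by auto
    moreover have "(\<integral>x. ?g (flow_map T X T x) * P T x \<partial>lebesgue) = 0"
    proof -
      have "Z \<inter> cball 0 (real m) \<in> null_sets lebesgue"
        using Z by (intro null_sets_completionI null_set_Int2) auto
      then have "AE x in lebesgue. x \<notin> Z \<inter> cball 0 (real m)" by (rule AE_not_in)
      then have "AE x in lebesgue. ?g (flow_map T X T x) * P T x = 0"
        by (rule eventually_mono) (simp add: flow_map_final)
      then show ?thesis by (rule integral_eq_zero_AE)
    qed
    ultimately have z: "(\<integral>x. ?g (flow_map T X t x) * (cut R x * jac (flow_comp T X t) x) \<partial>lebesgue) = 0"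
      unfolding P_def by simp
    have "AE x in lebesgue. ?g (flow_map T X t x) * jac (flow_comp T X t) x = 0"
      by (rule vanish_of_integral[OF _ near flow_comp_jac_nonneg[OF T flow t] _ z])
         (use gP_integrable[OF gm gB, of t] in \<open>auto simp: P_def\<close>)
    then show ?thesis by (rule eventually_mono) auto
  qed
  then have "AE x in lebesgue. \<forall>m. flow_map T X t x \<in> Z \<inter> cball 0 (real m) \<longrightarrow> jac (flow_comp T X t) x = 0"
    unfolding AE_all_countable by blast
  then show ?thesis
  proof (rule eventually_mono, intro impI)
    fix x assume *: "\<forall>m. flow_map T X t x \<in> Z \<inter> cball 0 (real m) \<longrightarrow> jac (flow_comp T X t) x = 0" and "flow_map T X t x \<in> Z"
    moreover obtain m where "norm (flow_map T X t x) \<le> real m" using real_arch_simple by blast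
    ultimately show "jac (flow_comp T X t) x = 0" by auto
  qed
qed

text \<open>Only the Jacobian of X enters, so the conclusion concerns the set where that one is
  nonzero; exchanging the flows gives the other half. The components are compared one at a
  time.\<close>

lemma flow_agree:
  assumes flow': "transport_flow T a X'" and t: "t \<in> {0..T}"
  shows "AE x in lebesgue. jac (flow_comp T X t) x \<noteq> 0 \<longrightarrow> flow_comp T X t k x = flow_comp T X' t k x"
proof -
  let ?Y = "flow_comp T X" and ?Z = "flow_comp T X'"
  obtain D where D: "0 \<le> D" "\<And>t x. norm (flow_map T X t x - x) \<le> D"
    using finite_speed[OF T flow] unfolding flow_map_def by metis
  obtain E where E: "0 \<le> E" "\<And>t x. norm (flow_map T X' t x - x) \<le> E"
    using finite_speed[OF T flow'] unfolding flow_map_def by metis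
  define d where "d t x = ?Y t k x - ?Z t k x" for t x
  \<comment> \<open>Both flows stay near the identity, so their difference is bounded although
    neither is; its square is then Lipschitz.\<close>
  have dB: "\<bar>d t x\<bar> \<le> D + E" for t x
  proof -
    have "\<bar>?Y t k x - x $ k\<bar> \<le> D" "\<bar>?Z t k x - x $ k\<bar> \<le> E"
      using order.trans[OF component_le_norm_cart[of "flow_map T X t x - x" k] D(2)]
        order.trans[OF component_le_norm_cart[of "flow_map T X' t x - x" k] E(2)] by (auto simp: flow_map_nth)
    then show ?thesis unfolding d_def by linarith
  qed
  have dL: "Lip2 d" unfolding d_def Lip2_def
    using Lip_diff flow_comp_Lip2[OF T flow, of k] flow_comp_Lip2[OF T flow', of k] unfolding Lip2_def by blast
  have dS: "solves T a d" unfolding d_def by (rule solves_diff[OF flow_comp_solves[OF T flow] flow_comp_solves[OF T flow']])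
  have "AE x in lebesgue. (\<forall>i. \<bar>?Y t i x\<bar> < real m) \<longrightarrow> jac (?Y t) x \<noteq> 0 \<longrightarrow> ?Y t k x = ?Z t k x" for m
  proof -
    \<comment> \<open>On the support of the bump every component is at most m in size, so the
      Euclidean norm of the image is at most N m; D and 2 are as for null sets.\<close>
    define R where "R = real CARD('n) * real m + D + 2"
    interpret transport_test T a X "\<lambda>t. cut R" "\<lambda>t x. 0" R by (rule transport_test_cut[OF T a flow])
    define b where "b t x = (\<Prod>i\<in>UNIV. bump 1 (- real m) (real m) (?Y t i x))" for t x
    define w where "w t x = b t x * (d t x * d t x)" for t x
    have b01: "0 \<le> b t x" "b t x \<le> 1" for t x
      unfolding b_def using bump_bounds by (auto intro!: prod_nonneg prod_le_1)
    have bB: "\<bar>b t x\<bar> \<le> 1" for t x using b01[of t x] by simp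
    have bL: "Lip2 b" unfolding b_def
      by (rule Lip2_prod) (use bump_bounds in \<open>auto intro: Lip2_compose Lip_bump flow_comp_Lip2[OF T flow]\<close>)
    have bS: "solves T a b" unfolding b_def
      by (rule solves_prod) (auto intro: solves_compose[OF flow_comp_solves[OF T flow] bump_DERIV])
    have ddB: "\<bar>d t x * d t x\<bar> \<le> (D + E) * (D + E)" for t x
      unfolding abs_mult using dB D(1) E(1) by (intro mult_mono) auto
    have wB: "\<bar>w t x\<bar> \<le> 1 * ((D + E) * (D + E))" for t x
      unfolding w_def abs_mult[of "b t x"] using bB ddB by (intro mult_mono) auto
    have wL: "Lip2 w" unfolding w_def by (rule Lip2_mult[OF bL bB Lip2_mult[OF dL dB dL dB] ddB])
    have wS: "solves T a w" unfolding w_def by (intro solves_mult bS dS)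
    have near: "norm x < R - 1" if "w r x \<noteq> 0" for r x
    proof -
      have "b r x \<noteq> 0" using that by (auto simp: w_def)
      then have "\<forall>i. bump 1 (- real m) (real m) (?Y r i x) \<noteq> 0" by (simp add: b_def)
      then have "?Y r i x \<in> {- real m<..<real m}" for i using bump_outside by blast
      then have "\<bar>flow_map T X r x $ i\<bar> \<le> real m" for i by (auto simp: flow_map_nth abs_le_iff less_imp_le minus_le_iff)
      then have "(\<Sum>i\<in>UNIV. \<bar>flow_map T X r x $ i\<bar>) \<le> (\<Sum>i\<in>(UNIV::'n set). real m)" by (intro sum_mono)
      then have "norm (flow_map T X r x) \<le> real CARD('n) * real m" using norm_le_l1_cart[of "flow_map T X r x"] by simp
      moreover have "norm x \<le> norm (flow_map T X r x) + norm (flow_map T X r x - x)"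
        by (metis norm_triangle_sub norm_minus_commute add.commute)
      ultimately show ?thesis using D(2)[of r x] by (simp add: R_def)
    qed
    have wK: "w r x * ((0 + a r x \<bullet> grad (cut R) x) * jac (?Y r) x) = 0" for r x
      using near[of r x] by (cases "w r x = 0") (auto simp: grad_cut_inside)
    have "(\<integral>x. w T x * (cut R x * jac (?Y T) x) \<partial>lebesgue) - (\<integral>x. w t x * (cut R x * jac (?Y t) x) \<partial>lebesgue)
      = (\<integral>r. indicator {t<..<T} r * (\<integral>x. w r x * ((0 + a r x \<bullet> grad (cut R) x) * jac (?Y r) x) \<partial>lebesgue) \<partial>lebesgue)"
      by (rule transport_identity(3)[OF flow_comp_Lip2[OF T flow] flow_comp_solves[OF T flow] p pt wL wB wS]) (use t in auto)
    \<comment> \<open>Both flows are the identity at time T.\<close>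
    moreover have "w T x = 0" for x by (simp add: w_def d_def flow_comp_final[OF T flow] flow_comp_final[OF T flow'])
    ultimately have z: "(\<integral>x. w t x * (cut R x * jac (?Y t) x) \<partial>lebesgue) = 0" unfolding wK by simp
    have i: "integrable lebesgue (\<lambda>x. w t x * (cut R x * jac (?Y t) x))"
      using integrable_mult_bounded[OF P_integrable[of t] Lip_measurable[OF Lip2_Lip[OF wL, of t]], of "1 * ((D + E) * (D + E))"] wB
      by (simp add: P_def mult.commute)
    have w0: "0 \<le> w t x" for x using b01[of t x] by (simp add: w_def)
    have "AE x in lebesgue. w t x * jac (?Y t) x = 0"
      by (rule vanish_of_integral[OF w0 near flow_comp_jac_nonneg[OF T flow t] i z])
    then show ?thesis
    proof (rule eventually_mono, intro impI)
      fix x assume "w t x * jac (?Y t) x = 0" "\<forall>i. \<bar>?Y t i x\<bar> < real m" "jac (?Y t) x \<noteq> 0"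
      then have "w t x = 0" "\<And>i. bump 1 (- real m) (real m) (?Y t i x) > 0"
        by (auto intro!: bump_positive simp: abs_less_iff minus_less_iff)
      then have "d t x = 0" by (auto simp: w_def b_def less_imp_neq[THEN not_sym] dest!: prod_zero_iff[THEN iffD1, rotated])
      then show "?Y t k x = ?Z t k x" by (simp add: d_def)
    qed
  qed
  then have "AE x in lebesgue. \<forall>m. (\<forall>i. \<bar>?Y t i x\<bar> < real m) \<longrightarrow> jac (?Y t) x \<noteq> 0 \<longrightarrow> ?Y t k x = ?Z t k x"
    unfolding AE_all_countable by blast
  then show ?thesis
  proof (rule eventually_mono)
    fix x assume *: "\<forall>m. (\<forall>i. \<bar>?Y t i x\<bar> < real m) \<longrightarrow> jac (?Y t) x \<noteq> 0 \<longrightarrow> ?Y t k x = ?Z t k x"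
    obtain m where "norm (flow_map T X t x) < real m" using reals_Archimedean2 by blast
    then have "\<forall>i. \<bar>?Y t i x\<bar> < real m" using component_le_norm_cart[of "flow_map T X t x"] by (auto simp: flow_map_nth intro: le_less_trans)
    then show "jac (?Y t) x \<noteq> 0 \<longrightarrow> ?Y t k x = ?Z t k x" using * by blast
  qed
qed

end

text \<open>Where either Jacobian is nonzero the flows agree. There the gradients agree as well,
  because \<open>|Y - Z|\<close> has partial derivatives at almost every point, so the two Jacobians
  are equal.\<close>

lemma flow_unique:
  fixes a :: "real \<Rightarrow> real^'n \<Rightarrow> real^'n"
  assumes T: "0 < T" and a: "Linf_field T a" and flow: "transport_flow T a X" "transport_flow T a X'" and t: "t \<in> {0..T}"
  shows "AE x in lebesgue. (Jac X t x = 0 \<and> Jac X' t x = 0) \<or> (X t x = X' t x \<and> Jac X t x = Jac X' t x)"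
proof -
  let ?Y = "flow_comp T X" and ?Z = "flow_comp T X'"
  have L: "Lip (?Y t i)" "Lip (?Z t i)" for i
    using Lip2_Lip[OF flow_comp_Lip2[OF T flow(1)]] Lip2_Lip[OF flow_comp_Lip2[OF T flow(2)]] by auto
  have ag: "AE x in lebesgue. \<forall>k. jac (?Y t) x \<noteq> 0 \<longrightarrow> ?Y t k x = ?Z t k x"
    by (intro eventually_all_finite flow_agree[OF T a flow t])
  have ag': "AE x in lebesgue. \<forall>k. jac (?Z t) x \<noteq> 0 \<longrightarrow> ?Z t k x = ?Y t k x"
    by (intro eventually_all_finite flow_agree[OF T a flow(2,1) t])
  have pa: "AE x in lebesgue. \<forall>k. pd (\<lambda>x. \<bar>?Y t k x - ?Z t k x\<bar>) x"
    by (intro AE_pd_all Lip_abs Lip_diff L)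
  from ag ag' pa flow_comp_AE_pd[OF T flow(1), of t] flow_comp_AE_pd[OF T flow(2), of t]
  show ?thesis
  proof eventually_elim
    case (elim x)
    have J: "Jac X t x = jac (?Y t) x" "Jac X' t x = jac (?Z t) x" using Jac_eq_jac[OF t] elim by auto
    have same: "jac (?Y t) x = jac (?Z t) x" "X t x = X' t x" if e: "\<And>k. ?Y t k x = ?Z t k x"
    proof -
      have "grad (?Y t k) x = grad (?Z t k) x" for k
      proof -
        have pdk: "pd (?Y t k) x" "pd (?Z t k) x" using elim by auto
        have "grad (\<lambda>x. ?Y t k x - ?Z t k x) x = 0"
          by (rule grad_zero_on_zero_set(1)[OF grad_diff(1)[OF pdk]]) (use elim e in auto)
        then show ?thesis using grad_diff(2)[OF pdk] by simp
      qed
      then show "jac (?Y t) x = jac (?Z t) x" by (simp add: jac_def)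
      show "X t x = X' t x" using e flow_comp_eq[OF t, of X] flow_comp_eq[OF t, of X'] by (simp add: vec_eq_iff)
    qed
    show ?case
    proof (cases "jac (?Y t) x = 0 \<and> jac (?Z t) x = 0")
      case False
      then have "?Y t k x = ?Z t k x" for k using elim(1,2) by metis
      then show ?thesis using same J by auto
    qed (simp add: J)
  qed
qed

text \<open>Makes q(X) J independent of the representative of q: the exceptional set lies in a Borel
  null set, on whose preimage the Jacobian vanishes.\<close>

lemma AE_flow_composition:
  fixes a :: "real \<Rightarrow> real^'n \<Rightarrow> real^'n"
  assumes T: "0 < T" and a: "Linf_field T a" and flow: "transport_flow T a X" and t: "t \<in> {0..T}"
    and Q: "AE y in lebesgue. Q y"
  shows "AE x in lebesgue. Q (X t x) \<or> Jac X t x = 0"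
proof -
  have "AE y in lborel. Q y" using Q by (simp add: AE_completion_iff)
  then obtain Z where Z: "Z \<in> null_sets lborel" "{y. \<not> Q y} \<subseteq> Z" by (auto simp: eventually_ae_filter)
  from flow_null[OF T a flow Z(1) t] flow_comp_AE_pd[OF T flow, of t] show ?thesis
  proof eventually_elim
    case (elim x)
    have "flow_map T X t x = X t x" using t by (simp add: flow_map_def)
    then show ?case using elim(1) Z(2) Jac_eq_jac[OF t elim(2)] by auto
  qed
qed

section \<open>Existence of the reversible solution, and the formula for every reversible
  solution\<close>

section \<open>Existence\<close>

text \<open>q is Lebesgue measurable and only locally bounded, whereas the transport results take
  bounded Borel functions. On the ball of radius R the flow sees q only within R + D, where q equals
  a bounded Borel function almost everywhere.\<close>

lemma bounded_representative:
  fixes a :: "real \<Rightarrow> real^'n \<Rightarrow> real^'n" and q :: "real^'n \<Rightarrow> real"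
  assumes T: "0 < T" and a: "Linf_field T a" and flow: "transport_flow T a X" and q: "Linf_loc q"
  obtains g B where "g \<in> borel_measurable borel" "\<And>y. \<bar>g y\<bar> \<le> B"
    "\<And>t. t \<in> {0..T} \<Longrightarrow> AE x in lebesgue. norm x \<le> R \<longrightarrow> q (X t x) * Jac X t x = g (flow_map T X t x) * jac (flow_comp T X t) x"
proof -
  obtain D where D: "0 \<le> D" "\<And>t x. norm (flow_map T X t x - x) \<le> D"
    using finite_speed[OF T flow] unfolding flow_map_def by metis
  obtain C where C: "AE y in lebesgue. y \<in> cball 0 (R + D) \<longrightarrow> \<bar>q y\<bar> \<le> C"
    using q compact_cball unfolding Linf_loc_def by blast
  obtain g0 where g0: "g0 \<in> borel_measurable lborel" "AE y in lborel. q y = g0 y"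
    using completion_ex_borel_measurable_real[of q lborel] q unfolding Linf_loc_def by blast
  define g where "g y = max (- \<bar>C\<bar>) (min \<bar>C\<bar> (g0 y))" for y
  have Q: "AE y in lebesgue. y \<in> cball 0 (R + D) \<longrightarrow> q y = g y"
    using C AE_completion[OF g0(2)] by eventually_elim (auto simp: g_def)
  show ?thesis
  proof (rule that[of g "\<bar>C\<bar>"])
    show "g \<in> borel_measurable borel" using g0(1) unfolding g_def[abs_def] by simp
    show "\<bar>g y\<bar> \<le> \<bar>C\<bar>" for y by (auto simp: g_def)
    fix t assume t: "t \<in> {0..T}"
    from AE_flow_composition[OF T a flow t Q] flow_comp_AE_pd[OF T flow, of t]
    show "AE x in lebesgue. norm x \<le> R \<longrightarrow> q (X t x) * Jac X t x = g (flow_map T X t x) * jac (flow_comp T X t) x"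
    proof eventually_elim
      case (elim x)
      have V: "flow_map T X t x = X t x" using t by (simp add: flow_map_def)
      have J: "Jac X t x = jac (flow_comp T X t) x" by (rule Jac_eq_jac[OF t elim(2)])
      show ?case
      proof
        assume "norm x \<le> R"
        then have "X t x \<in> cball 0 (R + D)" using D(2)[of t x] norm_triangle_sub[of "X t x" x] V by simp
        then show "q (X t x) * Jac X t x = g (flow_map T X t x) * jac (flow_comp T X t) x"
          using elim(1) by (auto simp: V J)
      qed
    qed
  qed
qed

lemma smooth_dd:
  fixes f :: "'a::euclidean_space \<Rightarrow> real"
  assumes "smooth f" "v \<in> Basis"
  shows "continuous_on UNIV (dd v f)" "diffable_along v f x"
proof -
  have "continuous_on UNIV (iter_dd [v] f)" using assms unfolding smooth_def by (metis empty_set empty_subsetI insert_subset list.simps(15))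
  then show "continuous_on UNIV (dd v f)" by simp
  show "diffable_along v f x" using assms(1)[unfolded smooth_def, rule_format, of "[]"] assms(2) by auto
qed

text \<open>Two points are joined by a path along coordinate directions, and the mean value bound
  applies on each piece.\<close>

lemma bounded_partials_imp_Lip:
  fixes f :: "'a::euclidean_space \<Rightarrow> real"
  assumes d: "\<And>v x. v \<in> Basis \<Longrightarrow> diffable_along v f x" and M: "\<And>v x. v \<in> Basis \<Longrightarrow> \<bar>dd v f x\<bar> \<le> M"
  shows "Lip f"
proof -
  have M0: "0 \<le> M" using order.trans[OF abs_ge_zero M] nonempty_Basis by blast
  have step: "\<bar>f (x + c *\<^sub>R v) - f x\<bar> \<le> M * \<bar>c\<bar>" if v: "v \<in> Basis" for x c v
  proof -
    let ?g = "\<lambda>s. f (x + s *\<^sub>R v)"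
    have D: "(?g has_real_derivative dd v f (x + s *\<^sub>R v)) (at s)" for s
    proof -
      have "((\<lambda>r. f ((x + s *\<^sub>R v) + r *\<^sub>R v)) has_real_derivative dd v f (x + s *\<^sub>R v)) (at 0)"
        using dd_works[where f=f and v=v and x="x + s *\<^sub>R v", OF d[OF v]] by (simp add: has_real_derivative_iff_has_vector_derivative)
      then have "((\<lambda>r. ?g (r + s)) has_real_derivative dd v f (x + s *\<^sub>R v)) (at 0)"
        by (simp add: algebra_simps)
      then show ?thesis using DERIV_at_within_shift[of ?g _ s 0 UNIV] by (simp add: add.commute)
    qed
    have "norm (?g c - ?g 0) \<le> M * norm (c - 0)"
      by (rule field_differentiable_bound[of UNIV ?g "\<lambda>s. dd v f (x + s *\<^sub>R v)"]) (use D M v in auto)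
    then show ?thesis by simp
  qed
  have path: "\<bar>f (x + (\<Sum>v\<in>S. c v *\<^sub>R v)) - f x\<bar> \<le> M * (\<Sum>v\<in>S. \<bar>c v\<bar>)" if "finite S" "S \<subseteq> Basis" for S x c
    using that
  proof (induction S)
    case (insert v S)
    have "\<bar>f ((x + (\<Sum>v\<in>S. c v *\<^sub>R v)) + c v *\<^sub>R v) - f (x + (\<Sum>v\<in>S. c v *\<^sub>R v))\<bar> \<le> M * \<bar>c v\<bar>"
      using insert by (intro step) auto
    moreover have "x + (\<Sum>v\<in>insert v S. c v *\<^sub>R v) = (x + (\<Sum>v\<in>S. c v *\<^sub>R v)) + c v *\<^sub>R v"
      using insert by (simp add: ac_simps)
    ultimately show ?case using insert by (simp add: algebra_simps)
  qed simp
  show ?thesis unfolding Lip_def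
  proof (intro exI lipschitz_onI)
    fix x y :: 'a
    have "f x = f (y + (\<Sum>v\<in>Basis. ((x - y) \<bullet> v) *\<^sub>R v))" by (simp add: euclidean_representation)
    then have "\<bar>f x - f y\<bar> \<le> M * (\<Sum>v\<in>Basis. \<bar>(x - y) \<bullet> v\<bar>)" using path[OF finite_Basis, of y "\<lambda>v. (x - y) \<bullet> v"] by simp
    also have "\<dots> \<le> M * (\<Sum>v\<in>(Basis :: 'a set). norm (x - y))"
      using M0 by (intro mult_left_mono sum_mono) (auto intro: Basis_le_norm)
    finally show "dist (f x) (f y) \<le> (M * real DIM('a)) * dist x y" by (simp add: dist_norm mult_ac)
  qed (use M0 in simp)
qed

lemma dd_zero_off_closed:
  fixes f :: "'a::real_normed_vector \<Rightarrow> real"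
  assumes "closed S" "\<And>z. z \<notin> S \<Longrightarrow> f z = 0" "x \<notin> S"
  shows "dd v f x = 0"
proof (rule dd_eqI)
  have c: "open ((\<lambda>s. x + s *\<^sub>R v) -` (- S))"
    using assms(1) by (intro open_vimage continuous_intros) auto
  show "((\<lambda>s. f (x + s *\<^sub>R v)) has_vector_derivative 0) (at 0)"
    by (rule has_vector_derivative_transform_within_open[OF has_vector_derivative_const c]) (use assms in auto)
qed

text \<open>Extracts what \<open>transport_test\<close> asks of a weight, together with the
  vanishing at times 0 and T that removes the boundary terms.\<close>

lemma test_fn_properties:
  fixes f :: "real \<times> (real^'n) \<Rightarrow> real"
  assumes f: "test_fn T f"
  obtains R where "Lip2 (\<lambda>t x. f (t, x))" "\<And>t x. R \<le> norm x \<Longrightarrow> f (t, x) = 0"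
    "\<And>t x. t \<notin> {0<..<T} \<Longrightarrow> f (t, x) = 0"
    "\<And>t x v. t \<notin> {0<..<T} \<or> R \<le> norm x \<Longrightarrow> dd v f (t, x) = 0"
    "\<And>t x. ((\<lambda>s. f (s, x)) has_real_derivative dd (1, 0) f (t, x)) (at t)"
proof -
  obtain S where sm: "smooth f" and S: "compact S" "S \<subseteq> {0<..<T} \<times> UNIV" "\<And>z. z \<notin> S \<Longrightarrow> f z = 0"
    using f unfolding test_fn_def by blast
  obtain r where r: "\<And>z. z \<in> S \<Longrightarrow> norm z \<le> r" using compact_imp_bounded[OF S(1)] unfolding bounded_iff by blast
  define R where "R = \<bar>r\<bar> + 1"
  have out: "(t, x) \<notin> S" if "t \<notin> {0<..<T} \<or> R \<le> norm x" for t and x :: "real^'n"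
  proof
    assume m: "(t, x) \<in> S"
    then have "norm x \<le> r" using r[OF m] norm_snd_le[of x t] by simp
    then show False using that m S(2) by (auto simp: R_def)
  qed
  have cl: "closed S" using S(1) by (rule compact_imp_closed)
  have ddz: "dd v f z = 0" if "z \<notin> S" for v z by (rule dd_zero_off_closed[OF cl S(3) that])
  have "\<exists>M. \<forall>v\<in>Basis. \<forall>z. \<bar>dd v f z\<bar> \<le> M"
  proof -
    have "\<forall>v\<in>Basis. \<exists>M. \<forall>z. \<bar>dd v f z\<bar> \<le> M"
    proof
      fix v :: "real \<times> (real^'n)" assume v: "v \<in> Basis"
      have "compact (dd v f ` S)" by (intro compact_continuous_image continuous_on_subset[OF smooth_dd(1)[OF sm v]] S) auto
      then obtain M where M: "\<And>z. z \<in> S \<Longrightarrow> \<bar>dd v f z\<bar> \<le> M"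
        using compact_imp_bounded[THEN bounded_iff[THEN iffD1]] by fastforce
      have "\<bar>dd v f z\<bar> \<le> \<bar>M\<bar>" for z using M[of z] ddz[of z v] by (cases "z \<in> S") auto
      then show "\<exists>M. \<forall>z. \<bar>dd v f z\<bar> \<le> M" by blast
    qed
    then obtain m where m: "\<And>v z. v \<in> Basis \<Longrightarrow> \<bar>dd v f z\<bar> \<le> m v" by metis
    have "\<bar>dd v f z\<bar> \<le> Max (m ` Basis)" if "v \<in> Basis" for v z
      using m[OF that, of z] that by (meson Max_ge finite_Basis finite_imageI imageI order_trans)
    then show ?thesis by blast
  qed
  then obtain M where M: "\<And>v z. v \<in> Basis \<Longrightarrow> \<bar>dd v f z\<bar> \<le> M" by blast
  have Lf: "Lip f" by (rule bounded_partials_imp_Lip[OF smooth_dd(2)[OF sm] M])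
  show ?thesis
  proof (rule that)
    show "Lip2 (\<lambda>t x. f (t, x))" using Lf by (simp add: Lip2_def)
    show "f (t, x) = 0" if "R \<le> norm x" for t x using out that S(3) by blast
    show "f (t, x) = 0" if "t \<notin> {0<..<T}" for t x using out that S(3) by blast
    show "dd v f (t, x) = 0" if "t \<notin> {0<..<T} \<or> R \<le> norm x" for t x v using ddz out[OF that] by blast
    fix t and x :: "real^'n"
    have b: "(1, 0) \<in> (Basis :: (real \<times> (real^'n)) set)" by (simp add: Basis_prod_def)
    have "((\<lambda>s. f (t + s, x)) has_real_derivative dd (1, 0) f (t, x)) (at 0)"
      using dd_works[where f=f and v="(1, 0)" and x="(t, x)", OF smooth_dd(2)[OF sm b]]
      by (simp add: has_real_derivative_iff_has_vector_derivative)
    then show "((\<lambda>s. f (s, x)) has_real_derivative dd (1, 0) f (t, x)) (at t)"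
      using DERIV_at_within_shift[of "\<lambda>s. f (s, x)" _ t 0 UNIV] by simp
  qed
qed

text \<open>Every property is tested on a bounded set, where u agrees with g(V) J for a bounded
  Borel g; the identities for \<open>balanced\<close> functions then give weak continuity and the
  equation.\<close>

lemma reversible_existence:
  fixes a :: "real \<Rightarrow> real^'n \<Rightarrow> real^'n" and q :: "real^'n \<Rightarrow> real"
  assumes T: "0 < T" and a: "Linf_field T a" and flow: "transport_flow T a X" and q: "Linf_loc q"
  defines "u \<equiv> \<lambda>t x. q (X t x) * Jac X t x"
  shows "reversible T a u" "u T = q"
proof -
  let ?Y = "flow_comp T X" and ?V = "flow_map T X"
  show uT: "u T = q"
    using flow unfolding transport_flow_def by (auto simp: u_def fun_eq_iff Jac_final[OF T flow])
  have rep: "\<exists>g B. g \<in> borel_measurable borel \<and> (\<forall>y. \<bar>g y\<bar> \<le> B) \<and>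
    (\<forall>t\<in>{0..T}. AE x in lebesgue. norm x \<le> R \<longrightarrow> u t x = g (?V t x) * jac (?Y t) x)" for R
  proof -
    obtain g B where "g \<in> borel_measurable borel" "\<And>y. \<bar>g y\<bar> \<le> B"
      "\<And>t. t \<in> {0..T} \<Longrightarrow> AE x in lebesgue. norm x \<le> R \<longrightarrow> q (X t x) * Jac X t x = g (?V t x) * jac (?Y t) x"
      by (rule bounded_representative[OF T a flow q, where R=R]) blast
    then show ?thesis unfolding u_def by (intro exI[of _ g] exI[of _ B]) blast
  qed
  have YL: "Lip (?Y t i)" for t i by (rule Lip2_Lip[OF flow_comp_Lip2[OF T flow]])
  have Vm: "g \<in> borel_measurable borel \<Longrightarrow> (\<lambda>x. g (?V t x)) \<in> borel_measurable lebesgue" for g :: "real^'n \<Rightarrow> real" and t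
    by (rule transport_test.gV_measurable[OF transport_test_cut[OF T a flow]])
  have meas: "u t \<in> borel_measurable lebesgue" if t: "t \<in> {0..T}" for t
  proof -
    \<comment> \<open>The Borel representative depends on the radius, so measurability is obtained
      along an exhaustion by balls.\<close>
    have "\<forall>n. \<exists>g. g \<in> borel_measurable borel \<and>
      (\<forall>t\<in>{0..T}. AE x in lebesgue. norm x \<le> real n \<longrightarrow> u t x = g (?V t x) * jac (?Y t) x)" using rep by blast
    from choice[OF this] obtain g where g: "\<And>n. g n \<in> borel_measurable borel"
      "\<And>n t. t \<in> {0..T} \<Longrightarrow> AE x in lebesgue. norm x \<le> real n \<longrightarrow> u t x = g n (?V t x) * jac (?Y t) x" by blast
    have ae: "AE x in lebesgue. \<forall>n. norm x \<le> real n \<longrightarrow> u t x = g n (?V t x) * jac (?Y t) x"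
      unfolding AE_all_countable using g(2) t by blast
    show ?thesis
    proof (rule borel_measurable_LIMSEQ_AE[where u="\<lambda>n x. g n (?V t x) * jac (?Y t) x"])
      show "(\<lambda>x. g n (?V t x) * jac (?Y t) x) \<in> borel_measurable lebesgue" for n
        by (intro borel_measurable_times Vm g jac_measurable YL)
      show "AE x in lebesgue. (\<lambda>n. g n (?V t x) * jac (?Y t) x) \<longlonglongrightarrow> u t x"
        using ae
      proof (rule eventually_mono)
        fix x assume *: "\<forall>n. norm x \<le> real n \<longrightarrow> u t x = g n (?V t x) * jac (?Y t) x"
        obtain N where N: "norm x \<le> real N" using real_arch_simple by blast
        have "eventually (\<lambda>n. g n (?V t x) * jac (?Y t) x = u t x) sequentially"
          by (rule eventually_sequentiallyI[of N]) (use * N in \<open>metis of_nat_mono order_trans\<close>)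
        then show "(\<lambda>n. g n (?V t x) * jac (?Y t) x) \<longlonglongrightarrow> u t x" by (rule tendsto_eventually)
      qed
    qed
  qed
  have loc: "Linf_loc (u t)" if t: "t \<in> {0..T}" for t
    unfolding Linf_loc_def
  proof (intro conjI allI impI meas[OF t])
    fix S :: "(real^'n) set" assume "compact S"
    then obtain R where R: "\<And>x. x \<in> S \<Longrightarrow> norm x \<le> R" using compact_imp_bounded bounded_iff by metis
    obtain g B where g: "\<And>y. \<bar>g y\<bar> \<le> B" "AE x in lebesgue. norm x \<le> R \<longrightarrow> u t x = g (?V t x) * jac (?Y t) x"
      using rep[of R] t by blast
    obtain L where L: "\<And>i. L-lipschitz_on UNIV (?Y t i)" using Lip_common[of "?Y t", OF YL] by blast
    have "0 \<le> B" using order.trans[OF abs_ge_zero g(1)] .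
    from g(2) jac_bounded[where f="?Y t", OF L] have "AE x in lebesgue. x \<in> S \<longrightarrow> \<bar>u t x\<bar> \<le> B * det_bound TYPE('n) L"
    proof eventually_elim
      case (elim x)
      then show ?case using R[of x] g(1)[of "?V t x"] \<open>0 \<le> B\<close> by (auto simp: abs_mult intro!: mult_mono)
    qed
    then show "\<exists>C. AE x in lebesgue. x \<in> S \<longrightarrow> \<bar>u t x\<bar> \<le> C" by blast
  qed
  have wsc: "weak_star_continuous T u"
    unfolding weak_star_continuous_def
  proof (intro allI impI, elim conjE exE)
    fix f :: "real^'n \<Rightarrow> real" and S :: "(real^'n) set"
    assume f: "integrable lebesgue f" and S: "compact S" "\<forall>x. x \<notin> S \<longrightarrow> f x = 0"
    obtain R where R: "\<And>x. x \<in> S \<Longrightarrow> norm x \<le> R" using compact_imp_bounded[OF S(1)] bounded_iff by metis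
    obtain g B where g: "g \<in> borel_measurable borel" "\<And>y. \<bar>g y\<bar> \<le> B"
      "\<And>t. t \<in> {0..T} \<Longrightarrow> AE x in lebesgue. norm x \<le> R \<longrightarrow> u t x = g (?V t x) * jac (?Y t) x"
      using rep[of R] by blast
    have B0: "0 \<le> B" using order.trans[OF abs_ge_zero g(2)] .
    obtain L where L0: "0 \<le> L" and LY: "\<And>t i. L-lipschitz_on UNIV (?Y t i)"
      by (rule flow_comp_uniform_lipschitz[OF T flow]) blast
    define c where "c = B * det_bound TYPE('n) L"
    let ?E = "\<lambda>t x. g (?V t x) * jac (?Y t) x"
    have Em: "?E t \<in> borel_measurable lebesgue" for t by (intro borel_measurable_times Vm g jac_measurable YL)
    have Eb: "AE x in lebesgue. \<bar>?E t x\<bar> \<le> c" for t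
      using jac_bounded[where f="?Y t", OF LY] by (rule eventually_mono) (use g(2) B0 in \<open>auto simp: c_def abs_mult intro!: mult_mono\<close>)
    have int: "integrable lebesgue (\<lambda>x. h x * ?E t x)" if "integrable lebesgue h" for h t
      by (rule integrable_mult_bounded[OF that Em Eb])
    have c0: "0 \<le> c" using B0 L0 by (simp add: c_def det_bound_def)
    have eq: "(\<integral>x. u t x * f x \<partial>lebesgue) = (\<integral>x. f x * ?E t x \<partial>lebesgue)" if t: "t \<in> {0..T}" for t
    proof (rule integral_cong_AE)
      show "(\<lambda>x. u t x * f x) \<in> borel_measurable lebesgue" using meas[OF t] f by auto
      show "(\<lambda>x. f x * ?E t x) \<in> borel_measurable lebesgue" using int[OF f] by auto
      show "AE x in lebesgue. u t x * f x = f x * ?E t x"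
        using g(3)[OF t]
      proof (rule eventually_mono)
        fix x assume "norm x \<le> R \<longrightarrow> u t x = g (?V t x) * jac (?Y t) x"
        then show "u t x * f x = f x * ?E t x" using R[of x] S(2) by (cases "x \<in> S") auto
      qed
    qed
    \<comment> \<open>Continuity in t is known for Lipschitz weights only. L1 approximation makes
      the convergence uniform in t, since \<open>?E t\<close> is bounded by c for all t.\<close>
    have "\<forall>n. \<exists>h. Lip h \<and> bsupp h \<and> (\<integral>x. \<bar>f x - h x\<bar> \<partial>lebesgue) < 1 / real (Suc n)"
      using integrable_imp_L1_approx[OF f] unfolding L1_approx_def by simp
    then obtain h where h: "\<And>n. Lip (h n)" "\<And>n. bsupp (h n)" "\<And>n. (\<integral>x. \<bar>f x - h n x\<bar> \<partial>lebesgue) < 1 / real (Suc n)" by metis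
    have "continuous_on {0..T} (\<lambda>t. \<integral>x. f x * ?E t x \<partial>lebesgue)"
    proof (rule uniform_limit_theorem[where F=sequentially])
      show "\<forall>\<^sub>F n in sequentially. continuous_on {0..T} (\<lambda>t. \<integral>x. h n x * ?E t x \<partial>lebesgue)"
      proof (intro always_eventually allI)
        fix n
        obtain R' where R': "\<And>x. R' \<le> norm x \<Longrightarrow> h n x = 0" using h(2)[of n] unfolding bsupp_def by blast
        interpret transport_test T a X "\<lambda>t. h n" "\<lambda>t x. 0" R'
          by unfold_locales (use T a flow R' h(1) in \<open>auto intro: Lip2_space\<close>)
        show "continuous_on {0..T} (\<lambda>t. \<integral>x. h n x * ?E t x \<partial>lebesgue)"
          using balanced_continuous[OF g(1,2)] by (simp add: P_def mult_ac)
      qed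
      show "uniform_limit {0..T} (\<lambda>n t. \<integral>x. h n x * ?E t x \<partial>lebesgue) (\<lambda>t. \<integral>x. f x * ?E t x \<partial>lebesgue) sequentially"
      proof (rule uniform_limitI)
        fix e :: real assume e: "e > 0"
        obtain N where N: "(c + 1) / e < real N" using reals_Archimedean2 by blast
        show "\<forall>\<^sub>F n in sequentially. \<forall>t\<in>{0..T}. dist (\<integral>x. h n x * ?E t x \<partial>lebesgue) (\<integral>x. f x * ?E t x \<partial>lebesgue) < e"
        proof (rule eventually_sequentiallyI[of N], intro ballI)
          fix n t assume n: "N \<le> n"
          have ih: "integrable lebesgue (h n)" by (rule Lip_bsupp_integrable[OF h(1,2)])
          have "\<bar>(\<integral>x. h n x * ?E t x \<partial>lebesgue) - (\<integral>x. f x * ?E t x \<partial>lebesgue)\<bar> = \<bar>\<integral>x. (h n x - f x) * ?E t x \<partial>lebesgue\<bar>"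
            using int[OF ih, of t] int[OF f, of t] by (simp add: left_diff_distrib)
          also have "\<dots> \<le> (\<integral>x. \<bar>(h n x - f x) * ?E t x\<bar> \<partial>lebesgue)" by (rule integral_abs_bound)
          also have "\<dots> \<le> (\<integral>x. c * \<bar>f x - h n x\<bar> \<partial>lebesgue)"
          proof (rule integral_mono_AE)
            show "AE x in lebesgue. \<bar>(h n x - f x) * ?E t x\<bar> \<le> c * \<bar>f x - h n x\<bar>"
              using Eb[of t]
            proof (rule eventually_mono)
              fix x assume "\<bar>?E t x\<bar> \<le> c"
              then have "\<bar>h n x - f x\<bar> * \<bar>?E t x\<bar> \<le> \<bar>h n x - f x\<bar> * c" by (intro mult_left_mono) auto
              then show "\<bar>(h n x - f x) * ?E t x\<bar> \<le> c * \<bar>f x - h n x\<bar>"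
                by (simp only: abs_mult[of "h n x - f x"] mult.commute[of c] abs_minus_commute[of "f x"])
            qed
          qed (use int[of "\<lambda>x. h n x - f x" t] ih f in auto)
          also have "\<dots> = c * (\<integral>x. \<bar>f x - h n x\<bar> \<partial>lebesgue)" by simp
          also have "\<dots> \<le> c * (1 / real (Suc n))" using c0 h(3)[of n] by (intro mult_left_mono) auto
          also have "\<dots> < e"
          proof -
            have "(c + 1) / e < real (Suc n)" using N n by simp
            then have "c + 1 < e * real (Suc n)" using e by (simp add: field_simps)
            then have "c < e * real (Suc n)" by simp
            then show ?thesis by (simp add: field_simps)
          qed
          finally show "dist (\<integral>x. h n x * ?E t x \<partial>lebesgue) (\<integral>x. f x * ?E t x \<partial>lebesgue) < e" by (simp add: dist_real_def)
        qed
      qed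
    qed simp
    then show "continuous_on {0..T} (\<lambda>t. \<integral>x. u t x * f x \<partial>lebesgue)"
      by (rule continuous_on_eq) (simp add: eq)
  qed
  have ds: "dist_solution T a u"
    unfolding dist_solution_def
  proof (intro allI impI)
    fix f :: "real \<times> (real^'n) \<Rightarrow> real" assume tf: "test_fn T f"
    obtain R where f: "Lip2 (\<lambda>t x. f (t, x))" "\<And>t x. R \<le> norm x \<Longrightarrow> f (t, x) = 0"
      "\<And>t x. t \<notin> {0<..<T} \<Longrightarrow> f (t, x) = 0"
      "\<And>t x v. t \<notin> {0<..<T} \<or> R \<le> norm x \<Longrightarrow> dd v f (t, x) = 0"
      "\<And>t x. ((\<lambda>s. f (s, x)) has_real_derivative dd (1, 0) f (t, x)) (at t)"
      by (rule test_fn_properties[OF tf]) blast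
    interpret transport_test T a X "\<lambda>t x. f (t, x)" "\<lambda>t x. dd (1, 0) f (t, x)" R
      by unfold_locales (use T a flow f(1,2,5) in auto)
    obtain g B where g: "g \<in> borel_measurable borel" "\<And>y. \<bar>g y\<bar> \<le> B"
      "\<And>t. t \<in> {0..T} \<Longrightarrow> AE x in lebesgue. norm x \<le> R \<longrightarrow> u t x = g (?V t x) * jac (?Y t) x"
      using rep[of R] by blast
    have gr: "grad (\<lambda>x. f (t, x)) x = (\<chi> j. dd (0, axis j 1) f (t, x))" for t x
      by (simp add: grad_def dd_def)
    let ?I = "\<lambda>t x. u t x * (dd (1, 0) f (t, x) + a t x \<bullet> (\<chi> j. dd (0, axis j 1) f (t, x)))"
    let ?G = "\<lambda>r. indicator {0<..<T} r * (\<integral>x. g (?V r x) * K r x \<partial>lebesgue) :: real"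
    have bal: "integrable lebesgue ?G"
      "(\<integral>x. g (?V T x) * P T x \<partial>lebesgue) - (\<integral>x. g (?V 0 x) * P 0 x \<partial>lebesgue) = integral\<^sup>L lebesgue ?G"
      using balanced_borel[OF g(1,2)] T unfolding balanced_def by auto
    \<comment> \<open>The test function vanishes at times 0 and T, so the left side of the balance
      is 0.\<close>
    have G0: "integral\<^sup>L lebesgue ?G = 0" using bal(2) f(3)[of T] f(3)[of 0] by (simp add: P_def)
    obtain C where C: "AE t in lebesgue. t \<in> {0<..<T} \<longrightarrow> integrable lebesgue (K t) \<and> (AE x in lebesgue. \<bar>K t x\<bar> \<le> C * indicator (cball 0 R) x)"
      using K_bound by blast
    have e: "AE t in lebesgue. ?G t = (\<integral>x. ?I t x \<partial>lebesgue)"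
      using C
    proof eventually_elim
      case (elim t)
      show ?case
      \<comment> \<open>The outer integral of the weak equation runs over all times; outside (0, T)
        the partial derivatives of the test function are 0.\<close>
      proof (cases "t \<in> {0<..<T}")
        case False
        then have "dd v f (t, x) = 0" for v x using f(4)[of t x] by blast
        then show ?thesis using False by (simp add: inner_vec_def)
      next
        case True
        then have iK: "integrable lebesgue (K t)" using elim by blast
        have ae: "AE x in lebesgue. g (?V t x) * K t x = ?I t x"
          using g(3)[of t]
        proof (rule eventually_mono)
          show "t \<in> {0..T}" using True by simp
          fix x assume *: "norm x \<le> R \<longrightarrow> u t x = g (?V t x) * jac (?Y t) x"
          show "g (?V t x) * K t x = ?I t x"
          proof (cases "norm x \<le> R")
            case True then show ?thesis using * by (simp add: K_def gr mult_ac)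
          next
            case False then show ?thesis using f(4)[of t x] by (simp add: K_def gr inner_vec_def)
          qed
        qed
        have "(\<integral>x. g (?V t x) * K t x \<partial>lebesgue) = (\<integral>x. ?I t x \<partial>lebesgue)"
          by (rule integrable_AE_eq(2)[OF gK_integrable[OF g(1,2) iK] ae])
        then show ?thesis using True by simp
      qed
    qed
    have "(\<integral>t. \<integral>x. ?I t x \<partial>lebesgue \<partial>lebesgue) = integral\<^sup>L lebesgue ?G"
      by (rule integrable_AE_eq(2)[OF bal(1) e, symmetric])
    then show "(\<integral>t. \<integral>x. ?I t x \<partial>lebesgue \<partial>lebesgue) = 0" using G0 by simp
  qed
  have final: "u t x = u T (X t x) * Jac X t x" for t x unfolding uT by (simp add: u_def)
  show "reversible T a u"
    unfolding reversible_def W_T_def by (intro conjI ballI exI[of _ X] loc wsc ds flow AE_I2 final)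
qed

text \<open>The solution comes with some flow Z of its own. First \<open>u T\<close> is exchanged
  for q under Z, which is legitimate where the Jacobian is nonzero, and then Z for X by
  \<open>flow_unique\<close>.\<close>

lemma reversible_formula:
  fixes a :: "real \<Rightarrow> real^'n \<Rightarrow> real^'n"
  assumes T: "0 < T" and a: "Linf_field T a" and u: "reversible T a u" "AE x in lebesgue. u T x = q x"
    and flow: "transport_flow T a X" and t: "t \<in> {0..T}"
  shows "AE x in lebesgue. u t x = q (X t x) * Jac X t x"
proof -
  obtain Z where Z: "transport_flow T a Z" "AE x in lebesgue. u t x = u T (Z t x) * Jac Z t x"
    using u(1) t unfolding reversible_def by blast
  from Z(2) AE_flow_composition[OF T a Z(1) t u(2)] flow_unique[OF T a Z(1) flow t]
  show ?thesis by eventually_elim auto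
qed

text \<open>Uniqueness and independence of the flow are both instances of
  \<open>reversible_formula\<close>: any two solutions are expressed through one flow fixed in
  advance.\<close>

theorem mainTheorem8:
  fixes T :: real and a :: "real \<Rightarrow> real^'n \<Rightarrow> real^'n" and \<pi>T :: "real^'n \<Rightarrow> real"
  assumes "0 < T"
    and "Linf_field T a"
    and "\<exists>X. transport_flow T a X"
    and "Linf_loc \<pi>T"
  shows "(\<exists>\<pi>. reversible T a \<pi> \<and> (AE x in lebesgue. \<pi> T x = \<pi>T x))
    \<and> (\<forall>\<pi>1 \<pi>2. reversible T a \<pi>1 \<and> (AE x in lebesgue. \<pi>1 T x = \<pi>T x)
          \<and> reversible T a \<pi>2 \<and> (AE x in lebesgue. \<pi>2 T x = \<pi>T x)
          \<longrightarrow> (\<forall>t\<in>{0..T}. AE x in lebesgue. \<pi>1 t x = \<pi>2 t x))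
    \<and> (\<forall>\<pi> X. reversible T a \<pi> \<and> (AE x in lebesgue. \<pi> T x = \<pi>T x) \<and> transport_flow T a X
          \<longrightarrow> (\<forall>t\<in>{0..T}. AE x in lebesgue. \<pi> t x = \<pi>T (X t x) * Jac X t x))"
proof (intro conjI allI impI ballI)
  obtain X where X: "transport_flow T a X" using assms(3) by blast
  note ex = reversible_existence[OF assms(1,2) X assms(4)]
  show "\<exists>\<pi>. reversible T a \<pi> \<and> (AE x in lebesgue. \<pi> T x = \<pi>T x)"
    using ex(1) fun_cong[OF ex(2)] by (intro exI[of _ "\<lambda>t x. \<pi>T (X t x) * Jac X t x"] conjI) auto
  {
    fix \<pi>1 \<pi>2 t
    assume *: "reversible T a \<pi>1 \<and> (AE x in lebesgue. \<pi>1 T x = \<pi>T x)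
          \<and> reversible T a \<pi>2 \<and> (AE x in lebesgue. \<pi>2 T x = \<pi>T x)" and t: "t \<in> {0..T}"
    have "AE x in lebesgue. \<pi>1 t x = \<pi>T (X t x) * Jac X t x" "AE x in lebesgue. \<pi>2 t x = \<pi>T (X t x) * Jac X t x"
      using * reversible_formula[OF assms(1,2) _ _ X t] by blast+
    then show "AE x in lebesgue. \<pi>1 t x = \<pi>2 t x" by eventually_elim simp
  }
  {
    fix \<pi> X t
    assume "reversible T a \<pi> \<and> (AE x in lebesgue. \<pi> T x = \<pi>T x) \<and> transport_flow T a X" "t \<in> {0..T}"
    then show "AE x in lebesgue. \<pi> t x = \<pi>T (X t x) * Jac X t x"
      using reversible_formula[OF assms(1,2)] by blast
  }
qed

end
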